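(* Let $\mathbb{K}$ be a commutative ring with unit. For all $n\geq 1$, the cohomology $h^\bullet(\Pi_2(n))$ is concentrated in degree $n-1$, and $h^{n-1}(\Pi_2(n))$ is a free $\mathbb{K}$-module of rank $$\mathrm{rk}\, h^{n-1}(\Pi_2(n)) = n!\,C_n,$$ where $C_n$ denotes the $n$th Catalan number. Furthermore, the $\mathfrak{S}_n$-module $h^{n-1}(\Pi_2(n))$ is isomorphic to the direct sum of $C_n$ copies of the regular representation.
   Context: A partition of $\{1,\dots,n\}$ is non-crossing if for any $i<j<k<l$, if $i,k$ are in the same block and $j,l$ are in the same block, then the four elements are in the same block. A non-crossing $2$-partition of $\{1,\dots,n\}$ is a triple $(\pi,\rho,f)$ where $\pi$ is a partition of $\{1,\dots,n\}$, $\rho$ is a non-crossing partition of $\{1,\dots,n\}$, and $f:\pi\to\rho$ is a bijection between the sets of blocks with $|f(T)|=|T|$ for all $T\in\pi$. $\Pi_2(n)$ is the poset of those, with $(\pi,\rho,f)\le(\pi',\rho',f')$ iff $\pi\le\pi'$, $\rho\le\rho'$ (where $\alpha\le\beta$ means that $\alpha$ is obtained by merging blocks of $\beta$), and for all $T\in\pi$, $T'\in\pi'$, $T'\subset T\Rightarrow f'(T')\subset f(T)$. The symmetric group $\mathfrak{S}_n$ acts on $\Pi_2(n)$ by permuting the elements of the set partitioned by $\pi$. For a finite poset $P$, $c^k(P)$ is the free $\mathbb{K}$-module on symbols $[x_0<\cdots<x_k]$ for chains with $x_0$ minimal and $x_k$ maximal in $P$, with $d[x_0<\cdots<x_k]=\sum_{i=1}^k(-1)^i\sum_{x_{i-1}<y<x_i}[\cdots<x_{i-1}<y<x_i<\cdots]$,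 and $h^\bullet(P)$ is its cohomology.
   Formalization: The Catalan numbers are counted from n = 1, so C_n = binom(2n-2, n-1)/n (1, 1, 2, 5, ...); with the usual C_n = binom(2n, n)/(n+1) the claim fails for n = 2, where the rank is 2 and not 4. The ring K is taken to be nonzero. *)

theory Defs
  imports
    "HOL-Library.Disjoint_Sets"
    "HOL-Combinatorics.Permutations"
    "HOL-Algebra.AbelCoset"
    "HOL-Algebra.Module"
    "HOL-Algebra.Sym_Groups"
    "HOL-Algebra.Algebraic_Closure_Type"
begin

section \<open>Modules over a commutative ring\<close>

text \<open>
  The scalars are a type of class \<open>comm_ring_1\<close>, regarded as a ring record through the library
  constant \<open>ring_of_type_algebra\<close>. The library represents modules by records that extend ring
  records; the fields \<open>mult\<close> and \<open>one\<close> of a module carry no information and are left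
  \<open>undefined\<close>.
\<close>

text \<open>The free module on a set \<open>S\<close> of symbols (used only for finite \<open>S\<close>, so that there is no
  condition of finite support): an element is its family of coefficients, which is zero outside
  of \<open>S\<close>.\<close>

definition free_module :: "'s set \<Rightarrow> ('k::comm_ring_1, 's \<Rightarrow> 'k) module" where
  "free_module S =
    \<lparr>carrier = {c. \<forall>s. s \<notin> S \<longrightarrow> c s = 0}, mult = undefined, one = undefined,
     zero = (\<lambda>_. 0), add = (\<lambda>c c' s. c s + c' s), module.smult = (\<lambda>a c s. a * c s)\<rparr>"

definition symbol :: "'s \<Rightarrow> 's \<Rightarrow> 'k::comm_ring_1" where
  "symbol s = (\<lambda>t. if t = s then 1 else 0)"

definition linear_extension :: "'s set \<Rightarrow> ('s \<Rightarrow> 't \<Rightarrow> 'k::comm_ring_1) \<Rightarrow> ('s \<Rightarrow> 'k) \<Rightarrow> 't \<Rightarrow> 'k" where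
  "linear_extension S g c = (\<lambda>t. \<Sum>s\<in>S. c s * g s t)"

text \<open>The scalar multiple of a coset \<open>N +> x\<close> is \<open>N +> a x\<close>; as in the library's multiplication of
  cosets of an ideal, it is written as a union over representatives.\<close>

definition quotient_module :: "('k, 'm) module \<Rightarrow> 'm set \<Rightarrow> ('k, 'm set) module" where
  "quotient_module M N =
    \<lparr>carrier = a_rcosets\<^bsub>M\<^esub> N, mult = undefined, one = undefined,
     zero = N, add = (\<lambda>C D. C <+>\<^bsub>M\<^esub> D),
     module.smult = (\<lambda>a C. \<Union>x\<in>C. N +>\<^bsub>M\<^esub> (a \<odot>\<^bsub>M\<^esub> x))\<rparr>"

definition direct_power :: "nat \<Rightarrow> ('k, 'm) module \<Rightarrow> ('k, nat \<Rightarrow> 'm) module" where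
  "direct_power r M =
    \<lparr>carrier = {..<r} \<rightarrow>\<^sub>E carrier M, mult = undefined, one = undefined,
     zero = (\<lambda>i\<in>{..<r}. \<zero>\<^bsub>M\<^esub>), add = (\<lambda>u v. \<lambda>i\<in>{..<r}. u i \<oplus>\<^bsub>M\<^esub> v i),
     module.smult = (\<lambda>a u. \<lambda>i\<in>{..<r}. a \<odot>\<^bsub>M\<^esub> u i)\<rparr>"

definition free_of_rank :: "('k::comm_ring_1, 'm) module \<Rightarrow> nat \<Rightarrow> bool" where
  "free_of_rank M r \<longleftrightarrow>
    module (ring_of_type_algebra :: 'k ring) M \<and>
    (\<exists>b \<in> {..<r} \<rightarrow> carrier M. \<forall>x \<in> carrier M.
       \<exists>!a. a \<in> extensional {..<r} \<and> x = (\<Oplus>\<^bsub>M\<^esub>i\<in>{..<r}. a i \<odot>\<^bsub>M\<^esub> b i))"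

text \<open>\<open>M\<close> and \<open>N\<close>, with \<open>G\<close> acting by \<open>\<alpha>\<close> and \<open>\<beta>\<close> respectively, are isomorphic as \<open>G\<close>-modules
  over the scalars.\<close>

definition isomorphic_reps ::
  "'g monoid \<Rightarrow> ('k::comm_ring_1, 'm) module \<Rightarrow> ('g \<Rightarrow> 'm \<Rightarrow> 'm)
    \<Rightarrow> ('k, 'v) module \<Rightarrow> ('g \<Rightarrow> 'v \<Rightarrow> 'v) \<Rightarrow> bool" where
  "isomorphic_reps G M \<alpha> N \<beta> \<longleftrightarrow>
    (\<exists>\<phi> \<in> iso (add_monoid M) (add_monoid N).
       (\<forall>a. \<forall>x \<in> carrier M. \<phi> (a \<odot>\<^bsub>M\<^esub> x) = a \<odot>\<^bsub>N\<^esub> \<phi> x) \<and>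
       (\<forall>g \<in> carrier G. \<forall>x \<in> carrier M. \<phi> (\<alpha> g x) = \<beta> g (\<phi> x)))"

definition regular_module :: "'g monoid \<Rightarrow> ('k::comm_ring_1, 'g \<Rightarrow> 'k) module" where
  "regular_module G = free_module (carrier G)"

definition regular_action :: "'g monoid \<Rightarrow> 'g \<Rightarrow> ('g \<Rightarrow> 'k::comm_ring_1) \<Rightarrow> 'g \<Rightarrow> 'k" where
  "regular_action G g = linear_extension (carrier G) (\<lambda>h. symbol (g \<otimes>\<^bsub>G\<^esub> h))"

definition power_action :: "nat \<Rightarrow> ('g \<Rightarrow> 'm \<Rightarrow> 'm) \<Rightarrow> 'g \<Rightarrow> (nat \<Rightarrow> 'm) \<Rightarrow> nat \<Rightarrow> 'm" where
  "power_action r \<beta> g u = (\<lambda>i\<in>{..<r}. \<beta> g (u i))"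


section \<open>Cohomology of a finite poset\<close>

text \<open>A finite poset is given by its set \<open>P\<close> of elements and its order relation \<open>R\<close>.\<close>

definition strictly_below :: "'p rel \<Rightarrow> 'p \<Rightarrow> 'p \<Rightarrow> bool" where
  "strictly_below R x y \<longleftrightarrow> (x, y) \<in> R \<and> x \<noteq> y"

definition minimal_in :: "'p set \<Rightarrow> 'p rel \<Rightarrow> 'p \<Rightarrow> bool" where
  "minimal_in P R x \<longleftrightarrow> x \<in> P \<and> \<not> (\<exists>y\<in>P. strictly_below R y x)"

definition maximal_in :: "'p set \<Rightarrow> 'p rel \<Rightarrow> 'p \<Rightarrow> bool" where
  "maximal_in P R x \<longleftrightarrow> x \<in> P \<and> \<not> (\<exists>y\<in>P. strictly_below R x y)"

text \<open>The symbol \<open>[x\<^sub>0 < \<dots> < x\<^sub>k]\<close> is the list \<open>[x\<^sub>0, \<dots>, x\<^sub>k]\<close> of length \<open>k + 1\<close>.\<close>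

definition full_chains :: "'p set \<Rightarrow> 'p rel \<Rightarrow> nat \<Rightarrow> 'p list set" where
  "full_chains P R k =
    {xs. length xs = Suc k \<and> set xs \<subseteq> P \<and> sorted_wrt (strictly_below R) xs \<and>
         minimal_in P R (hd xs) \<and> maximal_in P R (last xs)}"

definition cochains :: "'p set \<Rightarrow> 'p rel \<Rightarrow> nat \<Rightarrow> ('k::comm_ring_1, 'p list \<Rightarrow> 'k) module" where
  "cochains P R k = free_module (full_chains P R k)"

definition symbol_coboundary :: "'p set \<Rightarrow> 'p rel \<Rightarrow> 'p list \<Rightarrow> 'p list \<Rightarrow> 'k::comm_ring_1" where
  "symbol_coboundary P R xs = (\<lambda>zs.
    \<Sum>i\<in>{1..<length xs}. (-1) ^ i *
      (\<Sum>y\<in>{y \<in> P. strictly_below R (xs ! (i - 1)) y \<and> strictly_below R y (xs ! i)}.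
        symbol (take i xs @ y # drop i xs) zs))"

definition coboundary ::
  "'p set \<Rightarrow> 'p rel \<Rightarrow> nat \<Rightarrow> ('p list \<Rightarrow> 'k::comm_ring_1) \<Rightarrow> 'p list \<Rightarrow> 'k" where
  "coboundary P R k = linear_extension (full_chains P R k) (symbol_coboundary P R)"

definition cocycles :: "'p set \<Rightarrow> 'p rel \<Rightarrow> nat \<Rightarrow> ('p list \<Rightarrow> 'k::comm_ring_1) set" where
  "cocycles P R k = {c \<in> carrier (cochains P R k). coboundary P R k c = (\<lambda>_. 0)}"

fun coboundaries :: "'p set \<Rightarrow> 'p rel \<Rightarrow> nat \<Rightarrow> ('p list \<Rightarrow> 'k::comm_ring_1) set" where
  "coboundaries P R 0 = {\<lambda>_. 0}"
| "coboundaries P R (Suc k) = coboundary P R k ` carrier (cochains P R k)"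

definition cohomology ::
  "'p set \<Rightarrow> 'p rel \<Rightarrow> nat \<Rightarrow> ('k::comm_ring_1, ('p list \<Rightarrow> 'k) set) module" where
  "cohomology P R k =
    quotient_module ((cochains P R k)\<lparr>carrier := cocycles P R k\<rparr>) (coboundaries P R k)"

text \<open>An action \<open>\<gamma>\<close> on the poset induces actions on chains, on cochains and on cohomology classes;
  as a class is a coset of cocycles, its image under a group element is the setwise image.\<close>

definition cochain_action ::
  "'p set \<Rightarrow> 'p rel \<Rightarrow> nat \<Rightarrow> ('g \<Rightarrow> 'p \<Rightarrow> 'p) \<Rightarrow> 'g \<Rightarrow> ('p list \<Rightarrow> 'k::comm_ring_1) \<Rightarrow> 'p list \<Rightarrow> 'k" where
  "cochain_action P R k \<gamma> g = linear_extension (full_chains P R k) (\<lambda>xs. symbol (map (\<gamma> g) xs))"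

definition cohomology_action ::
  "'p set \<Rightarrow> 'p rel \<Rightarrow> nat \<Rightarrow> ('g \<Rightarrow> 'p \<Rightarrow> 'p)
    \<Rightarrow> 'g \<Rightarrow> ('p list \<Rightarrow> 'k::comm_ring_1) set \<Rightarrow> ('p list \<Rightarrow> 'k) set" where
  "cohomology_action P R k \<gamma> g C = cochain_action P R k \<gamma> g ` C"


section \<open>Non-crossing 2-partitions\<close>

definition noncrossing :: "nat set set \<Rightarrow> bool" where
  "noncrossing \<rho> \<longleftrightarrow>
    (\<forall>i j k l. \<forall>S\<in>\<rho>. \<forall>T\<in>\<rho>.
       i < j \<and> j < k \<and> k < l \<and> i \<in> S \<and> k \<in> S \<and> j \<in> T \<and> l \<in> T \<longrightarrow> S = T)"

type_synonym two_partition = "nat set set \<times> nat set set \<times> (nat set \<Rightarrow> nat set)"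

text \<open>The bijection between the blocks is taken extensional on \<open>\<pi>\<close>, so that a triple is
  determined by its mathematical data.\<close>

definition nc2_partitions :: "nat \<Rightarrow> two_partition set" where
  "nc2_partitions n =
    {(\<pi>, \<rho>, f). partition_on {1..n} \<pi> \<and> partition_on {1..n} \<rho> \<and> noncrossing \<rho> \<and>
       f \<in> extensional \<pi> \<and> bij_betw f \<pi> \<rho> \<and> (\<forall>T\<in>\<pi>. card (f T) = card T)}"

text \<open>Smaller partitions are coarser: \<open>\<alpha> \<le> \<beta>\<close> means that \<open>\<alpha>\<close> arises by merging blocks of \<open>\<beta>\<close>,
  that is, that \<open>\<beta>\<close> refines \<open>\<alpha>\<close>. So the partition with only one block is the least one.\<close>

definition nc2_order :: "nat \<Rightarrow> two_partition rel" where
  "nc2_order n =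
    {((\<pi>, \<rho>, f), (\<pi>', \<rho>', f')).
       (\<pi>, \<rho>, f) \<in> nc2_partitions n \<and> (\<pi>', \<rho>', f') \<in> nc2_partitions n \<and>
       refines {1..n} \<pi>' \<pi> \<and> refines {1..n} \<rho>' \<rho> \<and>
       (\<forall>T\<in>\<pi>. \<forall>T'\<in>\<pi>'. T' \<subseteq> T \<longrightarrow> f' T' \<subseteq> f T)}"

text \<open>A permutation \<open>\<sigma>\<close> sends \<open>(\<pi>, \<rho>, f)\<close> to \<open>(\<sigma> \<pi>, \<rho>, f \<circ> \<sigma>\<inverse>)\<close>.\<close>

definition nc2_action :: "(nat \<Rightarrow> nat) \<Rightarrow> two_partition \<Rightarrow> two_partition" where
  "nc2_action \<sigma> = (\<lambda>(\<pi>, \<rho>, f).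
    ((`) \<sigma> ` \<pi>, \<rho>, restrict (\<lambda>S. f (\<sigma> -` S)) ((`) \<sigma> ` \<pi>)))"

text \<open>The Catalan numbers counted from \<open>n = 1\<close>, namely \<open>1, 1, 2, 5, 14, \<dots>\<close>. With the other usual
  indexing \<open>(2n choose n) / (n + 1)\<close> this is the number of index \<open>n - 1\<close>. It is the indexing
  for which the rank of the cohomology is \<open>n! C\<^sub>n\<close>: for \<open>n = 2\<close> the poset has one minimal and two
  maximal elements and no other elements, hence rank 2.\<close>

definition catalan :: "nat \<Rightarrow> nat" where
  "catalan n = ((2 * n - 2) choose (n - 1)) div n"

end

theory Submission
  imports Defs
begin

text \<open>
  The poset has one minimal element, its maximal elements are the permutations, and an element below
  a permutation is determined by its non-crossing partition. Label an element by the set of minima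
  of the blocks of that partition. If \<open>x < z\<close> and \<open>m\<close> is the smallest label of \<open>z\<close> that \<open>x\<close> lacks,
  there is exactly one element of \<open>[x, z]\<close> that has all labels of \<open>z\<close> but \<open>m\<close>. Inserting and
  deleting these elements defines an acyclic matching on the chains from a minimal to a maximal
  element, and the unmatched chains are the maximal chains that add the labels \<open>2, \<dots>, n\<close> in
  increasing order. So the cohomology vanishes except in degree \<open>n - 1\<close>, where the classes of these
  rising chains form a basis. The symmetric group permutes this basis freely, because it acts freely
  on the maximal elements, and the rising chains below a fixed permutation correspond to increasing
  non-crossing trees, of which there are a Catalan number.
\<close>

section \<open>Acyclic matchings\<close>

text \<open>Only the smallest missing label can be removed without choice. For n = 3, above the
  one-block partition, both {1,3},{2} and {1},{2,3} have labels {1,2}, so neither adding 2 at the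
  bottom nor removing 3 at the top is unique. Removing the smallest missing \<open>m\<close> is
  rigid: its block has to be merged into a block with smaller minimum, and \<open>x\<close> already
  has all those smaller minima as labels, so \<open>x\<close> dictates the target. This is why
  coatoms are toggled. The coatom may however coincide with the lower end of the step, where it
  cannot be toggled; these are the rising steps, and an initial run of them is skipped. Acyclicity
  comes from a lexicographic weight: first the number of initial rising steps, then the number of
  labels missing at the first element that has \<open>m\<close>. Since the scalars form an arbitrary
  commutative ring, there is no dimension count. What is used is that the coboundary from free
  chains to their partners is triangular with diagonal entries 1 or -1, hence both injective and
  surjective.\<close>

definition omit :: "nat \<Rightarrow> 'a list \<Rightarrow> 'a list" where
  "omit i xs = take i xs @ drop (Suc i) xs"

lemma omit_Suc_Cons [simp]: "omit (Suc i) (x # xs) = x # omit i xs"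
  by (simp add: omit_def)

lemma omit_0_Cons [simp]: "omit 0 (x # xs) = xs"
  by (simp add: omit_def)

lemma omit_map: "omit i (map f xs) = map f (omit i xs)"
  by (simp add: omit_def take_map drop_map)

lemma omit_omit:
  "\<lbrakk>j < i; i < length xs\<rbrakk> \<Longrightarrow> omit j (omit i xs) = omit (i - 1) (omit j xs)"
proof (induction xs arbitrary: i j)
  case (Cons x xs)
  then obtain i' where i': "i = Suc i'" by (cases i) auto
  show ?case
  proof (cases j)
    case (Suc j')
    then obtain i'' where "i' = Suc i''" using Cons.prems i' by (cases i') auto
    then show ?thesis using Cons.IH[of j' i'] Cons.prems i' Suc by simp
  qed (simp add: i')
qed simp

text \<open>The coefficient of \<open>b\<close> in the coboundary of \<open>c\<close>, for a chain \<open>b\<close> of length \<open>k + 2\<close>.\<close>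

definition alt_sum :: "nat \<Rightarrow> ('a list \<Rightarrow> 'k::comm_ring_1) \<Rightarrow> 'a list \<Rightarrow> 'k" where
  "alt_sum k c b = (\<Sum>i\<in>{1..k}. (-1) ^ i * c (omit i b))"

lemma alt_sum_add: "alt_sum k (\<lambda>x. c x + c' x) b = alt_sum k c b + alt_sum k c' b"
  by (simp add: alt_sum_def algebra_simps sum.distrib)

lemma alt_sum_diff: "alt_sum k (\<lambda>x. c x - c' x) b = alt_sum k c b - alt_sum k c' b"
  by (simp add: alt_sum_def algebra_simps sum_subtractf)

lemma alt_sum_scale: "alt_sum k (\<lambda>x. a * c x) b = a * alt_sum k c b"
  by (simp add: alt_sum_def algebra_simps sum_distrib_left)

text \<open>The identity d d = 0: removing position \<open>i\<close> and then a smaller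
  \<open>j\<close> is the same as removing \<open>j\<close> and then \<open>i - 1\<close>, and these
  two index pairs carry opposite signs.\<close>

lemma alt_sum_alt_sum:
  assumes "length b = k + 3"
  shows "alt_sum (Suc k) (alt_sum k c) b = 0"
proof -
  define t where "t = (\<lambda>(i, j). (-1) ^ i * ((-1) ^ j * c (omit j (omit i b))))"
  define lower where "lower = {(i, j). 1 \<le> j \<and> j < i \<and> i \<le> Suc k}"
  define upper where "upper = {(i, j). 1 \<le> i \<and> i \<le> j \<and> j \<le> k}"
  have fin: "finite lower" "finite upper"
    by (rule finite_subset[of _ "{0..Suc k} \<times> {0..Suc k}"]; force simp: lower_def upper_def)+
  have "alt_sum (Suc k) (alt_sum k c) b = sum t ({1..Suc k} \<times> {1..k})"
    by (simp add: alt_sum_def t_def sum.cartesian_product sum_distrib_left)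
  also have "{1..Suc k} \<times> {1..k} = lower \<union> upper"
    by (auto simp: lower_def upper_def)
  also have "sum t (lower \<union> upper) = sum t lower + sum t upper"
    by (rule sum.union_disjoint) (use fin in \<open>auto simp: lower_def upper_def\<close>)
  also have "sum t lower = (\<Sum>x\<in>upper. - t x)"
  proof (rule sum.reindex_bij_witness[of _ "\<lambda>(i, j). (j + 1, i)" "\<lambda>(i, j). (j, i - 1)"])
    fix x assume x: "x \<in> lower"
    then obtain i j where ij: "x = (i, j)" "1 \<le> j" "j < i" "i \<le> Suc k" by (auto simp: lower_def)
    then obtain i' where i': "i = Suc i'" by (cases i) auto
    have "omit j (omit i b) = omit (i - 1) (omit j b)"
      using ij assms by (intro omit_omit) auto
    then show "- t (case x of (i, j) \<Rightarrow> (j, i - 1)) = t x"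
      by (simp add: t_def ij i' algebra_simps)
  qed (auto simp: lower_def upper_def)
  finally show ?thesis by (simp add: sum_negf)
qed

text \<open>The matrix with rows \<open>\<phi> a\<close> and columns \<open>a\<close> is triangular
  in the order of \<open>w\<close>, with 1 or -1 on the diagonal, so its kernel is trivial over
  every commutative ring. Induction on the weight clears all columns of a row but the pivot.\<close>

lemma alt_sum_zero_matched:
  fixes c :: "'a list \<Rightarrow> 'k::comm_ring_1"
  assumes pivot: "\<And>a. a \<in> A \<Longrightarrow> \<exists>j\<in>{1..k}. omit j (\<phi> a) = a \<and>
      (\<forall>i\<in>{1..k} - {j}. omit i (\<phi> a) \<in> A \<longrightarrow> (w (omit i (\<phi> a)) :: nat) < w a)"
    and supp: "\<And>x. x \<notin> A \<Longrightarrow> c x = 0"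
    and zero: "\<And>a. a \<in> A \<Longrightarrow> alt_sum k c (\<phi> a) = 0"
  shows "c a = 0"
proof (cases "a \<in> A")
  case True
  then show ?thesis
  proof (induction "w a" arbitrary: a rule: less_induct)
    case less
    obtain j where j: "j \<in> {1..k}" "omit j (\<phi> a) = a"
      and lt: "\<And>i. i \<in> {1..k} - {j} \<Longrightarrow> omit i (\<phi> a) \<in> A \<Longrightarrow> w (omit i (\<phi> a)) < w a"
      using pivot[OF less.prems] by blast
    have "(\<Sum>i\<in>{1..k} - {j}. (-1) ^ i * c (omit i (\<phi> a))) = 0"
    proof (rule sum.neutral, rule ballI)
      fix i assume "i \<in> {1..k} - {j}"
      then show "(-1) ^ i * c (omit i (\<phi> a)) = 0"
        using lt[of i] less.hyps[of "omit i (\<phi> a)"] supp[of "omit i (\<phi> a)"]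
        by (cases "omit i (\<phi> a) \<in> A") auto
    qed
    then have "(-1) ^ j * c a = 0"
      using zero[OF less.prems] j
        sum.remove[OF _ j(1), of "\<lambda>i. (-1) ^ i * c (omit i (\<phi> a))"] by (simp add: alt_sum_def)
    then have "(-1) ^ j * ((-1) ^ j * c a) = 0" by simp
    then show ?case by (simp flip: mult.assoc power_add)
  qed
qed (rule supp)

text \<open>The same triangular matrix is surjective, by forward substitution through increasing
  weights, one weight per induction step.\<close>

lemma alt_sum_solve_matched:
  fixes g :: "'a list \<Rightarrow> 'k::comm_ring_1"
  assumes pivot: "\<And>a. a \<in> A \<Longrightarrow> \<exists>j\<in>{1..k}. omit j (\<phi> a) = a \<and>
      (\<forall>i\<in>{1..k} - {j}. omit i (\<phi> a) \<in> A \<longrightarrow> (w (omit i (\<phi> a)) :: nat) < w a)"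
    and bounded: "\<And>a. a \<in> A \<Longrightarrow> w a < N"
  obtains c where "\<And>x. x \<notin> A \<Longrightarrow> c x = 0" "\<And>a. a \<in> A \<Longrightarrow> alt_sum k c (\<phi> a) = g (\<phi> a)"
proof -
  have "\<exists>c. (\<forall>x. x \<notin> A \<longrightarrow> c x = 0) \<and> (\<forall>a\<in>A. w a < m \<longrightarrow> alt_sum k c (\<phi> a) = g (\<phi> a))" for m
  proof (induction m)
    case 0
    show ?case by (intro exI[of _ "\<lambda>_. 0"]) auto
  next
    case (Suc m)
    then obtain c where c: "\<And>x. x \<notin> A \<Longrightarrow> c x = 0"
        "\<And>a. a \<in> A \<Longrightarrow> w a < m \<Longrightarrow> alt_sum k c (\<phi> a) = g (\<phi> a)" by blast
    define J where "J a = (SOME j. j \<in> {1..k} \<and> omit j (\<phi> a) = a \<and>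
      (\<forall>i\<in>{1..k} - {j}. omit i (\<phi> a) \<in> A \<longrightarrow> w (omit i (\<phi> a)) < w a))" for a
    have J: "J a \<in> {1..k}" "omit (J a) (\<phi> a) = a"
      "\<And>i. i \<in> {1..k} - {J a} \<Longrightarrow> omit i (\<phi> a) \<in> A \<Longrightarrow> w (omit i (\<phi> a)) < w a" if "a \<in> A" for a
      using someI_ex[OF pivot[OF that, unfolded Bex_def]] unfolding J_def[of a, symmetric] by blast+
    \<comment> \<open>The correction is supported on weight \<open>m\<close>. A row of weight at
      most \<open>m\<close> can meet it only in its pivot, since its other columns have smaller
      weight; so rows solved earlier stay solved.\<close>
    define \<delta> where
      "\<delta> a = (if a \<in> A \<and> w a = m then (-1) ^ J a * (g (\<phi> a) - alt_sum k c (\<phi> a)) else 0)" for a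
    have "alt_sum k (\<lambda>x. c x + \<delta> x) (\<phi> a) = g (\<phi> a)" if a: "a \<in> A" "w a < Suc m" for a
    proof -
      have "(\<Sum>i\<in>{1..k} - {J a}. (-1) ^ i * \<delta> (omit i (\<phi> a))) = 0"
      proof (rule sum.neutral, rule ballI)
        fix i assume "i \<in> {1..k} - {J a}"
        then show "(-1) ^ i * \<delta> (omit i (\<phi> a)) = 0"
          using J(3)[OF a(1), of i] a(2) by (auto simp: \<delta>_def)
      qed
      then have "alt_sum k \<delta> (\<phi> a) = (-1) ^ J a * \<delta> a"
        using J(1,2)[OF a(1)] sum.remove[OF _ J(1)[OF a(1)], of "\<lambda>i. (-1) ^ i * \<delta> (omit i (\<phi> a))"]
        by (simp add: alt_sum_def)
      also have "\<dots> = (if w a = m then g (\<phi> a) - alt_sum k c (\<phi> a) else 0)"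
        using a(1) by (simp add: \<delta>_def flip: mult.assoc power_add)
      finally show ?thesis
        using c(2)[OF a(1)] a(2) by (auto simp: alt_sum_add)
    qed
    moreover have "c x + \<delta> x = 0" if "x \<notin> A" for x
      using that c(1) by (simp add: \<delta>_def)
    ultimately show ?case by (intro exI[of _ "\<lambda>x. c x + \<delta> x"]) blast
  qed
  from this[of N] show thesis using that bounded by blast
qed

text \<open>Insertion of one element strictly between the two ends, as in the coboundary, in
  recursive form: the matching is analysed by induction along a chain rather than by
  positions.\<close>

inductive insertion :: "'a list \<Rightarrow> 'a list \<Rightarrow> bool" where
  here: "insertion (x # y # xs) (x # v # y # xs)"
| there: "insertion xs zs \<Longrightarrow> insertion (x # xs) (x # zs)"

lemma insertion_omit:
  "\<lbrakk>1 \<le> i; i < length zs - 1\<rbrakk> \<Longrightarrow> insertion (omit i zs) zs"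
proof (induction zs arbitrary: i)
  case (Cons z zs)
  show ?case
  proof (cases "i = 1")
    case True
    then obtain v y xs where "zs = v # y # xs"
      using Cons.prems by (metis One_nat_def Suc_less_eq length_Cons length_0_conv less_nat_zero_code
          list.exhaust diff_Suc_1 list.size(3) not_less_iff_gr_or_eq)
    then show ?thesis using True by (simp add: insertion.here)
  next
    case False
    then obtain i' where "i = Suc i'" "1 \<le> i'" using Cons.prems by (cases i) auto
    then show ?thesis using Cons by (auto intro!: insertion.there)
  qed
qed simp

lemma omit_insertion:
  "insertion xs zs \<Longrightarrow> \<exists>i. 1 \<le> i \<and> i < length zs - 1 \<and> omit i zs = xs"
proof (induction rule: insertion.induct)
  case (here x y xs v)
  show ?case by (rule exI[of _ 1]) simp
next
  case (there xs zs x)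
  then obtain i where "1 \<le> i" "i < length zs - 1" "omit i zs = xs" by blast
  then show ?case by (intro exI[of _ "Suc i"]) auto
qed

lemma insertion_simps:
  "insertion (x # y # xs) zs \<longleftrightarrow> (\<exists>v. zs = x # v # y # xs) \<or> (\<exists>zs'. zs = x # zs' \<and> insertion (y # xs) zs')"
  "\<not> insertion [] zs"
  "\<not> insertion [x] zs"
proof -
  show nil: "\<not> insertion [] zs" for zs :: "'b list"
    by (auto elim: insertion.cases)
  show "\<not> insertion [x] zs" for zs
    using nil by (auto elim: insertion.cases)
  show "insertion (x # y # xs) zs \<longleftrightarrow> (\<exists>v. zs = x # v # y # xs) \<or> (\<exists>zs'. zs = x # zs' \<and> insertion (y # xs) zs')"
    by (subst insertion.simps) auto
qed

lemma insertion_hd: "insertion xs zs \<Longrightarrow> hd zs = hd xs"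
  by (induction rule: insertion.induct) auto

lemma insertion_last: "insertion xs zs \<Longrightarrow> last zs = last xs"
  by (induction rule: insertion.induct) (auto elim: insertion.cases)

lemma length_insertion: "insertion xs zs \<Longrightarrow> length zs = Suc (length xs)"
  by (induction rule: insertion.induct) auto

text \<open>The set of remaining elements reveals which one was removed. This keeps the different
  faces of a chain apart.\<close>

lemma omit_eq_imp_eq:
  assumes "distinct zs" "i < length zs" "j < length zs" "omit i zs = omit j zs"
  shows "i = j"
proof (rule ccontr)
  assume "i \<noteq> j"
  have *: "set (omit i zs) = set zs - {zs ! i}" if "i < length zs" for i
  proof -
    have "zs = take i zs @ zs ! i # drop (Suc i) zs" by (rule id_take_nth_drop[OF that])
    then show ?thesis using assms(1) unfolding omit_def
      by (metis Diff_insert_absorb Un_insert_right distinct_append distinct.simps(2) list.simps(15)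
          not_distinct_conv_prefix set_append UnE)
  qed
  have "zs ! i \<in> set zs - {zs ! j}"
    using assms \<open>i \<noteq> j\<close> by (auto simp: nth_eq_iff_index_eq)
  then show False using *[OF assms(2)] *[OF assms(3)] assms(4) by auto
qed

lemma insertion_Cons: "insertion (y # zs) bs \<Longrightarrow> \<exists>ws. bs = y # ws"
  by (auto elim: insertion.cases)

section \<open>Graded posets with unique rising chains\<close>

text \<open>\<open>M\<close> gives the labels and \<open>r\<close> is the number of labels that a
  chain from bottom to top has to add. In \<open>unique_last_step\<close> the element
  \<open>y\<close> may be \<open>x\<close> itself; this happens exactly when
  \<open>M x = M z - {m}\<close>.\<close>

locale rising_poset =
  fixes P :: "'p set" and R :: "'p rel" and M :: "'p \<Rightarrow> nat set" and L :: "nat set" and r :: nat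
  assumes finite_P: "finite P" and finite_L: "finite L"
    and R_trans: "\<lbrakk>(x, y) \<in> R; (y, z) \<in> R\<rbrakk> \<Longrightarrow> (x, z) \<in> R"
    and R_antisym: "\<lbrakk>(x, y) \<in> R; (y, x) \<in> R\<rbrakk> \<Longrightarrow> x = y"
    and M_subset: "x \<in> P \<Longrightarrow> M x \<subseteq> L"
    and M_strict_mono: "\<lbrakk>x \<in> P; y \<in> P; strictly_below R x y\<rbrakk> \<Longrightarrow> M x \<subset> M y"
    and M_maximal: "maximal_in P R x \<Longrightarrow> M x = L"
    and M_minimal: "minimal_in P R x \<Longrightarrow> card (L - M x) = r"
    and unique_last_step:
      "\<lbrakk>x \<in> P; z \<in> P; strictly_below R x z; m \<in> M z - M x; \<And>k. k \<in> M z \<Longrightarrow> k < m \<Longrightarrow> k \<in> M x\<rbrakk>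
        \<Longrightarrow> \<exists>!y. y \<in> P \<and> (x, y) \<in> R \<and> (y, z) \<in> R \<and> M y = M z - {m}"
begin

abbreviation below :: "'p \<Rightarrow> 'p \<Rightarrow> bool" (infix "\<prec>" 50) where
  "x \<prec> y \<equiv> strictly_below R x y"

lemma card_M_strict_mono: "\<lbrakk>x \<in> P; y \<in> P; x \<prec> y\<rbrakk> \<Longrightarrow> card (M x) < card (M y)"
  using M_strict_mono[of x y] M_subset[of y] finite_L by (simp add: psubset_card_mono finite_subset)

lemma below_trans: "\<lbrakk>x \<prec> y; y \<prec> z\<rbrakk> \<Longrightarrow> x \<prec> z"
  unfolding strictly_below_def by (metis R_trans R_antisym)

text \<open>A predicate instead of the value \<open>next_label x\<close>, so that one
  \<open>m\<close> can be carried up a chain for as long as the elements lack it.\<close>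

definition first_label :: "nat \<Rightarrow> 'p \<Rightarrow> bool" where
  "first_label m x \<longleftrightarrow> m \<in> L - M x \<and> (\<forall>k\<in>L. k < m \<longrightarrow> k \<in> M x)"

abbreviation next_label :: "'p \<Rightarrow> nat" where
  "next_label x \<equiv> Min (L - M x)"

abbreviation rising_step :: "'p \<Rightarrow> 'p \<Rightarrow> bool" where
  "rising_step x y \<equiv> M y = insert (next_label x) (M x)"

definition last_step :: "nat \<Rightarrow> 'p \<Rightarrow> 'p \<Rightarrow> 'p" where
  "last_step m x z = (THE y. y \<in> P \<and> (x, y) \<in> R \<and> (y, z) \<in> R \<and> M y = M z - {m})"

text \<open>The lower end is arbitrary, so that nonempty tails of chains are chains and recursion
  can strip the first element. The full label set at the top guarantees that every missing label is
  acquired somewhere.\<close>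

definition chain :: "'p list \<Rightarrow> bool" where
  "chain xs \<longleftrightarrow> xs \<noteq> [] \<and> set xs \<subseteq> P \<and> sorted_wrt (\<prec>) xs \<and> M (last xs) = L"

text \<open>As in \<open>deletable\<close>, what decides is the first element having
  \<open>m\<close>: the coatom without \<open>m\<close> is present iff it is the predecessor of that
  element.\<close>

fun insertable :: "nat \<Rightarrow> 'p list \<Rightarrow> bool" where
  "insertable m (x # y # zs) = (if m \<in> M y then M x \<noteq> M y - {m} else insertable m (y # zs))"
| "insertable m _ = False"

fun deletable :: "nat \<Rightarrow> 'p list \<Rightarrow> bool" where
  "deletable m (x # y # zs) = (if m \<in> M y then M x = M y - {m} else deletable m (y # zs))"
| "deletable m _ = False"

fun fill :: "nat \<Rightarrow> 'p list \<Rightarrow> 'p list" where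
  "fill m (x # y # zs) = (if m \<in> M y then x # last_step m x y # y # zs else x # fill m (y # zs))"
| "fill m xs = xs"

text \<open>An element having \<open>m\<close> that is inserted further down becomes the new first
  one and raises this number, whereas inserting the coatom without \<open>m\<close> leaves it
  unchanged.\<close>

fun gap_weight :: "nat \<Rightarrow> 'p list \<Rightarrow> nat" where
  "gap_weight m (x # y # zs) = (if m \<in> M y then card L - card (M y) else gap_weight m (y # zs))"
| "gap_weight m _ = 0"

fun rising :: "'p list \<Rightarrow> bool" where
  "rising (x # y # zs) \<longleftrightarrow> rising_step x y \<and> rising (y # zs)"
| "rising _ = True"

text \<open>A chain that is not rising is split at its first step that is not rising. With \<open>m\<close> the label
  that this step should have had, the chain is matched by toggling the coatom without label \<open>m\<close>
  below the first element that has label \<open>m\<close>.\<close>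

fun free_side :: "'p list \<Rightarrow> bool" where
  "free_side (x # y # zs) =
    (if rising_step x y then free_side (y # zs) else insertable (next_label x) (x # y # zs))"
| "free_side _ = False"

fun filled_side :: "'p list \<Rightarrow> bool" where
  "filled_side (x # y # zs) =
    (if rising_step x y then filled_side (y # zs) else deletable (next_label x) (x # y # zs))"
| "filled_side _ = False"

fun partner :: "'p list \<Rightarrow> 'p list" where
  "partner (x # y # zs) =
    (if rising_step x y then x # partner (y # zs) else fill (next_label x) (x # y # zs))"
| "partner xs = xs"

text \<open>Lexicographic order as one number: gap weights are at most \<open>card L\<close>, so an
  additional rising step, worth \<open>Suc (card L)\<close>, outweighs any of them.\<close>

fun weight :: "'p list \<Rightarrow> nat" where
  "weight (x # y # zs) =
    (if rising_step x y then Suc (card L) + weight (y # zs) else gap_weight (next_label x) (x # y # zs))"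
| "weight _ = 0"

section \<open>Labels along a chain, and the coatom that removes one label\<close>

lemma chain_Cons [simp]: "chain (x # y # zs) \<longleftrightarrow> x \<in> P \<and> x \<prec> y \<and> chain (y # zs)"
  using below_trans[of x y] by (auto simp: chain_def)

lemma chain_singleton [simp]: "chain [x] \<longleftrightarrow> x \<in> P \<and> M x = L"
  by (auto simp: chain_def)

lemma not_chain_Nil [simp]: "\<not> chain []"
  by (simp add: chain_def)

lemma chain_hd: "chain (x # xs) \<Longrightarrow> x \<in> P"
  by (simp add: chain_def)

lemma first_label_next:
  assumes "x \<in> P" "y \<in> P" "x \<prec> y"
  shows "first_label (next_label x) x"
proof -
  have "L - M x \<noteq> {}" using M_strict_mono[OF assms] M_subset[OF assms(2)] by blast
  then have "next_label x \<in> L - M x" using finite_L by (intro Min_in) auto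
  moreover have "k \<in> M x" if "k \<in> L" "k < next_label x" for k
    using that finite_L Min_le[of "L - M x" k] by (metis DiffI finite_Diff leD)
  ultimately show ?thesis by (auto simp: first_label_def)
qed

lemma first_label_above:
  "\<lbrakk>first_label m x; x \<in> P; y \<in> P; x \<prec> y; m \<notin> M y\<rbrakk> \<Longrightarrow> first_label m y"
  using M_strict_mono[of x y] unfolding first_label_def by auto

text \<open>Rising means that the coatom for the next label is the lower end of the step itself, so
  that there is nothing to toggle inside the step.\<close>

lemma rising_step_iff:
  assumes "x \<in> P" "y \<in> P" "x \<prec> y"
  shows "rising_step x y \<longleftrightarrow> next_label x \<in> M y \<and> M x = M y - {next_label x}"
  using first_label_next[OF assms] M_strict_mono[OF assms] by (auto simp: first_label_def)

context
  fixes m x z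
  assumes xz: "x \<in> P" "z \<in> P" "x \<prec> z" and m: "first_label m x" "m \<in> M z"
begin

lemma ex1_last_step: "\<exists>!y. y \<in> P \<and> (x, y) \<in> R \<and> (y, z) \<in> R \<and> M y = M z - {m}"
  by (rule unique_last_step) (use xz m M_subset in \<open>auto simp: first_label_def\<close>)

lemma last_step:
  "last_step m x z \<in> P" "(x, last_step m x z) \<in> R" "(last_step m x z, z) \<in> R"
  "M (last_step m x z) = M z - {m}"
  using theI'[OF ex1_last_step] by (simp_all add: last_step_def)

lemma last_step_eqI: "\<lbrakk>y \<in> P; x \<prec> y; y \<prec> z; M y = M z - {m}\<rbrakk> \<Longrightarrow> y = last_step m x z"
  unfolding last_step_def by (rule the1_equality[OF ex1_last_step, symmetric]) (simp add: strictly_below_def)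

lemma last_step_below: "last_step m x z \<prec> z"
  using last_step(3,4) m(2) unfolding strictly_below_def by (metis DiffD2 singletonI)

lemma below_last_step: "M x \<noteq> M z - {m} \<Longrightarrow> x \<prec> last_step m x z"
  using last_step(2,4) unfolding strictly_below_def by metis

end

text \<open>The two tests disagree as soon as an element having \<open>m\<close> is reached. One is
  always reached, because the top of the chain has all labels and the first element lacks
  \<open>m\<close>.\<close>

lemma insertable_iff_not_deletable:
  "\<lbrakk>chain xs; first_label m (hd xs)\<rbrakk> \<Longrightarrow> insertable m xs \<longleftrightarrow> \<not> deletable m xs"
proof (induction m xs rule: insertable.induct)
  case (1 m x y zs)
  then show ?case using first_label_above[of m x y] by (auto simp: chain_hd)
qed (auto simp: first_label_def)

text \<open>The inserted coatom lacks \<open>m\<close>, so the first element having \<open>m\<close>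
  stays the same, and with it the gap weight.\<close>

lemma fill:
  "\<lbrakk>chain xs; first_label m (hd xs); insertable m xs\<rbrakk> \<Longrightarrow>
    chain (fill m xs) \<and> insertion xs (fill m xs) \<and> deletable m (fill m xs) \<and>
    gap_weight m (fill m xs) = gap_weight m xs"
proof (induction m xs rule: insertable.induct)
  case (1 m x y zs)
  have P: "x \<in> P" "y \<in> P" "x \<prec> y" and m: "first_label m x" using "1.prems" by (auto simp: chain_hd)
  show ?case
  proof (cases "m \<in> M y")
    case True
    then have "M x \<noteq> M y - {m}" using "1.prems" by simp
    with True P m 1 last_step[OF P m True] last_step_below[OF P m True] below_last_step[OF P m True]
    show ?thesis by (auto intro: insertion.here)
  next
    case False
    then have IH: "chain (fill m (y # zs)) \<and> insertion (y # zs) (fill m (y # zs)) \<and>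
        deletable m (fill m (y # zs)) \<and> gap_weight m (fill m (y # zs)) = gap_weight m (y # zs)"
      using 1 first_label_above[OF m P] by simp
    moreover from IH obtain ws where "fill m (y # zs) = y # ws"
      using insertion_Cons[of y zs "fill m (y # zs)"] by metis
    ultimately show ?thesis using False P by (auto intro: insertion.there)
  qed
qed auto

text \<open>Acyclicity for a single label. The outcome of the test can change only at the first
  element having \<open>m\<close>: either its coatom is inserted, which is \<open>fill\<close>, or a
  new element having \<open>m\<close> appears right below it, which raises the gap weight. Every
  other insertion leaves the chain insertable.\<close>

lemma insertion_deletable:
  "\<lbrakk>chain xs; first_label m (hd xs); insertable m xs; insertion xs bs; chain bs; deletable m bs\<rbrakk>
    \<Longrightarrow> bs = fill m xs \<or> gap_weight m xs < gap_weight m bs"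
proof (induction m xs arbitrary: bs rule: insertable.induct)
  case (1 m x y zs)
  have P: "x \<in> P" "y \<in> P" "x \<prec> y" and m: "first_label m x" using "1.prems" by (auto simp: chain_hd)
  from "1.prems"(4) consider (here) v where "bs = x # v # y # zs"
    | (there) bs' where "bs = x # bs'" "insertion (y # zs) bs'"
    by (auto simp: insertion_simps)
  then show ?case
  proof cases
    case here
    then have v: "v \<in> P" "x \<prec> v" "v \<prec> y" using "1.prems" by (auto simp: chain_hd)
    show ?thesis
    proof (cases "m \<in> M y")
      case my: True
      show ?thesis
      proof (cases "m \<in> M v")
        case True
        have "card (M v) < card (M y)"
          by (rule card_M_strict_mono[OF v(1) P(2) v(3)])
        moreover have "card (M y) \<le> card L" using M_subset[OF P(2)] finite_L by (rule card_mono[rotated])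
        ultimately show ?thesis using here True my by (simp add: diff_less_mono2)
      next
        case False
        then have "M v = M y - {m}" using "1.prems"(6) here my by simp
        then have "v = last_step m x y" using v P m my by (intro last_step_eqI)
        then show ?thesis using here my by simp
      qed
    next
      case False
      then have "m \<notin> M v" using M_strict_mono[OF v(1) P(2) v(3)] by blast
      then have "deletable m (y # zs)" "insertable m (y # zs)" using "1.prems" here False by auto
      then show ?thesis
        using insertable_iff_not_deletable[of "y # zs" m] first_label_above[OF m P False] "1.prems" by simp
    qed
  next
    case there
    then obtain bs'' where bs: "bs = x # y # bs''" "insertion (y # zs) (y # bs'')"
      using insertion_Cons[OF there(2)] by auto
    show ?thesis
    proof (cases "m \<in> M y")
      case True
      then show ?thesis using "1.prems" bs by simp
    next
      case False
      then show ?thesis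
        using "1.IH"[OF False, of "y # bs''"] "1.prems" bs first_label_above[OF m P False] by auto
    qed
  qed
qed auto

text \<open>Since the first step is not the coatom step, the coatom is an inner element and can be
  removed. The last conclusion ensures that the removal does not turn the first step into a coatom
  step.\<close>

lemma deletable_imp_fill:
  "\<lbrakk>chain (x # y # zs); first_label m x; deletable m (x # y # zs); \<not> (m \<in> M y \<and> M x = M y - {m})\<rbrakk> \<Longrightarrow>
    \<exists>w as. chain (x # w # as) \<and> insertable m (x # w # as) \<and> fill m (x # w # as) = x # y # zs \<and>
      \<not> (m \<in> M w \<and> M x = M w - {m})"
proof (induction zs arbitrary: x y)
  case (Cons w ws)
  have m: "m \<notin> M y" "deletable m (y # w # ws)" using Cons.prems by (auto split: if_splits)
  have P: "x \<in> P" "y \<in> P" "w \<in> P" "x \<prec> y" "y \<prec> w" using Cons.prems by (auto simp: chain_hd)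
  have xw: "x \<prec> w" using P below_trans by blast
  have my: "first_label m y" using first_label_above Cons.prems(2) P m by blast
  show ?case
  proof (cases "m \<in> M w")
    case True
    then have "M y = M w - {m}" using m by simp
    moreover from this have "M x \<noteq> M w - {m}"
      using M_strict_mono[OF P(1,2,4)] by simp
    moreover have "y = last_step m x w" if "M y = M w - {m}"
      using P xw Cons.prems True that by (intro last_step_eqI)
    ultimately show ?thesis using True P xw Cons.prems
      by (intro exI[of _ w] exI[of _ ws]) auto
  next
    case False
    then obtain v as where "chain (y # v # as)" "insertable m (y # v # as)"
        "fill m (y # v # as) = y # w # ws"
      using Cons.IH[of y w] Cons.prems m my by auto
    then show ?thesis using m P Cons.prems
      by (intro exI[of _ y] exI[of _ "v # as"]) auto
  qed
qed (auto split: if_splits)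

section \<open>The matching between free and filled chains\<close>

lemma free_or_filled_or_rising:
  assumes "chain xs"
  shows "free_side xs \<or> filled_side xs \<or> rising xs"
    and "\<not> (free_side xs \<and> filled_side xs)" "\<not> (free_side xs \<and> rising xs)" "\<not> (filled_side xs \<and> rising xs)"
proof -
  have "(free_side xs \<or> filled_side xs \<or> rising xs) \<and> \<not> (free_side xs \<and> filled_side xs) \<and>
      \<not> (free_side xs \<and> rising xs) \<and> \<not> (filled_side xs \<and> rising xs)"
    using assms
  proof (induction xs rule: rising.induct)
    case (1 x y zs)
    then have P: "x \<in> P" "y \<in> P" "x \<prec> y" by (auto simp: chain_hd)
    show ?case
    proof (cases "rising_step x y")
      case True
      then show ?thesis using 1 by simp
    next
      case False
      then show ?thesis
        using insertable_iff_not_deletable[OF "1.prems"] first_label_next[OF P] by (auto split: if_splits)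
    qed
  qed auto
  then show "free_side xs \<or> filled_side xs \<or> rising xs"
    and "\<not> (free_side xs \<and> filled_side xs)" "\<not> (free_side xs \<and> rising xs)" "\<not> (filled_side xs \<and> rising xs)"
    by blast+
qed

text \<open>This lets \<open>drain\<close> pass over the position of \<open>y\<close>: its test
  there fails because the element after \<open>y\<close> still lacks \<open>m\<close>.\<close>

lemma fill_Cons:
  "\<lbrakk>chain (x # y # zs); first_label m x; m \<notin> M y; insertable m (x # y # zs)\<rbrakk>
    \<Longrightarrow> \<exists>v vs. fill m (y # zs) = y # v # vs \<and> m \<notin> M v"
proof (cases zs)
  case (Cons z zs')
  assume *: "chain (x # y # zs)" "first_label m x" "m \<notin> M y" "insertable m (x # y # zs)"
  then have P: "x \<in> P" "y \<in> P" "z \<in> P" "x \<prec> y" "y \<prec> z" using Cons by (auto simp: chain_hd)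
  have my: "first_label m y" by (rule first_label_above[OF *(2) P(1,2,4) *(3)])
  show ?thesis
  proof (cases "m \<in> M z")
    case True
    then have "m \<notin> M (last_step m y z)" using last_step(4)[OF P(2,3,5) my True] by blast
    then show ?thesis using True Cons by simp
  next
    case False
    moreover have "insertable m (z # zs')" using * Cons False by simp
    then obtain w ws where "zs' = w # ws" by (cases zs') auto
    ultimately show ?thesis using Cons by (cases "m \<in> M w") auto
  qed
qed simp

text \<open>A coatom inserted right after \<open>x\<close> lacks the next label of \<open>x\<close>,
  so the step stays non-rising. Hence a chain and its partner are split at the same place.\<close>

lemma fill_not_rising:
  assumes "chain (x # y # zs)" "\<not> rising_step x y" "insertable (next_label x) (x # y # zs)"
  shows "\<exists>v vs. fill (next_label x) (x # y # zs) = x # v # vs \<and> \<not> rising_step x v"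
proof -
  have P: "x \<in> P" "y \<in> P" "x \<prec> y" using assms by (auto simp: chain_hd)
  have m: "first_label (next_label x) x" by (rule first_label_next[OF P])
  show ?thesis
  proof (cases "next_label x \<in> M y")
    case True
    then have "\<not> rising_step x (last_step (next_label x) x y)" using last_step(4)[OF P m True] by auto
    then show ?thesis using True by simp
  next
    case False
    then show ?thesis using fill_Cons[OF assms(1) m False assms(3)] assms(2) by auto
  qed
qed

lemma partner:
  "\<lbrakk>chain xs; free_side xs\<rbrakk> \<Longrightarrow> chain (partner xs) \<and> insertion xs (partner xs) \<and>
    filled_side (partner xs) \<and> weight (partner xs) = weight xs"
proof (induction xs rule: rising.induct)
  case (1 x y zs)
  have P: "x \<in> P" "y \<in> P" "x \<prec> y" using "1.prems" by (auto simp: chain_hd)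
  show ?case
  proof (cases "rising_step x y")
    case True
    then have IH: "chain (partner (y # zs)) \<and> insertion (y # zs) (partner (y # zs)) \<and>
        filled_side (partner (y # zs)) \<and> weight (partner (y # zs)) = weight (y # zs)"
      using 1 by simp
    moreover from IH obtain ws where "partner (y # zs) = y # ws"
      using insertion_Cons[of y zs "partner (y # zs)"] by metis
    ultimately show ?thesis using True P by (auto intro: insertion.there)
  next
    case False
    let ?m = "next_label x"
    have m: "first_label ?m x" by (rule first_label_next[OF P])
    have ins: "insertable ?m (x # y # zs)" using "1.prems" False by simp
    have f: "chain (fill ?m (x # y # zs)) \<and> insertion (x # y # zs) (fill ?m (x # y # zs)) \<and>
        deletable ?m (fill ?m (x # y # zs)) \<and>
        gap_weight ?m (fill ?m (x # y # zs)) = gap_weight ?m (x # y # zs)"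
      by (rule fill) (use "1.prems" m ins in auto)
    obtain v vs where v: "fill ?m (x # y # zs) = x # v # vs" "\<not> rising_step x v"
      using fill_not_rising[OF "1.prems"(1) False ins] by blast
    have p: "partner (x # y # zs) = x # v # vs" using False v(1) by simp
    have w: "filled_side (x # v # vs) = deletable ?m (x # v # vs)"
      "weight (x # v # vs) = gap_weight ?m (x # v # vs)"
      "weight (x # y # zs) = gap_weight ?m (x # y # zs)"
      using v(2) False by (simp_all only: filled_side.simps weight.simps if_False)
    show ?thesis using f unfolding p w v(1) by blast
  qed
qed auto

lemma partner_Cons:
  assumes "chain (x # y # zs)" "free_side (x # y # zs)"
  shows "\<exists>v vs. partner (x # y # zs) = x # v # vs \<and> (rising_step x v \<longleftrightarrow> rising_step x y)"
proof (cases "rising_step x y")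
  case True
  then obtain ws where "partner (y # zs) = y # ws"
    using partner[of "y # zs"] insertion_Cons[of y zs "partner (y # zs)"] assms by auto
  then show ?thesis using True by simp
next
  case False
  then show ?thesis using fill_not_rising[of x y zs] assms by (simp del: fill.simps)
qed

text \<open>The inverse operation to \<open>fill\<close>: it removes the element right below the
  first one having \<open>m\<close>. It serves to show that \<open>partner\<close> is
  injective.\<close>

fun drain :: "nat \<Rightarrow> 'p list \<Rightarrow> 'p list" where
  "drain m (x # y # z # zs) = (if m \<in> M z \<and> m \<notin> M y then x # z # zs else x # drain m (y # z # zs))"
| "drain m xs = xs"

lemma drain_fill:
  "\<lbrakk>chain xs; first_label m (hd xs); insertable m xs\<rbrakk> \<Longrightarrow> drain m (fill m xs) = xs"
proof (induction m xs rule: insertable.induct)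
  case (1 m x y zs)
  have P: "x \<in> P" "y \<in> P" "x \<prec> y" and m: "first_label m x" using "1.prems" by (auto simp: chain_hd)
  show ?case
  proof (cases "m \<in> M y")
    case True
    then show ?thesis using last_step(4)[OF P m True] by simp
  next
    case False
    obtain v vs where v: "fill m (y # zs) = y # v # vs" "m \<notin> M v"
      using fill_Cons[OF "1.prems"(1) m False "1.prems"(3)] by blast
    have "drain m (fill m (y # zs)) = y # zs"
      using "1.IH"[OF False] "1.prems" False first_label_above[OF m P False] by simp
    then show ?thesis using False v by simp
  qed
qed auto

text \<open>By \<open>partner_Cons\<close> equal partners come from chains with the same initial
  rising steps; at the first step that is not rising, \<open>drain\<close> recovers the
  chain.\<close>

lemma partner_inj:
  "\<lbrakk>chain xs; free_side xs; chain ys; free_side ys; partner xs = partner ys\<rbrakk> \<Longrightarrow> xs = ys"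
proof (induction xs arbitrary: ys rule: rising.induct)
  case (1 x y zs)
  obtain x' y' zs' where ys: "ys = x' # y' # zs'"
    using "1.prems" by (cases ys rule: rising.cases) auto
  obtain v vs where v: "partner (x # y # zs) = x # v # vs" "rising_step x v \<longleftrightarrow> rising_step x y"
    using partner_Cons[OF "1.prems"(1,2)] by blast
  obtain v' vs' where v': "partner (x' # y' # zs') = x' # v' # vs'" "rising_step x' v' \<longleftrightarrow> rising_step x' y'"
    using partner_Cons[OF "1.prems"(3,4)[unfolded ys]] by blast
  have "x' # v' # vs' = x # v # vs" using "1.prems"(5) unfolding ys v(1) v'(1) by (rule sym)
  then have x': "x' = x" and v'v: "v' = v" by simp_all
  have st: "rising_step x y' \<longleftrightarrow> rising_step x y" using v(2) v'(2) unfolding x' v'v by metis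
  show ?case
  proof (cases "rising_step x y")
    case True
    have "partner (y # zs) = partner (y' # zs')"
      using "1.prems"(5) True st by (simp only: ys x' partner.simps if_True simp_thms list.inject)
    moreover have "chain (y # zs)" "free_side (y # zs)" "chain (y' # zs')" "free_side (y' # zs')"
      using "1.prems"(1-4) True st by (simp_all only: ys x' chain_Cons free_side.simps if_True simp_thms)
    ultimately show ?thesis using "1.IH"[of "y' # zs'"] ys x' by blast
  next
    case False
    have P: "x \<in> P" "y \<in> P" "x \<prec> y" using "1.prems" by (auto simp: chain_hd)
    have "fill (next_label x) (x # y # zs) = fill (next_label x) ys"
      using "1.prems"(5) False st by (simp only: ys x' partner.simps if_False simp_thms)
    then have "drain (next_label x) (fill (next_label x) (x # y # zs)) = drain (next_label x) (fill (next_label x) ys)"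
      by simp
    moreover have "insertable (next_label x) (x # y # zs)" "insertable (next_label x) ys"
      using "1.prems"(2,4) False st by (simp_all only: ys x' free_side.simps if_False simp_thms)
    moreover have "first_label (next_label x) (hd ys)" "first_label (next_label x) (hd (x # y # zs))"
      using first_label_next[OF P] by (simp_all only: ys x' list.sel)
    ultimately show ?thesis
      using drain_fill[OF "1.prems"(1)] drain_fill[OF "1.prems"(3)] by metis
  qed
qed auto

lemma gap_weight_le: "gap_weight m xs \<le> card L"
  by (induction m xs rule: gap_weight.induct) auto

text \<open>Acyclicity of the matching. An insertion into the first non-rising step may create
  another initial rising step, which outweighs every gap weight; otherwise
  \<open>insertion_deletable\<close> applies. Nothing fits inside a rising step, because it adds a
  single label.\<close>

lemma insertion_filled:
  "\<lbrakk>chain xs; free_side xs; insertion xs bs; chain bs; filled_side bs\<rbrakk>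
    \<Longrightarrow> bs = partner xs \<or> weight xs < weight bs"
proof (induction xs arbitrary: bs rule: rising.induct)
  case (1 x y zs)
  have P: "x \<in> P" "y \<in> P" "x \<prec> y" using "1.prems" by (auto simp: chain_hd)
  have m: "first_label (next_label x) x" by (rule first_label_next[OF P])
  from "1.prems"(3) consider (here) v where "bs = x # v # y # zs"
    | (there) bs' where "bs = x # bs'" "insertion (y # zs) bs'"
    by (auto simp: insertion_simps)
  then show ?case
  proof cases
    case here
    then have v: "v \<in> P" "x \<prec> v" "v \<prec> y" using "1.prems" by (auto simp: chain_hd)
    have nr: "\<not> rising_step x y"
    proof
      assume "rising_step x y"
      moreover have "finite (M x)" using M_subset[OF P(1)] finite_L by (rule finite_subset)
      ultimately have "card (M y) \<le> Suc (card (M x))" by (simp add: card_insert_if)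
      then show False using card_M_strict_mono[OF P(1) v(1,2)] card_M_strict_mono[OF v(1) P(2) v(3)]
        by simp
    qed
    show ?thesis
    proof (cases "rising_step x v")
      case True
      then show ?thesis using here nr gap_weight_le[of "next_label x" "x # y # zs"] by simp
    next
      case False
      have "bs = fill (next_label x) (x # y # zs) \<or>
          gap_weight (next_label x) (x # y # zs) < gap_weight (next_label x) bs"
        by (rule insertion_deletable) (use "1.prems" m nr False here in auto)
      then show ?thesis using nr False here by auto
    qed
  next
    case there
    then obtain bs'' where bs: "bs = x # y # bs''" "insertion (y # zs) (y # bs'')"
      using insertion_Cons[OF there(2)] by auto
    show ?thesis
    proof (cases "rising_step x y")
      case True
      then show ?thesis using "1.IH"[of "y # bs''"] "1.prems" bs by auto
    next
      case False
      have "bs = fill (next_label x) (x # y # zs) \<or>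
          gap_weight (next_label x) (x # y # zs) < gap_weight (next_label x) bs"
        by (rule insertion_deletable) (use "1.prems" m False bs in auto)
      then show ?thesis using False bs by auto
    qed
  qed
qed auto

lemma filled_imp_partner:
  "\<lbrakk>chain bs; filled_side bs\<rbrakk> \<Longrightarrow> \<exists>as. chain as \<and> free_side as \<and> partner as = bs"
proof (induction bs rule: rising.induct)
  case (1 x y zs)
  have P: "x \<in> P" "y \<in> P" "x \<prec> y" using "1.prems" by (auto simp: chain_hd)
  have m: "first_label (next_label x) x" by (rule first_label_next[OF P])
  show ?case
  proof (cases "rising_step x y")
    case True
    then obtain as where as: "chain as" "free_side as" "partner as = y # zs" using 1 by auto
    moreover from this have "hd as = y" using partner[OF as(1,2)] insertion_hd by fastforce
    then obtain w ws where "as = y # w # ws"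
      using as by (cases as rule: rising.cases) auto
    ultimately show ?thesis using True P by (intro exI[of _ "x # as"]) auto
  next
    case False
    obtain w as where w: "chain (x # w # as)" "insertable (next_label x) (x # w # as)"
      "fill (next_label x) (x # w # as) = x # y # zs"
      "\<not> (next_label x \<in> M w \<and> M x = M w - {next_label x})"
      using deletable_imp_fill[of x y zs "next_label x"] "1.prems" m False rising_step_iff[OF P] by auto
    then have "\<not> rising_step x w" using rising_step_iff[of x w] by (auto simp: chain_hd)
    then show ?thesis using w by (intro exI[of _ "x # w # as"]) auto
  qed
qed auto

end

section \<open>Quotients of function modules\<close>

lemma free_module_simps [simp]:
  "carrier (free_module S) = {c. \<forall>s. s \<notin> S \<longrightarrow> c s = 0}"
  "\<zero>\<^bsub>free_module S\<^esub> = (\<lambda>_. 0)"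
  "c \<oplus>\<^bsub>free_module S\<^esub> c' = (\<lambda>s. c s + c' s)"
  "a \<odot>\<^bsub>free_module S\<^esub> c = (\<lambda>s. a * c s)"
  by (simp_all add: free_module_def)

lemma ring_of_type_algebra_simps [simp]:
  "carrier (ring_of_type_algebra :: 'k::comm_ring_1 ring) = UNIV"
  "a \<oplus>\<^bsub>ring_of_type_algebra :: 'k ring\<^esub> b = a + b"
  "a \<otimes>\<^bsub>ring_of_type_algebra :: 'k ring\<^esub> b = a * b"
  "\<one>\<^bsub>ring_of_type_algebra :: 'k ring\<^esub> = 1"
  by (simp_all add: ring_of_type_algebra_def)

text \<open>The target is a bare record: that it is a module will follow by
  \<open>module_transport\<close>, so the module axioms need not be checked on cosets.\<close>

definition linear_bij :: "('m \<Rightarrow> 'n) \<Rightarrow> ('k::comm_ring_1, 'm) module \<Rightarrow> ('k, 'n) module \<Rightarrow> bool" where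
  "linear_bij \<phi> M N \<longleftrightarrow> bij_betw \<phi> (carrier M) (carrier N) \<and> \<phi> \<zero>\<^bsub>M\<^esub> = \<zero>\<^bsub>N\<^esub> \<and>
    (\<forall>x\<in>carrier M. \<forall>y\<in>carrier M. \<phi> (x \<oplus>\<^bsub>M\<^esub> y) = \<phi> x \<oplus>\<^bsub>N\<^esub> \<phi> y) \<and>
    (\<forall>a. \<forall>x\<in>carrier M. \<phi> (a \<odot>\<^bsub>M\<^esub> x) = a \<odot>\<^bsub>N\<^esub> \<phi> x)"

lemma linear_bijD:
  assumes "linear_bij \<phi> M N"
  shows "bij_betw \<phi> (carrier M) (carrier N)" "\<phi> \<zero>\<^bsub>M\<^esub> = \<zero>\<^bsub>N\<^esub>"
    "\<lbrakk>x \<in> carrier M; y \<in> carrier M\<rbrakk> \<Longrightarrow> \<phi> (x \<oplus>\<^bsub>M\<^esub> y) = \<phi> x \<oplus>\<^bsub>N\<^esub> \<phi> y"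
    "x \<in> carrier M \<Longrightarrow> \<phi> (a \<odot>\<^bsub>M\<^esub> x) = a \<odot>\<^bsub>N\<^esub> \<phi> x"
  using assms by (auto simp: linear_bij_def)

lemma module_free_module:
  "module (ring_of_type_algebra :: 'k::comm_ring_1 ring) (free_module S :: ('k, 's \<Rightarrow> 'k) module)"
proof (rule moduleI)
  show "cring (ring_of_type_algebra :: 'k ring)" by (rule cring_from_type_algebra)
  show "abelian_group (free_module S :: ('k, 's \<Rightarrow> 'k) module)"
  proof (rule abelian_groupI)
    fix x assume "x \<in> carrier (free_module S :: ('k, 's \<Rightarrow> 'k) module)"
    then show "\<exists>y\<in>carrier (free_module S). y \<oplus>\<^bsub>free_module S\<^esub> x = \<zero>\<^bsub>free_module S :: ('k, 's \<Rightarrow> 'k) module\<^esub>"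
      by (intro bexI[of _ "\<lambda>s. - x s"]) auto
  qed (auto simp: algebra_simps)
qed (auto simp: algebra_simps)

lemma module_transport:
  assumes \<phi>: "linear_bij \<phi> M N" and M: "module (ring_of_type_algebra :: 'k::comm_ring_1 ring) M"
  shows "module (ring_of_type_algebra :: 'k ring) N"
proof -
  interpret M: module "ring_of_type_algebra :: 'k ring" M by (rule M)
  note \<phi>D = linear_bijD[OF \<phi>]
  have N: "carrier N = \<phi> ` carrier M" using \<phi>D(1) by (simp add: bij_betw_def)
  show ?thesis
  proof (rule moduleI)
    show "cring (ring_of_type_algebra :: 'k ring)" by (rule cring_from_type_algebra)
    show "abelian_group N"
    proof (rule abelian_groupI)
      fix x assume "x \<in> carrier N"
      then obtain u where u: "u \<in> carrier M" "x = \<phi> u" using N by auto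
      show "\<exists>y\<in>carrier N. y \<oplus>\<^bsub>N\<^esub> x = \<zero>\<^bsub>N\<^esub>"
        by (intro bexI[of _ "\<phi> (\<ominus>\<^bsub>M\<^esub> u)"]) (use u in \<open>auto simp: N M.l_neg \<phi>D(2) simp flip: \<phi>D(3)\<close>)
    qed (auto simp: N M.a_ac simp flip: \<phi>D(2,3,4))
  qed (auto simp: N M.smult_r_distr M.smult_assoc1[simplified] M.smult_one[simplified] M.smult_l_distr[simplified] simp flip: \<phi>D(2,3,4))
qed

lemma finsum_transport:
  assumes \<phi>: "linear_bij \<phi> (free_module S) N" and I: "finite I"
    and g: "\<And>i. i \<in> I \<Longrightarrow> g i \<in> carrier (free_module S)"
  shows "(\<Oplus>\<^bsub>N\<^esub>i\<in>I. \<phi> (g i)) = \<phi> (\<lambda>s. \<Sum>i\<in>I. g i s :: 'k::comm_ring_1)"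
proof -
  interpret N: module "ring_of_type_algebra :: 'k ring" N
    by (rule module_transport[OF \<phi> module_free_module])
  note \<phi>D = linear_bijD[OF \<phi>]
  have in_N: "\<phi> u \<in> carrier N" if "u \<in> carrier (free_module S)" for u
    using bij_betwE[OF \<phi>D(1)] that by blast
  show ?thesis using I g
  proof (induction I rule: finite_induct)
    case empty
    then show ?case using \<phi>D(2) by simp
  next
    case (insert i I)
    have "(\<Oplus>\<^bsub>N\<^esub>j\<in>insert i I. \<phi> (g j)) = \<phi> (g i) \<oplus>\<^bsub>N\<^esub> (\<Oplus>\<^bsub>N\<^esub>j\<in>I. \<phi> (g j))"
      using insert in_N by (intro N.finsum_insert) (auto simp del: free_module_simps)
    also have "\<dots> = \<phi> (g i \<oplus>\<^bsub>free_module S\<^esub> (\<lambda>s. \<Sum>j\<in>I. g j s))"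
    proof -
      have "(\<lambda>s. \<Sum>j\<in>I. g j s) \<in> carrier (free_module S)"
        using insert.prems by (auto intro!: sum.neutral)
      then show ?thesis using insert by (subst \<phi>D(3)) (auto simp del: free_module_simps)
    qed
    also have "g i \<oplus>\<^bsub>free_module S\<^esub> (\<lambda>s. \<Sum>j\<in>I. g j s) = (\<lambda>s. \<Sum>j\<in>insert i I. g j s)"
      using insert by simp
    finally show ?case .
  qed
qed

text \<open>The images of the symbols form the basis. Pulled back along \<open>\<phi>\<close>, an
  expansion becomes an identity of functions, whose values on \<open>S\<close> are the
  coefficients.\<close>

lemma free_of_rank_transport:
  fixes N :: "('k::comm_ring_1, 'm) module"
  assumes \<phi>: "linear_bij \<phi> (free_module S) N" and S: "finite S"
  shows "free_of_rank N (card S)"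
proof -
  note \<phi>D = linear_bijD[OF \<phi>]
  obtain e where e: "bij_betw e {..<card S} S"
    using ex_bij_betw_nat_finite[OF S] by (auto simp: atLeast0LessThan)
  define b where "b i = \<phi> (symbol (e i))" for i
  have sym: "symbol (e i) \<in> carrier (free_module S :: ('k, _) module)" if "i < card S" for i
    using bij_betwE[OF e] that by (auto simp: symbol_def)
  have lin: "(\<Oplus>\<^bsub>N\<^esub>i\<in>{..<card S}. a i \<odot>\<^bsub>N\<^esub> b i) = \<phi> (\<lambda>s. \<Sum>i<card S. a i * symbol (e i) s)" for a
  proof -
    interpret N: module "ring_of_type_algebra :: 'k ring" N
      by (rule module_transport[OF \<phi> module_free_module])
    have "(\<Oplus>\<^bsub>N\<^esub>i\<in>{..<card S}. a i \<odot>\<^bsub>N\<^esub> b i) = (\<Oplus>\<^bsub>N\<^esub>i\<in>{..<card S}. \<phi> (\<lambda>s. a i * symbol (e i) s))"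
    proof (rule N.finsum_cong')
      fix i assume "i \<in> {..<card S}"
      then show "a i \<odot>\<^bsub>N\<^esub> b i = \<phi> (\<lambda>s. a i * symbol (e i) s)"
        using \<phi>D(4)[OF sym, of i "a i"] by (simp add: b_def)
    qed (use sym in \<open>auto intro!: bij_betwE[OF \<phi>D(1), rule_format]\<close>)
    also have "\<dots> = \<phi> (\<lambda>s. \<Sum>i<card S. a i * symbol (e i) s)"
      using sym by (intro finsum_transport[OF \<phi>]) auto
    finally show ?thesis .
  qed
  have coord: "(\<Sum>i<card S. a i * symbol (e i) (e j)) = a j" if "j < card S" for a :: "nat \<Rightarrow> 'k" and j
  proof -
    have "(\<Sum>i<card S. a i * symbol (e i) (e j)) = (\<Sum>i<card S. if i = j then a i else 0)"
      using that bij_betw_imp_inj_on[OF e] by (intro sum.cong) (auto simp: symbol_def inj_on_def)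
    then show ?thesis using that by simp
  qed
  have b: "b \<in> {..<card S} \<rightarrow> carrier N"
    using sym bij_betwE[OF \<phi>D(1)] by (auto simp: b_def simp del: free_module_simps)
  have uniq: "\<exists>!a. a \<in> extensional {..<card S} \<and> x = (\<Oplus>\<^bsub>N\<^esub>i\<in>{..<card S}. a i \<odot>\<^bsub>N\<^esub> b i)"
    if "x \<in> carrier N" for x
  proof -
    have "x \<in> \<phi> ` carrier (free_module S)"
      using bij_betw_imp_surj_on[OF \<phi>D(1)] that by (simp only:)
    then obtain u where u: "u \<in> carrier (free_module S)" "x = \<phi> u"
      by (auto simp del: free_module_simps)
    have in_free: "(\<lambda>s. \<Sum>i<card S. a i * symbol (e i) s) \<in> carrier (free_module S)" for a :: "nat \<Rightarrow> 'k"
      using sym by (auto intro!: sum.neutral)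
    have iff: "x = (\<Oplus>\<^bsub>N\<^esub>i\<in>{..<card S}. a i \<odot>\<^bsub>N\<^esub> b i) \<longleftrightarrow> (\<forall>i<card S. a i = u (e i))" for a
    proof -
      have "x = (\<Oplus>\<^bsub>N\<^esub>i\<in>{..<card S}. a i \<odot>\<^bsub>N\<^esub> b i) \<longleftrightarrow> u = (\<lambda>s. \<Sum>i<card S. a i * symbol (e i) s)"
        using inj_onD[OF bij_betw_imp_inj_on[OF \<phi>D(1)], OF _ u(1) in_free[of a]]
        unfolding lin u(2) by blast
      also have "\<dots> \<longleftrightarrow> (\<forall>i<card S. a i = u (e i))"
      proof (intro iffI allI impI)
        fix i assume "u = (\<lambda>s. \<Sum>i<card S. a i * symbol (e i) s)" "i < card S"
        then show "a i = u (e i)" using coord[of i a] by simp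
      next
        assume *: "\<forall>i<card S. a i = u (e i)"
        show "u = (\<lambda>s. \<Sum>i<card S. a i * symbol (e i) s)"
        proof
          fix s
          show "u s = (\<Sum>i<card S. a i * symbol (e i) s)"
          proof (cases "s \<in> S")
            case True
            then obtain j where "j < card S" "s = e j" using e by (auto simp: bij_betw_def)
            then show ?thesis using coord[of j a] * by simp
          next
            case False
            then show ?thesis using u(1) in_free[of a] by simp
          qed
        qed
      qed
      finally show ?thesis .
    qed
    show ?thesis
    proof (rule ex1I[of _ "\<lambda>i\<in>{..<card S}. u (e i)"])
      show "(\<lambda>i\<in>{..<card S}. u (e i)) \<in> extensional {..<card S} \<and>
          x = (\<Oplus>\<^bsub>N\<^esub>i\<in>{..<card S}. (\<lambda>i\<in>{..<card S}. u (e i)) i \<odot>\<^bsub>N\<^esub> b i)"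
        unfolding iff by simp
      fix a assume "a \<in> extensional {..<card S} \<and> x = (\<Oplus>\<^bsub>N\<^esub>i\<in>{..<card S}. a i \<odot>\<^bsub>N\<^esub> b i)"
      then show "a = (\<lambda>i\<in>{..<card S}. u (e i))"
        unfolding iff by (auto simp: extensional_def fun_eq_iff)
    qed
  qed
  show ?thesis
    unfolding free_of_rank_def
    using module_transport[OF \<phi> module_free_module] b uniq by blast
qed

text \<open>The coset of \<open>x\<close> modulo \<open>N\<close> in pointwise form; the operations
  of the quotient record are reduced to it.\<close>

definition shift :: "('s \<Rightarrow> 'k::comm_ring_1) set \<Rightarrow> ('s \<Rightarrow> 'k) \<Rightarrow> ('s \<Rightarrow> 'k) set" where
  "shift N x = (\<lambda>h s. h s + x s) ` N"

locale function_quotient =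
  fixes S :: "'s set" and Z N :: "('s \<Rightarrow> 'k::comm_ring_1) set"
  assumes N_Z: "N \<subseteq> Z"
    and N_zero: "(\<lambda>_. 0) \<in> N"
    and N_diff: "\<lbrakk>x \<in> N; y \<in> N\<rbrakk> \<Longrightarrow> (\<lambda>s. x s - y s) \<in> N"
    and N_scale: "x \<in> N \<Longrightarrow> (\<lambda>s. a * x s) \<in> N"
    and Z_diff: "\<lbrakk>x \<in> Z; y \<in> Z\<rbrakk> \<Longrightarrow> (\<lambda>s. x s - y s) \<in> Z"
begin

abbreviation Q :: "('k, ('s \<Rightarrow> 'k) set) module" where
  "Q \<equiv> quotient_module (free_module S\<lparr>carrier := Z\<rparr>) N"

lemma N_add: "\<lbrakk>x \<in> N; y \<in> N\<rbrakk> \<Longrightarrow> (\<lambda>s. x s + y s) \<in> N"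
  using N_diff[of x "\<lambda>s. 0 - y s"] N_diff[OF N_zero, of y] by simp

lemma mem_shift: "y \<in> shift N x \<longleftrightarrow> (\<lambda>s. y s - x s) \<in> N"
proof
  assume "(\<lambda>s. y s - x s) \<in> N"
  then have "(\<lambda>s. (y s - x s) + x s) \<in> shift N x" unfolding shift_def by (rule imageI)
  then show "y \<in> shift N x" by simp
qed (auto simp: shift_def)

lemma shift_eq_iff: "shift N x = shift N y \<longleftrightarrow> (\<lambda>s. x s - y s) \<in> N"
proof
  assume "shift N x = shift N y"
  then show "(\<lambda>s. x s - y s) \<in> N" using mem_shift[of x x] N_zero mem_shift[of x y] by simp
next
  assume *: "(\<lambda>s. x s - y s) \<in> N"
  show "shift N x = shift N y"
  proof (rule Set.set_eqI)
    fix z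
    show "z \<in> shift N x \<longleftrightarrow> z \<in> shift N y"
      using N_add[OF _ *, of "\<lambda>s. z s - x s"] N_diff[OF _ *, of "\<lambda>s. z s - y s"]
      by (auto simp: mem_shift)
  qed
qed

lemma Q_carrier: "carrier Q = shift N ` Z"
  by (auto simp: quotient_module_def A_RCOSETS_def' a_r_coset_def' shift_def free_module_def image_def)

lemma Q_zero: "\<zero>\<^bsub>Q\<^esub> = N" "shift N (\<lambda>_. 0) = N"
  by (auto simp: quotient_module_def shift_def)

lemma Q_add: "shift N x \<oplus>\<^bsub>Q\<^esub> shift N y = shift N (\<lambda>s. x s + y s)"
proof -
  have "shift N x \<oplus>\<^bsub>Q\<^esub> shift N y = {\<lambda>s. x' s + y' s | x' y'. x' \<in> shift N x \<and> y' \<in> shift N y}"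
    by (auto simp: quotient_module_def set_add_def' free_module_def)
  also have "\<dots> = shift N (\<lambda>s. x s + y s)"
  proof (intro equalityI subsetI)
    fix z assume "z \<in> {\<lambda>s. x' s + y' s | x' y'. x' \<in> shift N x \<and> y' \<in> shift N y}"
    then obtain x' y' where "z = (\<lambda>s. x' s + y' s)" "(\<lambda>s. x' s - x s) \<in> N" "(\<lambda>s. y' s - y s) \<in> N"
      by (auto simp: mem_shift)
    then show "z \<in> shift N (\<lambda>s. x s + y s)"
      using N_add[of "\<lambda>s. x' s - x s" "\<lambda>s. y' s - y s"] by (simp add: mem_shift algebra_simps)
  next
    fix z assume "z \<in> shift N (\<lambda>s. x s + y s)"
    then have "(\<lambda>s. z s - y s) \<in> shift N x" by (simp add: mem_shift algebra_simps)
    moreover have "y \<in> shift N y" using N_zero by (simp add: mem_shift)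
    moreover have "z = (\<lambda>s. (z s - y s) + y s)" by simp
    ultimately show "z \<in> {\<lambda>s. x' s + y' s | x' y'. x' \<in> shift N x \<and> y' \<in> shift N y}"
      by (intro CollectI exI conjI)
  qed
  finally show ?thesis .
qed

lemma Q_smult: "a \<odot>\<^bsub>Q\<^esub> shift N x = shift N (\<lambda>s. a * x s)"
proof -
  have "a \<odot>\<^bsub>Q\<^esub> shift N x = (\<Union>y\<in>shift N x. shift N (\<lambda>s. a * y s))"
    by (auto simp: quotient_module_def a_r_coset_def' shift_def free_module_def)
  also have "\<dots> = (\<Union>y\<in>shift N x. shift N (\<lambda>s. a * x s))"
  proof (rule SUP_cong[OF refl])
    fix y assume "y \<in> shift N x"
    then show "shift N (\<lambda>s. a * y s) = shift N (\<lambda>s. a * x s)"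
      unfolding shift_eq_iff using N_scale[of "\<lambda>s. y s - x s" a]
      by (simp add: mem_shift algebra_simps)
  qed
  also have "\<dots> = shift N (\<lambda>s. a * x s)"
    using N_zero mem_shift[of x x] by (simp add: SUP_constant) blast
  finally show ?thesis .
qed

text \<open>The functions supported on \<open>F\<close> form a complement of \<open>N\<close> in
  \<open>Z\<close>: by \<open>span\<close> they generate \<open>Z\<close> modulo \<open>N\<close>,
  by \<open>indep\<close> they meet \<open>N\<close> trivially.\<close>

lemma linear_bij_shift:
  assumes F: "carrier (free_module F) \<subseteq> Z"
    and span: "\<And>z. z \<in> Z \<Longrightarrow> \<exists>u\<in>carrier (free_module F). (\<lambda>s. z s - u s) \<in> N"
    and indep: "\<And>u. u \<in> carrier (free_module F) \<Longrightarrow> u \<in> N \<Longrightarrow> u = (\<lambda>_. 0)"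
  shows "linear_bij (shift N) (free_module F) Q"
proof -
  have "inj_on (shift N) (carrier (free_module F))"
  proof (rule inj_onI)
    fix u v assume "u \<in> carrier (free_module F)" "v \<in> carrier (free_module F)" "shift N u = shift N v"
    then have "(\<lambda>s. u s - v s) = (\<lambda>_. 0)"
      by (intro indep) (auto simp: shift_eq_iff)
    then show "u = v" by (simp add: fun_eq_iff)
  qed
  moreover have "shift N ` Z = shift N ` carrier (free_module F)"
  proof
    show "shift N ` Z \<subseteq> shift N ` carrier (free_module F)"
    proof
      fix C assume "C \<in> shift N ` Z"
      then obtain z where z: "z \<in> Z" "C = shift N z" by blast
      then obtain u where "u \<in> carrier (free_module F)" "(\<lambda>s. z s - u s) \<in> N" using span by blast
      then show "C \<in> shift N ` carrier (free_module F)" using z shift_eq_iff by blast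
    qed
  qed (rule image_mono[OF F])
  ultimately show ?thesis
    unfolding linear_bij_def bij_betw_def Q_carrier by (simp add: Q_zero Q_add Q_smult)
qed

lemma carrier_Q_trivial:
  assumes "Z \<subseteq> N"
  shows "carrier Q = {\<zero>\<^bsub>Q\<^esub>}"
proof -
  have "shift N z = N" if "z \<in> Z" for z
    using shift_eq_iff[of z "\<lambda>_. 0"] that assms by (auto simp: Q_zero)
  moreover have "Z \<noteq> {}" using N_Z N_zero by blast
  ultimately show ?thesis unfolding Q_carrier Q_zero(1) by (simp add: image_constant_conv cong: image_cong_simp)
qed

end

section \<open>Cohomology of a rising poset\<close>

context rising_poset
begin

abbreviation "\<C> \<equiv> full_chains P R"
abbreviation "\<delta> \<equiv> coboundary P R"

lemma full_chains_chain: "xs \<in> \<C> k \<Longrightarrow> chain xs"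
  using M_maximal by (auto simp: full_chains_def chain_def)

lemma finite_full_chains: "finite (\<C> k)"
proof (rule finite_subset)
  show "\<C> k \<subseteq> {xs. set xs \<subseteq> P \<and> length xs = Suc k}" by (auto simp: full_chains_def)
qed (rule finite_lists_length_eq[OF finite_P])

lemma chain_distinct: "chain xs \<Longrightarrow> distinct xs"
  unfolding chain_def distinct_conv_nth
  by (metis linorder_neqE_nat sorted_wrt_nth_less strictly_below_def)

lemma full_chains_insertion:
  assumes "xs \<in> \<C> k" "insertion xs zs" "chain zs"
  shows "zs \<in> \<C> (Suc k)"
  using assms insertion_hd[OF assms(2)] insertion_last[OF assms(2)] length_insertion[OF assms(2)]
  by (auto simp: full_chains_def chain_def)

lemma full_chains_omit:
  assumes "zs \<in> \<C> (Suc k)" "i \<in> {1..k}"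
  shows "insertion (omit i zs) zs" "omit i zs \<in> \<C> k"
proof -
  have len: "length zs = Suc (Suc k)" using assms(1) by (simp add: full_chains_def)
  then show ins: "insertion (omit i zs) zs" using assms(2) by (intro insertion_omit) auto
  have "sorted_wrt (\<prec>) (take i zs @ zs ! i # drop (Suc i) zs)"
    using assms len by (subst id_take_nth_drop[symmetric]) (auto simp: full_chains_def)
  then have "sorted_wrt (\<prec>) (omit i zs)"
    by (auto simp: omit_def sorted_wrt_append)
  moreover have "set (omit i zs) \<subseteq> set zs"
    using set_take_subset[of i zs] set_drop_subset[of "Suc i" zs] by (auto simp: omit_def)
  ultimately show "omit i zs \<in> \<C> k"
    using assms(1) insertion_hd[OF ins] insertion_last[OF ins] length_insertion[OF ins]
    by (auto simp: full_chains_def)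
qed

lemma full_chains_insert:
  assumes xs: "xs \<in> \<C> k" and i: "i \<in> {1..k}"
    and y: "y \<in> P" "xs ! (i - 1) \<prec> y" "y \<prec> xs ! i"
  shows "take i xs @ y # drop i xs \<in> \<C> (Suc k)"
proof -
  have len: "length xs = Suc k" and sorted: "sorted_wrt (\<prec>) xs" and P: "set xs \<subseteq> P"
    using xs by (auto simp: full_chains_def)
  have lower: "a \<prec> y" if "a \<in> set (take i xs)" for a
  proof -
    from that obtain j where j: "j < i" "a = xs ! j" using len by (auto simp: in_set_conv_nth)
    then have "a = xs ! (i - 1) \<or> a \<prec> xs ! (i - 1)"
      using sorted_wrt_nth_less[OF sorted, of j "i - 1"] i len by (cases "j = i - 1") auto
    then show ?thesis using y(2) below_trans by blast
  qed
  have upper: "y \<prec> a" if "a \<in> set (drop i xs)" for a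
  proof -
    from that obtain j where "j < length (drop i xs)" "drop i xs ! j = a"
      by (auto simp only: in_set_conv_nth)
    then have j: "i + j < length xs" "a = xs ! (i + j)" by simp_all
    then have "a = xs ! i \<or> xs ! i \<prec> a"
      using sorted_wrt_nth_less[OF sorted, of i "i + j"] by (cases "j = 0") auto
    then show ?thesis using y(3) below_trans by blast
  qed
  have "sorted_wrt (\<prec>) (take i xs @ drop i xs)" using sorted by simp
  then have "sorted_wrt (\<prec>) (take i xs @ y # drop i xs)"
    using lower upper by (auto simp: sorted_wrt_append intro: below_trans[of _ y])
  moreover have "set (take i xs @ y # drop i xs) \<subseteq> P"
    using P y(1) set_take_subset[of i xs] set_drop_subset[of i xs] by auto
  moreover have "hd (take i xs @ y # drop i xs) = hd xs"
    using i len by (cases xs; cases i) auto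
  moreover have "last (take i xs @ y # drop i xs) = last xs"
    using i len by (simp add: last_drop)
  ultimately show ?thesis using xs i by (auto simp: full_chains_def)
qed

lemma insert_eq_iff_omit:
  assumes "length zs = Suc (length xs)" "i \<le> length xs"
  shows "take i xs @ y # drop i xs = zs \<longleftrightarrow> xs = omit i zs \<and> y = zs ! i"
proof
  assume "take i xs @ y # drop i xs = zs"
  then show "xs = omit i zs \<and> y = zs ! i"
    using assms by (auto simp: omit_def nth_append)
next
  assume "xs = omit i zs \<and> y = zs ! i"
  then show "take i xs @ y # drop i xs = zs"
    using assms id_take_nth_drop[of i zs] by (simp add: omit_def)
qed

text \<open>The transposed view of d: the coefficient at \<open>zs\<close> collects the chains from
  which \<open>zs\<close> arises by an insertion. After interchanging the sums, position
  \<open>i\<close> leaves only the face \<open>omit i zs\<close>, with inserted element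
  \<open>zs ! i\<close>.\<close>

lemma coboundary_apply:
  "\<delta> k c zs = (if zs \<in> \<C> (Suc k) then alt_sum k c zs else (0 :: 'k::comm_ring_1))"
proof -
  define Y where "Y xs i = {y \<in> P. xs ! (i - 1) \<prec> y \<and> y \<prec> xs ! i}" for xs i
  have "\<delta> k c zs = (\<Sum>xs\<in>\<C> k. \<Sum>i\<in>{1..k}. (-1) ^ i *
      (c xs * (\<Sum>y\<in>Y xs i. symbol (take i xs @ y # drop i xs) zs)))"
    unfolding coboundary_def linear_extension_def symbol_coboundary_def Y_def
  proof (rule sum.cong[OF refl])
    fix xs assume "xs \<in> \<C> k"
    then have "{1..<length xs} = {1..k}" by (auto simp: full_chains_def)
    then show "c xs * (\<Sum>i = 1..<length xs. (- 1) ^ i *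
        (\<Sum>y\<in>{y \<in> P. xs ! (i - 1) \<prec> y \<and> y \<prec> xs ! i}. symbol (take i xs @ y # drop i xs) zs)) =
      (\<Sum>i = 1..k. (- 1) ^ i * (c xs *
        (\<Sum>y\<in>{y \<in> P. xs ! (i - 1) \<prec> y \<and> y \<prec> xs ! i}. symbol (take i xs @ y # drop i xs) zs)))"
      by (simp only: sum_distrib_left mult.left_commute)
  qed
  also have "\<dots> = (\<Sum>i\<in>{1..k}. \<Sum>xs\<in>\<C> k. (-1) ^ i *
      (c xs * (\<Sum>y\<in>Y xs i. symbol (take i xs @ y # drop i xs) zs)))"
    by (rule sum.swap)
  also have "\<dots> = (\<Sum>i\<in>{1..k}. if zs \<in> \<C> (Suc k) then (-1) ^ i * c (omit i zs) else 0)"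
  proof (rule sum.cong[OF refl])
    fix i assume i: "i \<in> {1..k}"
    have inner: "(\<Sum>y\<in>Y xs i. symbol (take i xs @ y # drop i xs) zs) =
        (if zs \<in> \<C> (Suc k) \<and> xs = omit i zs then 1 else (0 :: 'k))" if xs: "xs \<in> \<C> k" for xs
    proof (cases "zs \<in> \<C> (Suc k)")
      case True
      have len: "length zs = Suc (length xs)" "i \<le> length xs"
        using True xs i by (auto simp: full_chains_def)
      have "(\<Sum>y\<in>Y xs i. symbol (take i xs @ y # drop i xs) zs) =
          (\<Sum>y\<in>Y xs i. if xs = omit i zs \<and> y = zs ! i then 1 else (0 :: 'k))"
        by (intro sum.cong refl) (auto simp: symbol_def simp flip: insert_eq_iff_omit[OF len])
      also have "\<dots> = (if xs = omit i zs then \<Sum>y\<in>Y xs i. if y = zs ! i then 1 else 0 else 0)"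
        by auto
      also have "\<dots> = (if xs = omit i zs then 1 else 0)"
      proof (cases "xs = omit i zs")
        case eq: True
        have sorted: "sorted_wrt (\<prec>) zs" and lz: "length zs = Suc (Suc k)" and zP: "set zs \<subseteq> P"
          using True by (auto simp: full_chains_def)
        have "xs ! (i - 1) = zs ! (i - 1)" "xs ! i = zs ! Suc i"
          using i lz by (auto simp: eq omit_def nth_append)
        then have "zs ! i \<in> Y xs i"
          using sorted_wrt_nth_less[OF sorted, of "i - 1" i] sorted_wrt_nth_less[OF sorted, of i "Suc i"]
            i lz zP nth_mem[of i zs] by (auto simp: Y_def)
        moreover have "finite (Y xs i)" using finite_P by (simp add: Y_def)
        ultimately show ?thesis by (simp flip: eq)
      qed simp
      finally show ?thesis using True by simp
    next
      case False
      have "symbol (take i xs @ y # drop i xs) zs = (0 :: 'k)" if "y \<in> Y xs i" for y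
        using full_chains_insert[OF xs i, of y] that False by (auto simp: Y_def symbol_def)
      then show ?thesis using False by simp
    qed
    have "(\<Sum>xs\<in>\<C> k. (-1) ^ i * (c xs * (\<Sum>y\<in>Y xs i. symbol (take i xs @ y # drop i xs) zs))) =
        (\<Sum>xs\<in>\<C> k. if xs = omit i zs then if zs \<in> \<C> (Suc k) then (-1) ^ i * c xs else 0 else 0)"
      by (intro sum.cong) (auto simp: inner)
    also have "\<dots> = (if zs \<in> \<C> (Suc k) then (-1) ^ i * c (omit i zs) else 0)"
      using full_chains_omit(2)[OF _ i, of zs] finite_full_chains by (auto simp: sum.delta')
    finally show "(\<Sum>xs\<in>\<C> k. (-1) ^ i * (c xs * (\<Sum>y\<in>Y xs i. symbol (take i xs @ y # drop i xs) zs))) =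
        (if zs \<in> \<C> (Suc k) then (-1) ^ i * c (omit i zs) else 0)" .
  qed
  finally show ?thesis by (auto simp: alt_sum_def)
qed

lemma alt_sum_cong:
  "\<lbrakk>b \<in> \<C> (Suc k); \<And>a. a \<in> \<C> k \<Longrightarrow> c a = c' a\<rbrakk> \<Longrightarrow> alt_sum k c b = alt_sum k c' b"
  using full_chains_omit(2) by (auto simp: alt_sum_def intro!: sum.cong)

lemma coboundary_diff: "\<delta> k (\<lambda>s. c s - c' s) = (\<lambda>s. \<delta> k c s - \<delta> k c' s)"
  by (auto simp: fun_eq_iff coboundary_apply alt_sum_diff)

lemma coboundary_scale: "\<delta> k (\<lambda>s. a * c s) = (\<lambda>s. a * \<delta> k c s)"
  by (auto simp: fun_eq_iff coboundary_apply alt_sum_scale)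

lemma coboundary_zero: "\<delta> k (\<lambda>_. 0) = (\<lambda>_. 0)"
  by (auto simp: fun_eq_iff coboundary_apply alt_sum_def)

lemma coboundary_coboundary: "\<delta> (Suc k) (\<delta> k c) = (\<lambda>_. 0)"
proof
  fix b
  have "alt_sum (Suc k) (\<delta> k c) b = 0" if b: "b \<in> \<C> (Suc (Suc k))"
  proof -
    have "alt_sum (Suc k) (\<delta> k c) b = alt_sum (Suc k) (alt_sum k c) b"
      by (rule alt_sum_cong[OF b]) (simp add: coboundary_apply)
    also have "\<dots> = 0" using b by (intro alt_sum_alt_sum) (simp add: full_chains_def)
    finally show ?thesis .
  qed
  then show "\<delta> (Suc k) (\<delta> k c) b = 0" by (simp add: coboundary_apply)
qed

section \<open>The matching as a triangular linear system\<close>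

definition free_chains :: "nat \<Rightarrow> 'p list set" where
  "free_chains k = {xs \<in> \<C> k. free_side xs}"

definition rising_chains :: "'p list set" where
  "rising_chains = {xs \<in> \<C> r. rising xs}"

lemma finite_rising_chains: "finite rising_chains"
  unfolding rising_chains_def by (rule finite_subset[OF _ finite_full_chains]) auto

text \<open>The triangularity hypothesis. If another face \<open>a'\<close> of
  \<open>partner a\<close> is free, then \<open>partner a\<close> is a filled insertion of
  \<open>a'\<close> other than its partner, so its weight, which is also that of \<open>a\<close>,
  exceeds that of \<open>a'\<close>.\<close>

lemma partner_pivot:
  assumes a: "a \<in> free_chains k"
  shows "partner a \<in> \<C> (Suc k)"
    and "\<exists>j\<in>{1..k}. omit j (partner a) = a \<and>
      (\<forall>i\<in>{1..k} - {j}. omit i (partner a) \<in> free_chains k \<longrightarrow> weight (omit i (partner a)) < weight a)"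
proof -
  have ac: "a \<in> \<C> k" "free_side a" "chain a" using a full_chains_chain by (auto simp: free_chains_def)
  note p = partner[OF ac(3,2)]
  show pc: "partner a \<in> \<C> (Suc k)" using full_chains_insertion[OF ac(1)] p by blast
  then have len: "length (partner a) = Suc (Suc k)" by (simp add: full_chains_def)
  from p omit_insertion obtain j where j: "1 \<le> j" "j < length (partner a) - 1" "omit j (partner a) = a"
    by blast
  have "weight (omit i (partner a)) < weight a"
    if i: "i \<in> {1..k} - {j}" and free: "omit i (partner a) \<in> free_chains k" for i
  proof -
    let ?a' = "omit i (partner a)"
    have a': "chain ?a'" "free_side ?a'" using free full_chains_chain by (auto simp: free_chains_def)
    have "insertion ?a' (partner a)" using full_chains_omit(1)[OF pc] i by blast
    then have "partner a = partner ?a' \<or> weight ?a' < weight (partner a)"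
      using insertion_filled[OF a'] p by blast
    moreover have "partner a \<noteq> partner ?a'"
    proof
      assume "partner a = partner ?a'"
      then have "omit j (partner a) = omit i (partner a)"
        using partner_inj[OF ac(3,2) a'] j(3) by simp
      then have "j = i"
        using omit_eq_imp_eq[OF chain_distinct, of "partner a" j i] p j i len by simp
      then show False using i by simp
    qed
    ultimately show ?thesis using p by simp
  qed
  then show "\<exists>j\<in>{1..k}. omit j (partner a) = a \<and>
      (\<forall>i\<in>{1..k} - {j}. omit i (partner a) \<in> free_chains k \<longrightarrow> weight (omit i (partner a)) < weight a)"
    using j len by (intro bexI[of _ j]) auto
qed

lemma free_cocycle_zero:
  assumes supp: "\<And>x. x \<notin> free_chains k \<Longrightarrow> c x = 0" and \<delta>: "\<And>a. a \<in> free_chains k \<Longrightarrow> \<delta> k c (partner a) = 0"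
  shows "c = (\<lambda>_. 0)"
proof
  fix a
  show "c a = 0"
  proof (rule alt_sum_zero_matched[where A = "free_chains k" and \<phi> = partner and w = weight and k = k])
    fix a assume "a \<in> free_chains k"
    then show "alt_sum k c (partner a) = 0"
      using \<delta> partner_pivot(1) by (fastforce simp: coboundary_apply)
  qed (use supp partner_pivot(2) in auto)
qed

text \<open>Every filled chain is a partner, so solving the triangular system on partners prescribes
  the coboundary on all filled chains.\<close>

lemma prescribe_on_filled:
  obtains w :: "'p list \<Rightarrow> 'k::comm_ring_1"
  where "\<And>x. x \<notin> free_chains k \<Longrightarrow> w x = 0"
    "\<And>b. b \<in> \<C> (Suc k) \<Longrightarrow> filled_side b \<Longrightarrow> \<delta> k w b = g b"
proof -
  have fin: "finite (free_chains k)" using finite_full_chains by (simp add: free_chains_def)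
  obtain w :: "'p list \<Rightarrow> 'k" where w: "\<And>x. x \<notin> free_chains k \<Longrightarrow> w x = 0"
      "\<And>a. a \<in> free_chains k \<Longrightarrow> alt_sum k w (partner a) = g (partner a)"
  proof (rule alt_sum_solve_matched[where A = "free_chains k" and \<phi> = partner and w = weight and k = k
        and N = "Suc (Max (weight ` free_chains k))" and g = g])
    show "weight a < Suc (Max (weight ` free_chains k))" if "a \<in> free_chains k" for a
      using fin that by (simp add: less_Suc_eq_le)
  qed (use partner_pivot(2) in auto)
  have "\<delta> k w b = g b" if b: "b \<in> \<C> (Suc k)" "filled_side b" for b
  proof -
    obtain a where a: "chain a" "free_side a" "partner a = b"
      using filled_imp_partner[OF full_chains_chain[OF b(1)] b(2)] by blast
    have ins: "insertion a b" using partner[OF a(1,2)] a(3) by simp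
    have "a \<in> \<C> k"
      using b(1) a(1) insertion_hd[OF ins] insertion_last[OF ins] length_insertion[OF ins]
      by (auto simp: full_chains_def chain_def)
    then show ?thesis using w(2)[of a] a b by (simp add: free_chains_def coboundary_apply)
  qed
  with w(1) show thesis by (rule that)
qed

text \<open>Every step adds at least one label, and a rising step exactly one.\<close>

lemma chain_length:
  "chain xs \<Longrightarrow> length xs - 1 \<le> card (L - M (hd xs))"
  "\<lbrakk>chain xs; rising xs\<rbrakk> \<Longrightarrow> length xs - 1 = card (L - M (hd xs))"
proof -
  have "length xs - 1 \<le> card (L - M (hd xs)) \<and> (rising xs \<longrightarrow> length xs - 1 = card (L - M (hd xs)))"
    if "chain xs" for xs
    using that
  proof (induction xs rule: rising.induct)
    case (1 x y zs)
    then have P: "x \<in> P" "y \<in> P" "x \<prec> y" by (auto simp: chain_hd)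
    have sub: "L - M y \<subset> L - M x" using M_strict_mono[OF P] M_subset[OF P(2)] by blast
    then have lt: "card (L - M y) < card (L - M x)" using finite_L by (intro psubset_card_mono) auto
    have "card (L - M x) = Suc (card (L - M y))" if "rising_step x y"
    proof -
      have "next_label x \<in> L - M x" using first_label_next[OF P] by (auto simp: first_label_def)
      moreover have "L - M y = (L - M x) - {next_label x}" using that by auto
      ultimately show ?thesis using finite_L by (metis card_Suc_Diff1 finite_Diff)
    qed
    then show ?case using 1 lt by auto
  qed auto
  then show "chain xs \<Longrightarrow> length xs - 1 \<le> card (L - M (hd xs))"
    "\<lbrakk>chain xs; rising xs\<rbrakk> \<Longrightarrow> length xs - 1 = card (L - M (hd xs))" by blast+
qed

lemma full_chains_length: "xs \<in> \<C> k \<Longrightarrow> k \<le> r" "\<lbrakk>xs \<in> \<C> k; rising xs\<rbrakk> \<Longrightarrow> k = r"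
  using chain_length[OF full_chains_chain] M_minimal[of "hd xs"] by (fastforce simp: full_chains_def)+

lemma full_chains_Suc_r: "r < k \<Longrightarrow> \<C> k = {}"
  using full_chains_length(1) by fastforce

text \<open>The partner of such a chain would have \<open>Suc r\<close> steps, more than there are
  labels to add.\<close>

lemma free_chains_r: "free_chains r = {}"
  using partner_pivot(1) full_chains_Suc_r[of "Suc r"] by fastforce

lemma free_if_not_filled:
  assumes "k \<noteq> r" "x \<notin> free_chains k" "x \<in> \<C> k"
  shows "filled_side x"
  using assms full_chains_length(2) free_or_filled_or_rising(1)[OF full_chains_chain[OF assms(3)]]
  by (auto simp: free_chains_def)

lemma cocycles_eq:
  "cocycles P R k = {c. (\<forall>s. s \<notin> \<C> k \<longrightarrow> c s = 0) \<and> \<delta> k c = (\<lambda>_. 0)}"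
  by (auto simp: cocycles_def cochains_def)

lemma coboundaries_Suc_eq:
  "coboundaries P R (Suc k) = \<delta> k ` {c. \<forall>s. s \<notin> \<C> k \<longrightarrow> c s = 0}"
  by (simp add: cochains_def)

text \<open>Normal form modulo coboundaries: subtracting \<open>w\<close> makes a cochain vanish on
  all filled chains. In degree 0 there are none, because a one-element chain has no step.\<close>

lemma reduce_mod_coboundary:
  fixes c :: "'p list \<Rightarrow> 'k::comm_ring_1"
  assumes "\<And>s. s \<notin> \<C> k \<Longrightarrow> c s = 0"
  obtains w where "w \<in> coboundaries P R k" "\<And>s. s \<notin> \<C> k \<Longrightarrow> w s = 0"
    "\<And>b. b \<in> \<C> k \<Longrightarrow> filled_side b \<Longrightarrow> w b = c b"
proof (cases k)
  case 0
  have "\<not> filled_side b" if "b \<in> \<C> 0" for b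
    using that by (cases b rule: filled_side.cases) (auto simp: full_chains_def)
  then show thesis using that[of "\<lambda>_. 0"] 0 by auto
next
  case (Suc k')
  obtain v :: "'p list \<Rightarrow> 'k" where "\<And>x. x \<notin> free_chains k' \<Longrightarrow> v x = 0"
      "\<And>b. b \<in> \<C> k \<Longrightarrow> filled_side b \<Longrightarrow> \<delta> k' v b = c b"
    using prescribe_on_filled[of k' c] Suc by blast
  moreover from this have "\<delta> k' v \<in> coboundaries P R k"
    unfolding Suc coboundaries_Suc_eq by (intro imageI) (auto simp: free_chains_def)
  ultimately show thesis using that[of "\<delta> k' v"] by (simp add: Suc coboundary_apply)
qed

lemma coboundaries_subset_cocycles: "coboundaries P R k \<subseteq> cocycles P R k"
proof (cases k)
  case 0
  then show ?thesis by (simp add: cocycles_eq coboundary_zero)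
next
  case (Suc k')
  then show ?thesis
    by (auto simp only: cocycles_eq coboundaries_Suc_eq coboundary_coboundary)
      (simp add: coboundary_apply)
qed

text \<open>Away from degree \<open>r\<close> no full chain is rising, so the reduced cocycle is
  supported on free chains, and triangularity makes it zero.\<close>

lemma cocycles_subset_coboundaries:
  assumes "k \<noteq> r"
  shows "cocycles P R k \<subseteq> (coboundaries P R k :: ('p list \<Rightarrow> 'k::comm_ring_1) set)"
proof
  fix c :: "'p list \<Rightarrow> 'k"
  assume c: "c \<in> cocycles P R k"
  obtain w where w: "w \<in> coboundaries P R k" "\<And>s. s \<notin> \<C> k \<Longrightarrow> w s = 0"
      "\<And>b. b \<in> \<C> k \<Longrightarrow> filled_side b \<Longrightarrow> w b = c b"
    using reduce_mod_coboundary[of k c] c by (auto simp: cocycles_eq)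
  have "\<delta> k c = (\<lambda>_. 0)" "\<delta> k w = (\<lambda>_. 0)"
    using c w(1) coboundaries_subset_cocycles by (auto simp: cocycles_eq)
  then have "\<delta> k (\<lambda>s. c s - w s) = (\<lambda>_. 0)" by (simp add: coboundary_diff)
  moreover have "c x - w x = 0" if "x \<notin> free_chains k" for x
    using free_if_not_filled[OF assms that] c w by (cases "x \<in> \<C> k") (auto simp: cocycles_eq)
  ultimately have "(\<lambda>s. c s - w s) = (\<lambda>_. 0)"
    by (intro free_cocycle_zero[of k]) auto
  then have "c = w" by (simp add: fun_eq_iff)
  then show "c \<in> coboundaries P R k" using w(1) by simp
qed

text \<open>In degree \<open>r\<close> there are no free chains, so the reduced cocycle is supported
  on rising chains.\<close>

lemma span_rising:
  fixes c :: "'p list \<Rightarrow> 'k::comm_ring_1"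
  assumes "c \<in> cocycles P R r"
  shows "\<exists>u\<in>carrier (free_module rising_chains). (\<lambda>s. c s - u s) \<in> coboundaries P R r"
proof -
  obtain w where w: "w \<in> coboundaries P R r" "\<And>s. s \<notin> \<C> r \<Longrightarrow> w s = 0"
      "\<And>b. b \<in> \<C> r \<Longrightarrow> filled_side b \<Longrightarrow> w b = c b"
    using reduce_mod_coboundary[of r c] assms by (auto simp: cocycles_eq)
  have "c s - w s = 0" if "s \<notin> rising_chains" for s
  proof (cases "s \<in> \<C> r")
    case True
    then have "filled_side s"
      using that free_chains_r free_or_filled_or_rising(1)[OF full_chains_chain[OF True]]
      by (auto simp: rising_chains_def free_chains_def)
    then show ?thesis using w(3)[OF True] by simp
  qed (use w(2) assms in \<open>auto simp: cocycles_eq\<close>)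
  then show ?thesis using w(1) by (intro bexI[of _ "\<lambda>s. c s - w s"]) auto
qed

text \<open>Write \<open>u\<close> as the coboundary of \<open>v\<close> and reduce \<open>v\<close>
  so that it is supported on free chains of degree \<open>r - 1\<close>; this does not change its
  coboundary. Since \<open>u\<close> vanishes on filled chains, in particular on partners,
  triangularity makes the reduced cochain zero.\<close>

lemma indep_rising:
  fixes u :: "'p list \<Rightarrow> 'k::comm_ring_1"
  assumes u: "u \<in> carrier (free_module rising_chains)" and cob: "u \<in> coboundaries P R r"
  shows "u = (\<lambda>_. 0)"
proof (cases r)
  case 0
  then show ?thesis using cob by simp
next
  case (Suc k)
  then obtain v where v: "\<And>s. s \<notin> \<C> k \<Longrightarrow> v s = 0" "u = \<delta> k v"
    using cob by (auto simp: coboundaries_Suc_eq simp del: coboundaries.simps)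
  obtain w where w: "w \<in> coboundaries P R k" "\<And>s. s \<notin> \<C> k \<Longrightarrow> w s = 0"
      "\<And>b. b \<in> \<C> k \<Longrightarrow> filled_side b \<Longrightarrow> w b = v b"
    using reduce_mod_coboundary[of k v] v(1) by blast
  have "\<delta> k w = (\<lambda>_. 0)" using w(1) coboundaries_subset_cocycles by (auto simp: cocycles_eq)
  then have uvw: "\<delta> k (\<lambda>s. v s - w s) = u" by (simp add: coboundary_diff v(2))
  have "v x - w x = 0" if "x \<notin> free_chains k" for x
    using free_if_not_filled[OF _ that] v(1) w Suc by (cases "x \<in> \<C> k") auto
  moreover have "\<delta> k (\<lambda>s. v s - w s) (partner a) = 0" if a: "a \<in> free_chains k" for a
  proof -
    have "partner a \<in> \<C> r" "filled_side (partner a)"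
      using partner_pivot(1)[OF a] partner[OF full_chains_chain] a Suc by (auto simp: free_chains_def)
    then have "partner a \<notin> rising_chains"
      using free_or_filled_or_rising(4)[OF full_chains_chain] by (auto simp: rising_chains_def)
    then show ?thesis using u by (simp add: uvw)
  qed
  ultimately have "(\<lambda>s. v s - w s) = (\<lambda>_. 0)" by (intro free_cocycle_zero[of k]) auto
  then have "v = w" by (simp add: fun_eq_iff)
  then show ?thesis using v(2) \<open>\<delta> k w = (\<lambda>_. 0)\<close> by simp
qed

lemma function_quotient_cohomology: "function_quotient (cocycles P R k) (coboundaries P R k)"
proof
  show "coboundaries P R k \<subseteq> cocycles P R k" by (rule coboundaries_subset_cocycles)
  show "(\<lambda>s. x s - y s) \<in> cocycles P R k" if "x \<in> cocycles P R k" "y \<in> cocycles P R k" for x y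
    using that by (auto simp: cocycles_eq coboundary_diff)
  show "(\<lambda>_. 0) \<in> coboundaries P R k"
  proof (cases k)
    case (Suc k')
    show ?thesis unfolding Suc coboundaries_Suc_eq
      by (rule image_eqI[of _ _ "\<lambda>_. 0"]) (auto simp: coboundary_zero)
  qed simp
  show "(\<lambda>s. x s - y s) \<in> coboundaries P R k" if "x \<in> coboundaries P R k" "y \<in> coboundaries P R k" for x y
  proof (cases k)
    case (Suc k')
    with that obtain x' y' where x': "\<forall>s. s \<notin> \<C> k' \<longrightarrow> x' s = 0" "x = \<delta> k' x'"
        and y': "\<forall>s. s \<notin> \<C> k' \<longrightarrow> y' s = 0" "y = \<delta> k' y'"
      by (auto simp: coboundaries_Suc_eq simp del: coboundaries.simps)
    show ?thesis unfolding Suc coboundaries_Suc_eq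
      by (rule image_eqI[of _ _ "\<lambda>s. x' s - y' s"]) (use x' y' in \<open>auto simp: coboundary_diff\<close>)
  qed (use that in simp)
  show "(\<lambda>s. a * x s) \<in> coboundaries P R k" if "x \<in> coboundaries P R k" for a x
  proof (cases k)
    case (Suc k')
    with that obtain x' where x': "\<forall>s. s \<notin> \<C> k' \<longrightarrow> x' s = 0" "x = \<delta> k' x'"
      by (auto simp: coboundaries_Suc_eq simp del: coboundaries.simps)
    show ?thesis unfolding Suc coboundaries_Suc_eq
      by (rule image_eqI[of _ _ "\<lambda>s. a * x' s"]) (use x' in \<open>auto simp: coboundary_scale\<close>)
  qed (use that in simp)
qed

lemma cohomology_trivial:
  assumes "k \<noteq> r"
  shows "carrier (cohomology P R k :: ('k::comm_ring_1, _) module) = {\<zero>\<^bsub>cohomology P R k\<^esub>}"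
  unfolding cohomology_def cochains_def
  by (rule function_quotient.carrier_Q_trivial[OF function_quotient_cohomology])
    (rule cocycles_subset_coboundaries[OF assms])

lemma cohomology_rising_basis:
  "linear_bij (shift (coboundaries P R r)) (free_module rising_chains)
    (cohomology P R r :: ('k::comm_ring_1, _) module)"
  unfolding cohomology_def cochains_def
proof (rule function_quotient.linear_bij_shift[OF function_quotient_cohomology])
  \<comment> \<open>Every cochain of degree \<open>r\<close> is a cocycle, as there are no chains of
    degree \<open>Suc r\<close>.\<close>
  show "carrier (free_module rising_chains) \<subseteq> (cocycles P R r :: ('p list \<Rightarrow> 'k) set)"
    using full_chains_Suc_r[of "Suc r"]
    by (auto simp: cocycles_eq rising_chains_def fun_eq_iff coboundary_apply)
qed (use span_rising indep_rising in blast)+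

section \<open>Poset automorphisms and the induced action on cohomology\<close>

definition automorphism :: "('p \<Rightarrow> 'p) \<Rightarrow> ('p \<Rightarrow> 'p) \<Rightarrow> bool" where
  "automorphism f f' \<longleftrightarrow>
    (\<forall>x\<in>P. f x \<in> P \<and> f' x \<in> P \<and> f' (f x) = x \<and> f (f' x) = x) \<and>
    (\<forall>x\<in>P. \<forall>y\<in>P. (f x, f y) \<in> R \<longleftrightarrow> (x, y) \<in> R)"

lemma automorphism_sym: "automorphism f f' \<Longrightarrow> automorphism f' f"
  unfolding automorphism_def by metis

lemma automorphism_below:
  "\<lbrakk>automorphism f f'; x \<in> P; y \<in> P\<rbrakk> \<Longrightarrow> f x \<prec> f y \<longleftrightarrow> x \<prec> y"
  unfolding automorphism_def strictly_below_def by metis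

lemma automorphism_full_chains:
  assumes f: "automorphism f f'" and xs: "xs \<in> \<C> k"
  shows "map f xs \<in> \<C> k" "map f' (map f xs) = xs"
proof -
  have P: "set xs \<subseteq> P" and ne: "xs \<noteq> []" using xs by (auto simp: full_chains_def)
  have fP: "f x \<in> P" "f' x \<in> P" "f' (f x) = x" "f (f' x) = x" if "x \<in> P" for x
    using f that by (auto simp: automorphism_def)
  show "map f' (map f xs) = xs" using P fP by (auto intro!: map_idI)
  have minimal: "minimal_in P R (f x)" if "minimal_in P R x" for x
    using that fP automorphism_below[OF f, of "f' _" x] unfolding minimal_in_def by metis
  have maximal: "maximal_in P R (f x)" if "maximal_in P R x" for x
    using that fP automorphism_below[OF f, of x "f' _"] unfolding maximal_in_def by metis
  have "sorted_wrt (\<prec>) (map f xs)"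
    unfolding sorted_wrt_map
    by (rule sorted_wrt_mono_rel[of _ "(\<prec>)"])
      (use xs P automorphism_below[OF f] in \<open>auto simp: full_chains_def\<close>)
  then show "map f xs \<in> \<C> k"
    using xs ne P fP(1) minimal maximal by (auto simp: full_chains_def hd_map last_map)
qed

lemma linear_extension_map_apply:
  fixes c :: "'p list \<Rightarrow> 'k::comm_ring_1"
  assumes f: "automorphism f f'"
  shows "linear_extension (\<C> k) (\<lambda>xs. symbol (map f xs)) c zs =
    (if zs \<in> \<C> k then c (map f' zs) else 0)"
proof -
  have f': "automorphism f' f" by (rule automorphism_sym[OF f])
  have "linear_extension (\<C> k) (\<lambda>xs. symbol (map f xs)) c zs =
      (\<Sum>xs\<in>\<C> k. if xs = map f' zs then if zs \<in> \<C> k then c xs else 0 else 0)"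
    unfolding linear_extension_def
  proof (rule sum.cong[OF refl])
    fix xs assume xs: "xs \<in> \<C> k"
    have "zs = map f xs \<longleftrightarrow> xs = map f' zs \<and> zs \<in> \<C> k"
      using automorphism_full_chains[OF f xs] automorphism_full_chains[OF f', of zs k] by metis
    then show "c xs * symbol (map f xs) zs = (if xs = map f' zs then if zs \<in> \<C> k then c xs else 0 else 0)"
      by (auto simp: symbol_def)
  qed
  also have "\<dots> = (if zs \<in> \<C> k then c (map f' zs) else 0)"
    using automorphism_full_chains(1)[OF f', of zs k] finite_full_chains by (simp add: sum.delta')
  finally show ?thesis .
qed

text \<open>A class is moved as a set of cochains, so the coboundaries have to be mapped onto the
  coboundaries: into them because removing a position commutes with \<open>map\<close>, and onto
  them by applying the inverse automorphism.\<close>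

lemma cohomology_action_shift:
  fixes u :: "'p list \<Rightarrow> 'k::comm_ring_1"
  assumes \<gamma>: "automorphism (\<gamma> g) f'"
  shows "cohomology_action P R k \<gamma> g (shift (coboundaries P R k) u) =
    shift (coboundaries P R k) (cochain_action P R k \<gamma> g u)"
proof -
  define act where "act f k c = (\<lambda>zs. if zs \<in> \<C> k then c (map f zs) else (0 :: 'k))"
    for f :: "'p \<Rightarrow> 'p" and k c
  have act: "cochain_action P R k \<gamma> g = act f' k"
    by (intro ext) (simp add: act_def cochain_action_def linear_extension_map_apply[OF \<gamma>])
  have act_cob: "act f k ` coboundaries P R k \<subseteq> coboundaries P R k" if f: "automorphism f h" for f h
  proof (cases k)
    case 0
    then show ?thesis by (simp add: act_def fun_eq_iff)
  next
    case (Suc k')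
    have "act f k (\<delta> k' w) = \<delta> k' (act f k' w)" for w
    proof
      fix zs
      show "act f k (\<delta> k' w) zs = \<delta> k' (act f k' w) zs"
      proof (cases "zs \<in> \<C> k")
        case True
        have "alt_sum k' w (map f zs) = alt_sum k' (act f k' w) zs"
          using full_chains_omit(2)[of zs k'] True Suc
          by (auto simp: alt_sum_def omit_map act_def intro!: sum.cong)
        then show ?thesis
          using True automorphism_full_chains(1)[OF f True] by (simp add: act_def coboundary_apply Suc)
      qed (simp add: act_def coboundary_apply Suc)
    qed
    moreover have "\<forall>s. s \<notin> \<C> k' \<longrightarrow> act f k' w s = 0" for w by (simp add: act_def)
    ultimately show ?thesis unfolding Suc coboundaries_Suc_eq by blast
  qed
  have f': "automorphism f' (\<gamma> g)" by (rule automorphism_sym[OF \<gamma>])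
  have "coboundaries P R k \<subseteq> act f' k ` coboundaries P R k"
  proof
    fix x :: "'p list \<Rightarrow> 'k" assume x: "x \<in> coboundaries P R k"
    have "\<And>s. s \<notin> \<C> k \<Longrightarrow> x s = 0" using x coboundaries_subset_cocycles[of k] by (auto simp: cocycles_eq)
    then have "x = act f' k (act (\<gamma> g) k x)"
      using automorphism_full_chains[OF f', of _ k] by (auto simp: act_def fun_eq_iff)
    then show "x \<in> act f' k ` coboundaries P R k" using act_cob[OF \<gamma>] x by blast
  qed
  then have N: "act f' k ` coboundaries P R k = coboundaries P R k" using act_cob[OF f'] by blast
  have "act f' k ` shift (coboundaries P R k) u = (\<lambda>h s. h s + act f' k u s) ` (act f' k ` coboundaries P R k)"
    unfolding shift_def image_image by (rule image_cong[OF refl]) (auto simp: act_def fun_eq_iff)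
  then show ?thesis unfolding cohomology_action_def act by (simp only: N shift_def)
qed

end

section \<open>Non-crossing partitions as minimum maps\<close>

text \<open>A non-crossing partition is encoded by the map that sends an element to the minimum of its
  block. For such maps being non-crossing becomes the last condition below, and the partition of
  \<open>s\<close> refines that of \<open>r\<close> iff \<open>r \<circ> s = r\<close>.\<close>

definition nc_maps :: "nat \<Rightarrow> (nat \<Rightarrow> nat) set" where
  "nc_maps n = {r. (\<forall>i\<in>{1..n}. 1 \<le> r i \<and> r i \<le> i \<and> r (r i) = r i) \<and>
     (\<forall>i\<in>{1..n}. \<forall>j\<in>{1..<i}. j \<le> r i \<or> r i \<le> r j)}"

definition block :: "nat \<Rightarrow> (nat \<Rightarrow> nat) \<Rightarrow> nat \<Rightarrow> nat set" where
  "block n r m = {i \<in> {1..n}. r i = m}"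

definition blocks :: "nat \<Rightarrow> (nat \<Rightarrow> nat) \<Rightarrow> nat set set" where
  "blocks n r = block n r ` r ` {1..n}"

lemma nc_mapsD:
  assumes "r \<in> nc_maps n" "i \<in> {1..n}"
  shows "1 \<le> r i" "r i \<le> i" "r (r i) = r i" "r i \<in> {1..n}"
    "\<lbrakk>1 \<le> j; j < i\<rbrakk> \<Longrightarrow> j \<le> r i \<or> r i \<le> r j"
  using assms unfolding nc_maps_def by (auto intro: order_trans)

lemma fixed_iff:
  assumes "r \<in> nc_maps n" "i \<in> {1..n}"
  shows "r i = i \<longleftrightarrow> i \<in> r ` {1..n}"
  using nc_mapsD(3)[OF assms(1)] assms(2) by force

lemma partition_on_blocks:
  assumes r: "r \<in> nc_maps n"
  shows "partition_on {1..n} (blocks n r)"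
proof (rule partition_onI)
  show "\<Union>(blocks n r) = {1..n}" by (auto simp: blocks_def block_def)
  show "{} \<notin> blocks n r" by (auto simp: blocks_def block_def)
qed (auto simp: blocks_def block_def disjnt_def)

text \<open>Let \<open>i < j < k < l\<close>, where \<open>a\<close> is the value at
  \<open>i\<close> and \<open>k\<close>, and \<open>b\<close> that at \<open>j\<close> and
  \<open>l\<close>. The condition at \<open>k\<close> and \<open>j\<close> gives
  \<open>a \<le> b\<close>, since \<open>a \<le> i < j\<close>; the condition at \<open>l\<close>
  and \<open>k\<close> gives \<open>b \<le> a\<close>, since \<open>b \<le> j < k\<close>.\<close>

lemma noncrossing_blocks:
  assumes r: "r \<in> nc_maps n"
  shows "noncrossing (blocks n r)"
  unfolding noncrossing_def
proof (intro allI ballI impI)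
  fix i j k l S T
  assume "S \<in> blocks n r" "T \<in> blocks n r"
    and *: "i < j \<and> j < k \<and> k < l \<and> i \<in> S \<and> k \<in> S \<and> j \<in> T \<and> l \<in> T"
  then obtain a b where ab: "S = block n r a" "T = block n r b" by (auto simp: blocks_def)
  with * have el: "i \<in> {1..n}" "j \<in> {1..n}" "k \<in> {1..n}" "l \<in> {1..n}" "r i = a" "r k = a" "r j = b" "r l = b"
    by (auto simp: block_def)
  have "j \<le> a \<or> a \<le> b" using nc_mapsD(5)[OF r el(3), of j] * el by auto
  moreover have "k \<le> b \<or> b \<le> a" using nc_mapsD(5)[OF r el(4), of k] * el by auto
  moreover have "a \<le> i" "b \<le> j" using nc_mapsD(2)[OF r el(1)] nc_mapsD(2)[OF r el(2)] el by auto
  ultimately show "S = T" using ab * by force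
qed

lemma Min_block:
  assumes r: "r \<in> nc_maps n" and m: "m \<in> r ` {1..n}"
  shows "Min (block n r m) = m"
proof (rule Min_eqI)
  show "m \<in> block n r m" using m nc_mapsD[OF r] by (auto simp: block_def)
  show "m \<le> i" if "i \<in> block n r m" for i using that nc_mapsD(2)[OF r, of i] by (auto simp: block_def)
qed (simp add: block_def)

lemma Min_blocks:
  assumes r: "r \<in> nc_maps n"
  shows "Min ` blocks n r = r ` {1..n}"
  using Min_block[OF r] by (auto simp: blocks_def image_image)

lemma refines_blocks_iff:
  assumes r: "r \<in> nc_maps n" and s: "s \<in> nc_maps n"
  shows "refines {1..n} (blocks n s) (blocks n r) \<longleftrightarrow> (\<forall>i\<in>{1..n}. r (s i) = r i)"
proof
  assume ref: "refines {1..n} (blocks n s) (blocks n r)"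
  show "\<forall>i\<in>{1..n}. r (s i) = r i"
  proof
    fix i assume i: "i \<in> {1..n}"
    then have "block n s (s i) \<in> blocks n s" by (auto simp: blocks_def)
    then obtain Y where "Y \<in> blocks n r" "block n s (s i) \<subseteq> Y" using ref unfolding refines_def by blast
    then obtain m where "block n s (s i) \<subseteq> block n r m" by (auto simp: blocks_def)
    moreover have "i \<in> block n s (s i)" "s i \<in> block n s (s i)"
      using i nc_mapsD[OF s i] by (auto simp: block_def)
    ultimately show "r (s i) = r i" by (auto simp: block_def)
  qed
next
  assume *: "\<forall>i\<in>{1..n}. r (s i) = r i"
  show "refines {1..n} (blocks n s) (blocks n r)"
    unfolding refines_def
  proof (intro conjI ballI)
    fix U assume "U \<in> blocks n s"
    then obtain i where i: "i \<in> {1..n}" "U = block n s (s i)" by (auto simp: blocks_def)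
    have "U \<subseteq> block n r (r i)"
    proof
      fix j assume "j \<in> U"
      then have "j \<in> {1..n}" "s j = s i" using i by (auto simp: block_def)
      then have "r j = r i" using bspec[OF *, of j] bspec[OF *, of i] i(1) by simp
      with \<open>j \<in> {1..n}\<close> show "j \<in> block n r (r i)" by (simp add: block_def)
    qed
    moreover have "block n r (r i) \<in> blocks n r" using i by (auto simp: blocks_def)
    ultimately show "\<exists>Y\<in>blocks n r. U \<subseteq> Y" by blast
  qed (use partition_on_blocks r s in auto)
qed

text \<open>Values outside \<open>{1..n}\<close> are unconstrained in \<open>nc_maps\<close>, so a
  partition determines its map only on \<open>{1..n}\<close>. Refinement in both directions gives
  \<open>r i = r (s i) \<le> s i\<close> and the reverse inequality.\<close>

lemma blocks_eq_iff:
  assumes r: "r \<in> nc_maps n" and s: "s \<in> nc_maps n"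
  shows "blocks n r = blocks n s \<longleftrightarrow> (\<forall>i\<in>{1..n}. r i = s i)"
proof
  assume eq: "blocks n r = blocks n s"
  have "\<forall>i\<in>{1..n}. r (s i) = r i" "\<forall>i\<in>{1..n}. s (r i) = s i"
    using refines_blocks_iff[OF r s] refines_blocks_iff[OF s r] eq
      refines_refl[OF partition_on_blocks[OF s]] by simp_all
  then show "\<forall>i\<in>{1..n}. r i = s i"
    using nc_mapsD(2)[OF r] nc_mapsD(2)[OF s] nc_mapsD(4)[OF r] nc_mapsD(4)[OF s] by (metis le_antisym)
next
  assume *: "\<forall>i\<in>{1..n}. r i = s i"
  then have "r ` {1..n} = s ` {1..n}" "block n r = block n s" by (auto simp: block_def fun_eq_iff)
  then show "blocks n r = blocks n s" by (simp add: blocks_def)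
qed

lemma ex_nc_map:
  assumes \<rho>: "partition_on {1..n} \<rho>" and nc: "noncrossing \<rho>"
  shows "\<exists>r\<in>nc_maps n. blocks n r = \<rho>"
proof -
  have ex1: "\<exists>!S. S \<in> \<rho> \<and> i \<in> S" if "i \<in> {1..n}" for i
    using \<rho> that unfolding partition_on_def disjoint_def by blast
  define B where "B i = (THE S. S \<in> \<rho> \<and> i \<in> S)" for i
  define r where "r i = Min (B i)" for i
  have B: "B i \<in> \<rho>" "i \<in> B i" if "i \<in> {1..n}" for i
    using theI'[OF ex1[OF that]] by (auto simp: B_def)
  have B_eq: "B i = S" if "S \<in> \<rho>" "i \<in> S" for i S
  proof -
    have "i \<in> {1..n}" using that \<rho> by (auto simp: partition_on_def)
    then show ?thesis unfolding B_def using the1_equality[OF ex1] that by blast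
  qed
  have fin: "finite S" "S \<subseteq> {1..n}" "S \<noteq> {}" if "S \<in> \<rho>" for S
  proof -
    show S: "S \<subseteq> {1..n}" "S \<noteq> {}" using \<rho> that by (auto simp: partition_on_def)
    show "finite S" using S(1) by (rule finite_subset) simp
  qed
  have rB: "r i \<in> B i" if "i \<in> {1..n}" for i
    unfolding r_def using fin B that by (intro Min_in) auto
  have r_le: "r i \<le> j" if "i \<in> {1..n}" "j \<in> B i" for i j
    unfolding r_def using fin(1) B that by (intro Min_le) auto
  have r_eq_iff: "r i = r j \<longleftrightarrow> B i = B j" if "i \<in> {1..n}" "j \<in> {1..n}" for i j
    using B_eq[OF B(1)[OF that(1)] rB[OF that(1)]] B_eq[OF B(1)[OF that(2)] rB[OF that(2)]]
    by (metis r_def)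
  have r_in: "r i \<in> {1..n}" if "i \<in> {1..n}" for i using rB[OF that] fin(2)[OF B(1)[OF that]] by blast
  have rr: "r (r i) = r i" if "i \<in> {1..n}" for i
    using B_eq[OF B(1)[OF that] rB[OF that]] by (metis r_def)
  \<comment> \<open>A failure would mean \<open>r j < r i < j < i\<close>, where \<open>r j\<close>
    and \<open>j\<close> share one block and \<open>r i\<close> and \<open>i\<close> share another:
    a crossing.\<close>
  have cross: "j \<le> r i \<or> r i \<le> r j" if ij: "i \<in> {1..n}" "1 \<le> j" "j < i" for i j
  proof (rule ccontr)
    assume "\<not> ?thesis"
    then have lt: "r j < r i" "r i < j" by auto
    have j: "j \<in> {1..n}" using ij by auto
    have "B j = B i"
      using nc lt ij rB[OF j] rB[OF ij(1)] B[OF j] B[OF ij(1)] unfolding noncrossing_def by blast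
    then show False using lt by (simp add: r_def)
  qed
  have r: "r \<in> nc_maps n"
    using r_in rr r_le B(2) cross by (auto simp: nc_maps_def)
  have blk: "block n r (r i) = B i" if "i \<in> {1..n}" for i
  proof (rule Set.set_eqI)
    fix j
    show "j \<in> block n r (r i) \<longleftrightarrow> j \<in> B i"
      using r_eq_iff[of j i] that B[of j] B_eq[OF B(1)[OF that], of j] fin(2)[OF B(1)[OF that]]
      by (auto simp: block_def)
  qed
  have "blocks n r = B ` {1..n}" using blk by (auto simp: blocks_def image_image)
  also have "\<dots> = \<rho>"
  proof
    show "\<rho> \<subseteq> B ` {1..n}"
    proof
      fix S assume S: "S \<in> \<rho>"
      then obtain i where "i \<in> S" using fin(3) by blast
      then show "S \<in> B ` {1..n}" using B_eq[OF S] fin(2)[OF S] by blast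
    qed
  qed (use B in auto)
  finally show ?thesis using r by blast
qed

section \<open>The poset of non-crossing 2-partitions\<close>

text \<open>The permutation \<open>h\<close> carries each block of the non-crossing partition to the
  block of \<open>\<pi>\<close> assigned to it. Only the images of whole blocks matter, so different
  \<open>h\<close> may give the same element.\<close>

definition two_part :: "nat \<Rightarrow> (nat \<Rightarrow> nat) \<Rightarrow> (nat \<Rightarrow> nat) \<Rightarrow> two_partition" where
  "two_part n h r = ((`) h ` blocks n r, blocks n r, restrict (\<lambda>T. h -` T) ((`) h ` blocks n r))"

definition labels :: "two_partition \<Rightarrow> nat set" where
  "labels = (\<lambda>(\<pi>, \<rho>, f). Min ` \<rho>)"

lemma labels_two_part: "r \<in> nc_maps n \<Longrightarrow> labels (two_part n h r) = r ` {1..n}"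
  by (simp add: labels_def two_part_def Min_blocks)

lemma partition_on_image_permutes:
  assumes "h permutes A" "partition_on A \<rho>"
  shows "partition_on A ((`) h ` \<rho>)"
proof -
  have "inj_on h A" using assms(1) permutes_inj_on by blast
  moreover have "{} \<notin> (`) h ` \<rho>" using assms(2) by (auto simp: partition_on_def)
  then have "(`) h ` \<rho> - {{}} = (`) h ` \<rho>" by simp
  ultimately show ?thesis
    using partition_on_inj_image[OF assms(2), of h] permutes_image[OF assms(1)] by simp
qed

lemma two_part_in:
  assumes h: "h permutes {1..n}" and r: "r \<in> nc_maps n"
  shows "two_part n h r \<in> nc2_partitions n"
proof -
  have inj: "inj h" using h permutes_inj by blast
  have "bij_betw (restrict (\<lambda>T. h -` T) ((`) h ` blocks n r)) ((`) h ` blocks n r) (blocks n r)"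
    by (rule bij_betwI[where g = "(`) h"]) (auto simp: inj_vimage_image_eq[OF inj])
  moreover have "card ((restrict (\<lambda>T. h -` T) ((`) h ` blocks n r)) T) = card T"
    if "T \<in> (`) h ` blocks n r" for T
    using that by (auto simp: inj_vimage_image_eq[OF inj] card_image inj_on_subset[OF inj])
  ultimately show ?thesis
    using partition_on_blocks[OF r] noncrossing_blocks[OF r] partition_on_image_permutes[OF h]
    by (auto simp: nc2_partitions_def two_part_def)
qed

lemma two_part_cong:
  assumes "h permutes {1..n}" "h' permutes {1..n}" "\<And>S. S \<in> blocks n r \<Longrightarrow> h ` S = h' ` S"
  shows "two_part n h r = two_part n h' r"
proof -
  have "(`) h ` blocks n r = (`) h' ` blocks n r" by (rule image_cong[OF refl]) (rule assms(3))
  moreover have "h -` T = h' -` T" if "T \<in> (`) h ` blocks n r" for T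
    using that assms inj_vimage_image_eq[OF permutes_inj[OF assms(1)]]
      inj_vimage_image_eq[OF permutes_inj[OF assms(2)]] by (metis imageE)
  then have "restrict (\<lambda>T. h -` T) ((`) h ` blocks n r) = restrict (\<lambda>T. h' -` T) ((`) h ` blocks n r)"
    by (rule restrict_ext)
  ultimately show ?thesis unfolding two_part_def by simp
qed

text \<open>As corresponding blocks have the same size, there is a bijection from each block of
  \<open>\<rho>\<close> to its counterpart in \<open>\<pi>\<close>; glued together they form the
  permutation.\<close>

lemma ex_two_part:
  assumes "z \<in> nc2_partitions n"
  obtains h r where "h permutes {1..n}" "r \<in> nc_maps n" "z = two_part n h r"
proof -
  obtain \<pi> \<rho> f where z: "z = (\<pi>, \<rho>, f)" "partition_on {1..n} \<pi>" "partition_on {1..n} \<rho>"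
      "noncrossing \<rho>" "f \<in> extensional \<pi>" "bij_betw f \<pi> \<rho>" "\<forall>T\<in>\<pi>. card (f T) = card T"
    using assms by (cases z) (auto simp: nc2_partitions_def)
  obtain r where r: "r \<in> nc_maps n" "blocks n r = \<rho>" using ex_nc_map z by blast
  define f' where "f' = the_inv_into \<pi> f"
  have f': "f' S \<in> \<pi>" "f (f' S) = S" if "S \<in> \<rho>" for S
    using that z(6) by (auto simp: f'_def bij_betw_def the_inv_into_into f_the_inv_into_f)
  have f'f: "f' (f T) = T" if "T \<in> \<pi>" for T
    using that z(6) by (simp add: f'_def bij_betw_def the_inv_into_f_f)
  have fin: "finite S" "S \<subseteq> {1..n}" if "S \<in> \<rho> \<or> S \<in> \<pi>" for S
  proof -
    show S: "S \<subseteq> {1..n}" using z(2,3) that by (auto simp: partition_on_def)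
    show "finite S" using S by (rule finite_subset) simp
  qed
  have "\<exists>g. bij_betw g S (f' S)" if "S \<in> \<rho>" for S
    using f'[OF that] z(7) fin that by (intro finite_same_card_bij) auto
  then obtain g where g: "\<And>S. S \<in> \<rho> \<Longrightarrow> bij_betw (g S) S (f' S)" by metis
  define h where "h i = (if i \<in> {1..n} then g (THE S. S \<in> \<rho> \<and> i \<in> S) i else i)" for i
  have h_eq: "h i = g S i" if "S \<in> \<rho>" "i \<in> S" for S i
  proof -
    have "(THE S. S \<in> \<rho> \<and> i \<in> S) = S"
      using that z(3) unfolding partition_on_def disjoint_def by (intro the_equality) auto
    then show ?thesis using that fin(2)[of S] by (auto simp: h_def)
  qed
  have h_image: "h ` S = f' S" if "S \<in> \<rho>" for S
  proof -
    have "h ` S = g S ` S" by (rule image_cong[OF refl]) (rule h_eq[OF that])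
    then show ?thesis using bij_betw_imp_surj_on[OF g[OF that]] by simp
  qed
  have \<pi>: "\<pi> = f' ` \<rho>"
  proof
    show "\<pi> \<subseteq> f' ` \<rho>"
    proof
      fix T assume T: "T \<in> \<pi>"
      then have "f T \<in> \<rho>" using z(6) bij_betwE by blast
      then show "T \<in> f' ` \<rho>" using f'f[OF T] by (metis imageI)
    qed
  qed (use f' in auto)
  have "h ` {1..n} = h ` \<Union>\<rho>" using z(3) by (simp add: partition_on_def)
  also have "\<dots> = \<Union>((`) h ` \<rho>)" by auto
  also have "(`) h ` \<rho> = f' ` \<rho>" by (rule image_cong[OF refl]) (rule h_image)
  also have "\<Union>(f' ` \<rho>) = {1..n}" using z(2) \<pi> by (simp add: partition_on_def)
  finally have surj: "h ` {1..n} = {1..n}" .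
  then have "inj_on h {1..n}" by (intro eq_card_imp_inj_on) auto
  then have h: "h permutes {1..n}"
    using surj by (intro bij_imp_permutes) (auto simp: bij_betw_def h_def)
  have img: "(`) h ` \<rho> = \<pi>" unfolding \<pi> by (rule image_cong[OF refl]) (rule h_image)
  have "f = restrict (\<lambda>T. h -` T) \<pi>"
  proof (rule extensionalityI[OF z(5)])
    fix T assume T: "T \<in> \<pi>"
    then have "f T \<in> \<rho>" using z(6) bij_betwE by blast
    then have "h ` f T = T" using h_image f'f[OF T] by simp
    then have "h -` T = f T" using inj_vimage_image_eq[OF permutes_inj[OF h], of "f T"] by simp
    then show "f T = restrict (\<lambda>T. h -` T) \<pi> T" using T by simp
  qed simp
  then have "z = two_part n h r" using z(1) r(2) img by (simp add: two_part_def)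
  with h r(1) show thesis by (rule that)
qed

lemma two_part_order_iff:
  assumes h: "h permutes {1..n}" and r: "r \<in> nc_maps n" and s: "s \<in> nc_maps n"
  shows "(two_part n h r, two_part n h s) \<in> nc2_order n \<longleftrightarrow> (\<forall>i\<in>{1..n}. r (s i) = r i)"
proof -
  have inj: "inj h" using h permutes_inj by blast
  have "refines {1..n} ((`) h ` blocks n s) ((`) h ` blocks n r)"
    if ref: "refines {1..n} (blocks n s) (blocks n r)"
    unfolding refines_def
  proof (intro conjI ballI)
    fix U assume "U \<in> (`) h ` blocks n s"
    then obtain S where "S \<in> blocks n s" "U = h ` S" by blast
    moreover from this obtain T where "T \<in> blocks n r" "S \<subseteq> T" using ref unfolding refines_def by blast
    ultimately show "\<exists>Y\<in>(`) h ` blocks n r. U \<subseteq> Y" by blast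
  qed (use ref partition_on_image_permutes[OF h] in \<open>auto simp: refines_def\<close>)
  moreover have "\<forall>T\<in>(`) h ` blocks n r. \<forall>T'\<in>(`) h ` blocks n s. T' \<subseteq> T \<longrightarrow>
      restrict (\<lambda>T. h -` T) ((`) h ` blocks n s) T' \<subseteq> restrict (\<lambda>T. h -` T) ((`) h ` blocks n r) T"
    by (simp add: vimage_mono del: ball_simps)
  ultimately have "(two_part n h r, two_part n h s) \<in> nc2_order n \<longleftrightarrow>
      refines {1..n} (blocks n s) (blocks n r)"
    using two_part_in[OF h r] two_part_in[OF h s] unfolding nc2_order_def two_part_def by blast
  then show ?thesis using refines_blocks_iff[OF r s] by simp
qed

text \<open>This reduces the order below a fixed element to minimum maps with one common
  \<open>h\<close>. The condition on the block bijections puts \<open>h i\<close> and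
  \<open>h' i\<close> into the same block for every \<open>i\<close>. Hence the image under
  \<open>h\<close> of each block of \<open>r\<close> is contained in its image under
  \<open>h'\<close>, and equal cardinality makes them agree.\<close>

lemma below_two_part:
  assumes h: "h permutes {1..n}" and s: "s \<in> nc_maps n" and le: "(y, two_part n h s) \<in> nc2_order n"
  obtains r where "r \<in> nc_maps n" "y = two_part n h r" "\<forall>i\<in>{1..n}. r (s i) = r i"
proof -
  have "y \<in> nc2_partitions n" using le by (auto simp: nc2_order_def)
  then obtain h' r where h': "h' permutes {1..n}" and r: "r \<in> nc_maps n" and y: "y = two_part n h' r"
    by (rule ex_two_part)
  have inj: "inj h" "inj h'" using h h' permutes_inj by blast+
  have ref: "refines {1..n} ((`) h ` blocks n s) ((`) h' ` blocks n r)"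
    and "\<forall>T\<in>(`) h' ` blocks n r. \<forall>T'\<in>(`) h ` blocks n s. T' \<subseteq> T \<longrightarrow>
      restrict (\<lambda>T. h -` T) ((`) h ` blocks n s) T' \<subseteq> restrict (\<lambda>T. h' -` T) ((`) h' ` blocks n r) T"
    using le unfolding nc2_order_def y two_part_def by blast+
  then have sub: "h -` T' \<subseteq> h' -` T"
    if "T \<in> (`) h' ` blocks n r" "T' \<in> (`) h ` blocks n s" "T' \<subseteq> T" for T T'
    using that by (simp del: ball_simps)
  have same: "\<exists>T\<in>(`) h' ` blocks n r. h i \<in> T \<and> h' i \<in> T" if i: "i \<in> {1..n}" for i
  proof -
    have S: "block n s (s i) \<in> blocks n s" "i \<in> block n s (s i)" using i by (auto simp: blocks_def block_def)
    then obtain T where T: "T \<in> (`) h' ` blocks n r" "h ` block n s (s i) \<subseteq> T"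
      using ref unfolding refines_def by blast
    have "h -` h ` block n s (s i) \<subseteq> h' -` T" using sub T S(1) by blast
    then show ?thesis using T S(2) by blast
  qed
  have "h' ` S = h ` S" if S: "S \<in> blocks n r" for S
  proof -
    have fin: "finite S" "S \<subseteq> {1..n}" using S by (auto simp: blocks_def block_def)
    have "h ` S \<subseteq> h' ` S"
    proof
      fix x assume "x \<in> h ` S"
      then obtain i where i: "i \<in> S" "x = h i" by blast
      then obtain S' where S': "S' \<in> blocks n r" "h i \<in> h' ` S'" "h' i \<in> h' ` S'"
        using same[of i] fin(2) by blast
      then have "i \<in> S'" using inj(2) by (simp add: inj_image_mem_iff)
      then have "S' = S" using S S'(1) i(1) by (auto simp: blocks_def block_def)
      then show "x \<in> h' ` S" using S' i by simp
    qed
    moreover have "card (h ` S) = card (h' ` S)" using inj by (simp add: card_image inj_on_subset)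
    ultimately show ?thesis using card_subset_eq[of "h' ` S" "h ` S"] fin(1) by simp
  qed
  then have "y = two_part n h r" unfolding y by (intro two_part_cong[OF h' h])
  moreover from this have "\<forall>i\<in>{1..n}. r (s i) = r i" using two_part_order_iff[OF h r s] le by simp
  ultimately show thesis using that r by blast
qed

lemma two_part_eq_iff:
  assumes "r \<in> nc_maps n" "s \<in> nc_maps n"
  shows "two_part n h r = two_part n h s \<longleftrightarrow> (\<forall>i\<in>{1..n}. r i = s i)"
  using blocks_eq_iff[OF assms] by (auto simp: two_part_def)

text \<open>With singleton blocks the block bijection is a bijection of points. So the top of a
  chain determines its permutation.\<close>

lemma two_part_perm_eq:
  assumes h: "h permutes {1..n}" and h': "h' permutes {1..n}"
    and eq: "two_part n h r = two_part n h' s" and r: "r \<in> nc_maps n" "\<forall>i\<in>{1..n}. r i = i"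
  shows "h = h'"
proof
  fix i
  show "h i = h' i"
  proof (cases "i \<in> {1..n}")
    case True
    then have "block n r i = {i}" using r(2) by (auto simp: block_def)
    then have "{i} \<in> blocks n r" using r(2) True by (force simp: blocks_def)
    then have T: "{h i} \<in> (`) h ` blocks n r" by (metis image_empty image_insert imageI)
    have eqs: "(`) h ` blocks n r = (`) h' ` blocks n s"
        "restrict (\<lambda>T. h -` T) ((`) h ` blocks n r) = restrict (\<lambda>T. h' -` T) ((`) h' ` blocks n s)"
      using eq unfolding two_part_def by blast+
    have "h -` {h i} = h' -` {h i}"
      using fun_cong[OF eqs(2), of "{h i}"] T T[unfolded eqs(1)] by (simp only: restrict_apply if_True)
    moreover have "i \<in> h -` {h i}" by simp
    ultimately have "i \<in> h' -` {h i}" by (simp only:)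
    then show ?thesis by simp
  qed (use h h' in \<open>auto simp: permutes_def\<close>)
qed

lemma nc2_action_two_part:
  assumes \<tau>: "\<tau> permutes {1..n}" and h: "h permutes {1..n}"
  shows "nc2_action \<tau> (two_part n h r) = two_part n (\<tau> \<circ> h) r"
proof -
  have inj: "inj \<tau>" using \<tau> permutes_inj by blast
  have img: "(`) \<tau> ` (`) h ` blocks n r = (`) (\<tau> \<circ> h) ` blocks n r"
    by (simp add: image_image image_comp)
  have "restrict (\<lambda>S. restrict (\<lambda>T. h -` T) ((`) h ` blocks n r) (\<tau> -` S)) ((`) \<tau> ` (`) h ` blocks n r) =
      restrict (\<lambda>T. (\<tau> \<circ> h) -` T) ((`) \<tau> ` (`) h ` blocks n r)"
    by (rule restrict_ext) (auto simp: inj_vimage_image_eq[OF inj] vimage_comp[symmetric])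
  then show ?thesis unfolding nc2_action_def two_part_def by (simp add: img)
qed

lemma finite_nc2_partitions: "finite (nc2_partitions n)"
proof (rule finite_subset)
  show "nc2_partitions n \<subseteq> (\<lambda>(h, \<rho>). ((`) h ` \<rho>, \<rho>, restrict (\<lambda>T. h -` T) ((`) h ` \<rho>))) `
      ({h. h permutes {1..n}} \<times> Pow (Pow {1..n}))"
  proof
    fix z assume "z \<in> nc2_partitions n"
    then obtain h r where "h permutes {1..n}" "z = two_part n h r" by (rule ex_two_part)
    moreover have "blocks n r \<in> Pow (Pow {1..n})" by (auto simp: blocks_def block_def)
    ultimately show "z \<in> (\<lambda>(h, \<rho>). ((`) h ` \<rho>, \<rho>, restrict (\<lambda>T. h -` T) ((`) h ` \<rho>))) `
        ({h. h permutes {1..n}} \<times> Pow (Pow {1..n}))"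
      unfolding two_part_def by (intro image_eqI[of _ _ "(h, blocks n r)"]) auto
  qed
qed (simp add: finite_permutations)

text \<open>The labels are the fixed points of the minimum map. If \<open>r\<close> fixes
  \<open>m\<close>, then \<open>m = r (s m) \<le> s m \<le> m\<close>. If the labels agree,
  \<open>r\<close> fixes every value of \<open>s\<close>, whence
  \<open>r i = r (s i) = s i\<close>.\<close>

lemma labels_mono:
  assumes le: "(x, y) \<in> nc2_order n"
  shows "labels x \<subseteq> labels y" "labels x = labels y \<Longrightarrow> x = y"
proof -
  have "y \<in> nc2_partitions n" using le by (auto simp: nc2_order_def)
  then obtain h s where h: "h permutes {1..n}" and s: "s \<in> nc_maps n" and y: "y = two_part n h s"
    by (rule ex_two_part)
  obtain r where r: "r \<in> nc_maps n" "x = two_part n h r" "\<forall>i\<in>{1..n}. r (s i) = r i"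
    using below_two_part[OF h s] le y by metis
  show sub: "labels x \<subseteq> labels y"
  proof
    fix m assume "m \<in> labels x"
    then have m: "m \<in> {1..n}" "r m = m"
      using r nc_mapsD(3,4)[OF r(1)] by (auto simp: labels_two_part)
    have "r (s m) = m" using r(3) m by simp
    moreover have "r (s m) \<le> s m" "s m \<le> m"
      using nc_mapsD(2)[OF r(1) nc_mapsD(4)[OF s m(1)]] nc_mapsD(2)[OF s m(1)] by auto
    ultimately have "s m = m" by simp
    then show "m \<in> labels y" using m(1) s y fixed_iff by (simp add: labels_two_part)
  qed
  assume eq: "labels x = labels y"
  have "r i = s i" if i: "i \<in> {1..n}" for i
  proof -
    have "s i \<in> r ` {1..n}" using eq i r(1,2) s y by (simp add: labels_two_part)
    then have "r (s i) = s i" using fixed_iff[OF r(1) nc_mapsD(4)[OF s i]] by simp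
    then show ?thesis using r(3) i by simp
  qed
  then show "x = y" unfolding y r(2) using two_part_eq_iff[OF r(1) s] by blast
qed

lemma minimal_labels:
  assumes n: "n \<ge> 1"
  shows "minimal_in (nc2_partitions n) (nc2_order n) x \<longleftrightarrow> x \<in> nc2_partitions n \<and> labels x = {1}"
proof
  assume x: "minimal_in (nc2_partitions n) (nc2_order n) x"
  then have xP: "x \<in> nc2_partitions n" by (simp add: minimal_in_def)
  then obtain h r where h: "h permutes {1..n}" and r: "r \<in> nc_maps n" and x': "x = two_part n h r"
    by (rule ex_two_part)
  have one: "(\<lambda>_. 1) \<in> nc_maps n" by (auto simp: nc_maps_def)
  have "(two_part n h (\<lambda>_. 1), x) \<in> nc2_order n" unfolding x' two_part_order_iff[OF h one r] by simp
  then have "x = two_part n h (\<lambda>_. 1)"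
    using x two_part_in[OF h one] unfolding minimal_in_def strictly_below_def by metis
  then have "labels x = (\<lambda>_. 1) ` {1..n}" by (simp only: labels_two_part[OF one])
  also have "\<dots> = {1}" using n by auto
  finally show "x \<in> nc2_partitions n \<and> labels x = {1}" using xP by blast
next
  assume x: "x \<in> nc2_partitions n \<and> labels x = {1}"
  have "\<not> strictly_below (nc2_order n) y x" for y
  proof
    assume y: "strictly_below (nc2_order n) y x"
    then have "y \<in> nc2_partitions n" by (auto simp: strictly_below_def nc2_order_def)
    then obtain h r where h: "h permutes {1..n}" and r: "r \<in> nc_maps n" and y': "y = two_part n h r"
      by (rule ex_two_part)
    have yx: "(y, x) \<in> nc2_order n" "y \<noteq> x" using y by (auto simp: strictly_below_def)
    have "labels y \<noteq> {}" using r n by (simp add: labels_two_part y')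
    moreover have "labels y \<subseteq> {1}" using labels_mono(1)[OF yx(1)] x by simp
    ultimately have "labels y = labels x" using x by (metis subset_singletonD)
    then show False using labels_mono(2)[OF yx(1)] yx(2) by simp
  qed
  then show "minimal_in (nc2_partitions n) (nc2_order n) x" using x by (auto simp: minimal_in_def)
qed

lemma maximal_labels:
  "maximal_in (nc2_partitions n) (nc2_order n) x \<longleftrightarrow> x \<in> nc2_partitions n \<and> labels x = {1..n}"
proof
  assume x: "maximal_in (nc2_partitions n) (nc2_order n) x"
  then have xP: "x \<in> nc2_partitions n" by (simp add: maximal_in_def)
  then obtain h r where h: "h permutes {1..n}" and r: "r \<in> nc_maps n" and x': "x = two_part n h r"
    by (rule ex_two_part)
  have one: "(\<lambda>i. i) \<in> nc_maps n" by (auto simp: nc_maps_def)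
  have "(x, two_part n h (\<lambda>i. i)) \<in> nc2_order n" unfolding x' two_part_order_iff[OF h r one] by simp
  then have "x = two_part n h (\<lambda>i. i)"
    using x two_part_in[OF h one] unfolding maximal_in_def strictly_below_def by metis
  then show "x \<in> nc2_partitions n \<and> labels x = {1..n}"
    using xP by (auto simp: labels_two_part[OF one])
next
  assume x: "x \<in> nc2_partitions n \<and> labels x = {1..n}"
  have "\<not> strictly_below (nc2_order n) x y" for y
  proof
    assume y: "strictly_below (nc2_order n) x y"
    then have "y \<in> nc2_partitions n" by (auto simp: strictly_below_def nc2_order_def)
    then obtain h r where h: "h permutes {1..n}" and r: "r \<in> nc_maps n" and y': "y = two_part n h r"
      by (rule ex_two_part)
    have "labels y \<subseteq> {1..n}" using nc_mapsD(4)[OF r] by (auto simp: labels_two_part[OF r] y')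
    moreover have xy: "(x, y) \<in> nc2_order n" "x \<noteq> y" using y by (auto simp: strictly_below_def)
    ultimately have "labels x = labels y" using labels_mono(1)[OF xy(1)] x by simp
    then show False using labels_mono(2)[OF xy(1)] xy(2) by simp
  qed
  then show "maximal_in (nc2_partitions n) (nc2_order n) x" using x by (auto simp: maximal_in_def)
qed

lemma nc2_order_trans: "\<lbrakk>(x, y) \<in> nc2_order n; (y, z) \<in> nc2_order n\<rbrakk> \<Longrightarrow> (x, z) \<in> nc2_order n"
proof -
  assume xy: "(x, y) \<in> nc2_order n" and yz: "(y, z) \<in> nc2_order n"
  have "z \<in> nc2_partitions n" using yz by (auto simp: nc2_order_def)
  then obtain h t where h: "h permutes {1..n}" and t: "t \<in> nc_maps n" and z: "z = two_part n h t"
    by (rule ex_two_part)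
  obtain s where s: "s \<in> nc_maps n" "y = two_part n h s" "\<forall>i\<in>{1..n}. s (t i) = s i"
    using below_two_part[OF h t] yz z by metis
  obtain r where r: "r \<in> nc_maps n" "x = two_part n h r" "\<forall>i\<in>{1..n}. r (s i) = r i"
    using below_two_part[OF h s(1)] xy s(2) by metis
  have "r (t i) = r i" if "i \<in> {1..n}" for i
    using r(3) s(3) that nc_mapsD(4)[OF t that] by metis
  then show "(x, z) \<in> nc2_order n" unfolding r(2) z two_part_order_iff[OF h r(1) t] by blast
qed

text \<open>To remove the label \<open>m\<close> from \<open>s\<close> while staying above \<open>r\<close>, the block with minimum \<open>m\<close> has to be
  merged into the block of \<open>r m\<close>.\<close>

lemma merge_nc_map:
  assumes r: "r \<in> nc_maps n" and s: "s \<in> nc_maps n" and rs: "\<forall>i\<in>{1..n}. r (s i) = r i"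
    and m: "m \<in> {1..n}" "s m = m" "r m \<noteq> m"
    and small: "\<forall>k\<in>{1..n}. s k = k \<and> k < m \<longrightarrow> r k = k"
    and t_def: "t = (\<lambda>i. if s i = m then r m else s i)"
  shows "t \<in> nc_maps n" "\<forall>i\<in>{1..n}. r (t i) = r i" "\<forall>i\<in>{1..n}. t (s i) = t i"
    "t ` {1..n} = s ` {1..n} - {m}"
proof -
  have rm: "r m < m" "r m \<in> {1..n}" "r (r m) = r m"
    using nc_mapsD(2,3,4)[OF r m(1)] m(3) by auto
  have srm: "s (r m) = r m"
  proof -
    have "r (s (r m)) = r m" using rs rm by simp
    moreover have "r (s (r m)) \<le> s (r m)" "s (r m) \<le> r m"
      using nc_mapsD(2)[OF r nc_mapsD(4)[OF s rm(2)]] nc_mapsD(2)[OF s rm(2)] by auto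
    ultimately show ?thesis by simp
  qed
  have ss: "s (s i) = s i" "s i \<in> {1..n}" "s i \<le> i" if "i \<in> {1..n}" for i
    using nc_mapsD[OF s that] by auto
  have t_in: "t i \<in> {1..n}" "t i \<le> i" "t (t i) = t i" if "i \<in> {1..n}" for i
    using ss[OF that] rm srm by (auto simp: t_def)
  have cross: "j \<le> t i \<or> t i \<le> t j" if ij: "i \<in> {1..n}" "1 \<le> j" "j < i" for i j
  proof -
    have j: "j \<in> {1..n}" using ij by auto
    note si = nc_mapsD(5)[OF s ij]
    have rj: "r j \<le> s j" using rs j nc_mapsD(2)[OF r ss(2)[OF j]] by simp
    show ?thesis
    proof (cases "s i = m")
      case True
      consider "m < s j" | "s j = m" | "s j < m" "j = m" | "j < m" | "s j < m" "m < j" by linarith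
      then show ?thesis
      proof cases
        case 4
        then have "s j \<noteq> m" using ss(3)[OF j] by simp
        moreover have "j \<le> r m \<or> r m \<le> r j" using nc_mapsD(5)[OF r m(1) ij(2) 4] .
        ultimately show ?thesis using True rj by (auto simp: t_def)
      qed (use True si rm m in \<open>auto simp: t_def\<close>)
    next
      case False
      show ?thesis
      proof (cases "s j = m \<and> s i < j")
        \<comment> \<open>Here \<open>j\<close> moves into the block of \<open>r m\<close> while
          \<open>i\<close> stays, with \<open>s i < m\<close>. By \<open>small\<close> the value
          \<open>s i\<close> is fixed by \<open>r\<close>, so \<open>r i = s i\<close>, and the
          condition for \<open>r\<close> at \<open>i\<close> and \<open>m\<close> yields
          \<open>r i \<le> r m\<close>.\<close>
        case True
        then have "s i \<le> m" using si by auto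
        then have lt: "s i < m" using False by simp
        have "r i = r (s i)" using rs ij(1) by simp
        also have "\<dots> = s i" using small ss(1,2)[OF ij(1)] lt by blast
        finally have ri: "r i = s i" .
        have "m \<le> j" using True ss(3)[OF j] by simp
        then have "m \<le> r i \<or> r i \<le> r m" using nc_mapsD(5)[OF r ij(1), of m] ij m by simp
        then show ?thesis using ri lt True False by (simp add: t_def)
      qed (use False si in \<open>auto simp: t_def\<close>)
    qed
  qed
  show "t \<in> nc_maps n" using t_in cross by (auto simp: nc_maps_def)
  show "\<forall>i\<in>{1..n}. r (t i) = r i"
  proof
    fix i assume i: "i \<in> {1..n}"
    then have "r (s i) = r i" using rs by blast
    then show "r (t i) = r i" using rm by (auto simp: t_def)
  qed
  show "\<forall>i\<in>{1..n}. t (s i) = t i" using ss by (simp add: t_def)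
  show "t ` {1..n} = s ` {1..n} - {m}"
  proof
    show "t ` {1..n} \<subseteq> s ` {1..n} - {m}"
      using rm srm by (auto simp: t_def) (metis atLeastAtMost_iff image_iff)
    show "s ` {1..n} - {m} \<subseteq> t ` {1..n}" by (auto simp: t_def)
  qed
qed

lemma rising_poset_nc2:
  assumes n: "n \<ge> 1"
  shows "rising_poset (nc2_partitions n) (nc2_order n) labels {1..n} (n - 1)"
proof
  show "finite (nc2_partitions n)" by (rule finite_nc2_partitions)
  show "(x, z) \<in> nc2_order n" if "(x, y) \<in> nc2_order n" "(y, z) \<in> nc2_order n" for x y z
    using that by (rule nc2_order_trans)
  show "x = y" if "(x, y) \<in> nc2_order n" "(y, x) \<in> nc2_order n" for x y
    using labels_mono[OF that(1)] labels_mono(1)[OF that(2)] by blast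
  show "labels x \<subseteq> {1..n}" if "x \<in> nc2_partitions n" for x
  proof -
    from that obtain h r where "r \<in> nc_maps n" "x = two_part n h r" by (rule ex_two_part)
    then show ?thesis using nc_mapsD(4)[of r n] by (auto simp: labels_two_part)
  qed
  show "labels x \<subset> labels y" if "strictly_below (nc2_order n) x y" for x y
    using that labels_mono[of x y n] by (auto simp: strictly_below_def)
  show "labels x = {1..n}" if "maximal_in (nc2_partitions n) (nc2_order n) x" for x
    using that maximal_labels by blast
  show "card ({1..n} - labels x) = n - 1" if "minimal_in (nc2_partitions n) (nc2_order n) x" for x
    using that minimal_labels[OF n] n by (simp add: card_Diff_singleton)
  fix x z m
  assume xz: "strictly_below (nc2_order n) x z" and zP: "z \<in> nc2_partitions n"
    and m: "m \<in> labels z - labels x" and small: "\<And>k. k \<in> labels z \<Longrightarrow> k < m \<Longrightarrow> k \<in> labels x"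
  from zP obtain h s where h: "h permutes {1..n}" and s: "s \<in> nc_maps n" and z: "z = two_part n h s"
    by (rule ex_two_part)
  obtain r where r: "r \<in> nc_maps n" "x = two_part n h r" "\<forall>i\<in>{1..n}. r (s i) = r i"
    using below_two_part[OF h s] xz z unfolding strictly_below_def by metis
  have lz: "labels z = s ` {1..n}" and lx: "labels x = r ` {1..n}"
    using labels_two_part r s z by blast+
  have m': "m \<in> {1..n}" using m nc_mapsD(4)[OF s] unfolding lz by blast
  have sm: "s m = m" "r m \<noteq> m" using m fixed_iff[OF s m'] fixed_iff[OF r(1) m'] by (auto simp: lz lx)
  have small': "\<forall>k\<in>{1..n}. s k = k \<and> k < m \<longrightarrow> r k = k"
  proof (intro ballI impI)
    fix k assume k: "k \<in> {1..n}" "s k = k \<and> k < m"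
    then have "k \<in> labels x" using small[of k] fixed_iff[OF s k(1)] by (simp add: lz)
    then show "r k = k" using fixed_iff[OF r(1) k(1)] by (simp add: lx)
  qed
  define t where "t = (\<lambda>i. if s i = m then r m else s i)"
  note t = merge_nc_map[OF r(1) s r(3) m' sm small' t_def]
  show "\<exists>!y. y \<in> nc2_partitions n \<and> (x, y) \<in> nc2_order n \<and> (y, z) \<in> nc2_order n \<and> labels y = labels z - {m}"
  proof (rule ex1I)
    show "two_part n h t \<in> nc2_partitions n \<and> (x, two_part n h t) \<in> nc2_order n \<and>
        (two_part n h t, z) \<in> nc2_order n \<and> labels (two_part n h t) = labels z - {m}"
    proof (intro conjI)
      show "two_part n h t \<in> nc2_partitions n" by (rule two_part_in[OF h t(1)])
      show "(x, two_part n h t) \<in> nc2_order n"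
        unfolding r(2) by (rule iffD2[OF two_part_order_iff[OF h r(1) t(1)] t(2)])
      show "(two_part n h t, z) \<in> nc2_order n"
        unfolding z by (rule iffD2[OF two_part_order_iff[OF h t(1) s] t(3)])
      show "labels (two_part n h t) = labels z - {m}"
        unfolding lz labels_two_part[OF t(1)] by (rule t(4))
    qed
    fix y assume y: "y \<in> nc2_partitions n \<and> (x, y) \<in> nc2_order n \<and> (y, z) \<in> nc2_order n \<and> labels y = labels z - {m}"
    then have "(y, two_part n h s) \<in> nc2_order n" using z by simp
    then obtain u where u: "u \<in> nc_maps n" "y = two_part n h u" "\<forall>i\<in>{1..n}. u (s i) = u i"
      by (rule below_two_part[OF h s])
    have ru: "\<forall>i\<in>{1..n}. r (u i) = r i" using y two_part_order_iff[OF h r(1) u(1)] r(2) u(2) by simp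
    have lu: "u ` {1..n} = s ` {1..n} - {m}" using y lz labels_two_part[OF u(1)] u(2) by simp
    \<comment> \<open>The value \<open>u m\<close> is a label of \<open>z\<close> below
      \<open>m\<close>, hence fixed by \<open>r\<close> because \<open>m\<close> is the smallest
      label that \<open>x\<close> lacks. So \<open>u m = r (u m) = r m\<close>, which leaves no
      choice.\<close>
    have "u i = t i" if i: "i \<in> {1..n}" for i
    proof (cases "s i = m")
      case True
      have um: "u m \<in> s ` {1..n} - {m}" using lu m' by blast
      have um': "u m \<in> {1..n}" "u m \<le> m" using nc_mapsD[OF u(1) m'] by auto
      have "r (u m) = u m"
        using small' um um' fixed_iff[OF s um'(1)] by auto
      then have "u m = r m" using ru m' by simp
      then show ?thesis using True u(3) i by (auto simp: t_def)
    next
      case False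
      then have "s i \<in> u ` {1..n}" using lu i by blast
      then have "u (s i) = s i" using fixed_iff[OF u(1) nc_mapsD(4)[OF s i]] by simp
      then show ?thesis using False u(3) i by (simp add: t_def)
    qed
    then show "y = two_part n h t" unfolding u(2) using two_part_eq_iff[OF u(1) t(1)] by blast
  qed
qed simp_all

section \<open>Rising chains and non-crossing trees\<close>

text \<open>A rising chain adds the labels in the order \<open>2, \<dots>, n\<close>. It is determined by the minimum \<open>p m\<close>
  of the block from which the block with minimum \<open>m\<close> is split off.\<close>

definition parent_maps :: "nat \<Rightarrow> (nat \<Rightarrow> nat) set" where
  "parent_maps n = {p \<in> extensional {2..n}. (\<forall>m\<in>{2..n}. 1 \<le> p m \<and> p m < m) \<and>
     (\<forall>l\<in>{2..n}. \<forall>m\<in>{2..<l}. m \<le> p l \<or> p l \<le> p m)}"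

text \<open>Climbs from \<open>i\<close> along parents to the first node at most
  \<open>Suc t\<close>. Counting positions from 0, the element of a rising chain at position
  \<open>t\<close> has labels \<open>{1..Suc t}\<close>, and this is its minimum map. The guard
  \<open>i \<le> p i\<close> makes the recursion terminate for every function
  \<open>p\<close>.\<close>

function ancestor :: "(nat \<Rightarrow> nat) \<Rightarrow> nat \<Rightarrow> nat \<Rightarrow> nat" where
  "ancestor p t i = (if i \<le> Suc t \<or> i \<le> p i then i else ancestor p t (p i))"
  by pat_completeness auto
termination by (relation "measure (\<lambda>(p, t, i). i)") auto

declare ancestor.simps [simp del]

context
  fixes n p
  assumes p: "p \<in> parent_maps n"
begin

lemma parent: "\<lbrakk>2 \<le> m; m \<le> n\<rbrakk> \<Longrightarrow> 1 \<le> p m \<and> p m < m"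
  using p by (auto simp: parent_maps_def)

lemma parent_cross: "\<lbrakk>l \<le> n; 2 \<le> m; m < l\<rbrakk> \<Longrightarrow> m \<le> p l \<or> p l \<le> p m"
  using p by (auto simp: parent_maps_def)

lemma ancestor_small: "i \<le> Suc t \<Longrightarrow> ancestor p t i = i"
  by (simp add: ancestor.simps)

lemma ancestor_large: "\<lbrakk>Suc t < i; i \<le> n\<rbrakk> \<Longrightarrow> ancestor p t i = ancestor p t (p i)"
  using parent[of i] by (subst ancestor.simps) simp

lemma ancestor_bounds: "\<lbrakk>1 \<le> i; i \<le> n\<rbrakk> \<Longrightarrow> 1 \<le> ancestor p t i \<and> ancestor p t i \<le> i \<and> ancestor p t i \<le> Suc t"
proof (induction i rule: less_induct)
  case (less i)
  show ?case
  proof (cases "i \<le> Suc t")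
    case False
    then have "1 \<le> p i" "p i < i" using parent[of i] less.prems by auto
    then show ?thesis using less.IH[of "p i"] less.prems False by (simp add: ancestor_large)
  qed (use less.prems in \<open>simp add: ancestor_small\<close>)
qed

text \<open>By the crossing condition, climbing from a node between \<open>p i\<close> and
  \<open>i\<close> never jumps below \<open>p i\<close>: it stops before or passes through
  \<open>p i\<close>.\<close>

lemma ancestor_le_ancestor:
  assumes i: "Suc t < i" "i \<le> n"
  shows "\<lbrakk>p i \<le> b; b < i\<rbrakk> \<Longrightarrow> ancestor p t (p i) \<le> ancestor p t b"
proof (induction b rule: less_induct)
  case (less b)
  have pi: "1 \<le> p i" "p i < i" using parent[of i] i by auto
  show ?case
  proof (cases "b \<le> Suc t")
    case True
    then show ?thesis using less.prems ancestor_bounds[of "p i" t] pi i by (simp add: ancestor_small)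
  next
    case False
    then have b: "2 \<le> b" "b \<le> n" "p b < b" using less.prems i parent[of b] by auto
    show ?thesis
    proof (cases "b = p i")
      case False
      then have "p i \<le> p b" using parent_cross[of i b] less.prems i b by auto
      then have "ancestor p t (p i) \<le> ancestor p t (p b)"
        using less.IH[of "p b"] less.prems b by simp
      then show ?thesis using ancestor_large[of t b] b \<open>\<not> b \<le> Suc t\<close> by simp
    qed simp
  qed
qed

text \<open>If \<open>j < p i\<close>, induction passes from \<open>i\<close> to \<open>p i\<close>;
  otherwise \<open>j\<close> lies between \<open>p i\<close> and \<open>i\<close>, and
  \<open>ancestor_le_ancestor\<close> applies.\<close>

lemma ancestor_cross:
  "\<lbrakk>i \<le> n; 1 \<le> j; j < i\<rbrakk> \<Longrightarrow> j \<le> ancestor p t i \<or> ancestor p t i \<le> ancestor p t j"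
proof (induction i rule: less_induct)
  case (less i)
  show ?case
  proof (cases "i \<le> Suc t")
    case True
    then show ?thesis using less.prems by (simp add: ancestor_small)
  next
    case False
    then have pi: "1 \<le> p i" "p i < i" and a: "ancestor p t i = ancestor p t (p i)"
      using parent[of i] less.prems by (auto simp: ancestor_large)
    show ?thesis
    proof (cases "j < p i")
      case True
      then show ?thesis using less.IH[of "p i"] less.prems pi a by simp
    next
      case False
      then show ?thesis
        using ancestor_le_ancestor[of t i j] less.prems \<open>\<not> i \<le> Suc t\<close> a by simp
    qed
  qed
qed

lemma ancestor_nc_map: "ancestor p t \<in> nc_maps n"
  using ancestor_bounds[of _ t] ancestor_cross by (auto simp: nc_maps_def ancestor_small)

lemma ancestor_labels:
  assumes "t < n"
  shows "ancestor p t ` {1..n} = {1..Suc t}"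
proof
  show "ancestor p t ` {1..n} \<subseteq> {1..Suc t}" using ancestor_bounds[of _ t] by auto
  show "{1..Suc t} \<subseteq> ancestor p t ` {1..n}"
  proof
    fix i assume "i \<in> {1..Suc t}"
    then show "i \<in> ancestor p t ` {1..n}"
      using assms by (intro image_eqI[of _ _ i]) (auto simp: ancestor_small)
  qed
qed

lemma ancestor_ancestor: "\<lbrakk>t \<le> t'; 1 \<le> i; i \<le> n\<rbrakk> \<Longrightarrow> ancestor p t (ancestor p t' i) = ancestor p t i"
proof (induction i rule: less_induct)
  case (less i)
  show ?case
  proof (cases "i \<le> Suc t'")
    case False
    then have "1 \<le> p i" "p i < i" using parent[of i] less.prems by auto
    then show ?thesis using less.IH[of "p i"] less.prems False ancestor_large[of t i] ancestor_large[of t' i]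
      by simp
  qed (simp add: ancestor_small)
qed

text \<open>At position \<open>m - 2\<close> the labels are \<open>{1..m - 1}\<close>, so
  \<open>m\<close> climbs exactly one step. This recovers \<open>p\<close> from the chain.\<close>

lemma ancestor_parent:
  assumes "2 \<le> m" "m \<le> n"
  shows "ancestor p (m - 2) m = p m"
proof -
  have "Suc (m - 2) < m" "p m \<le> Suc (m - 2)" using assms parent[OF assms] by linarith+
  then show ?thesis using ancestor_large[of "m - 2" m] ancestor_small[of "p m" "m - 2"] assms by simp
qed

end

definition tree_chain :: "nat \<Rightarrow> (nat \<Rightarrow> nat) \<times> (nat \<Rightarrow> nat) \<Rightarrow> two_partition list" where
  "tree_chain n = (\<lambda>(h, p). map (\<lambda>t. two_part n h (ancestor p t)) [0..<n])"

lemma Min_Diff_initial: "t < n \<Longrightarrow> Suc t < n \<Longrightarrow> Min ({1..n} - {1..Suc t}) = Suc (Suc t)"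
  by (rule Min_eqI) auto

lemma (in rising_poset) rising_iff_nth:
  "rising xs \<longleftrightarrow> (\<forall>t. Suc t < length xs \<longrightarrow> rising_step (xs ! t) (xs ! Suc t))"
proof (induction xs rule: rising.induct)
  case (1 x y zs)
  show ?case
  proof
    assume r: "rising (x # y # zs)"
    show "\<forall>t. Suc t < length (x # y # zs) \<longrightarrow> rising_step ((x # y # zs) ! t) ((x # y # zs) ! Suc t)"
    proof (intro allI impI)
      fix t assume "Suc t < length (x # y # zs)"
      then show "rising_step ((x # y # zs) ! t) ((x # y # zs) ! Suc t)"
        using r 1 by (cases t) auto
    qed
  next
    assume *: "\<forall>t. Suc t < length (x # y # zs) \<longrightarrow> rising_step ((x # y # zs) ! t) ((x # y # zs) ! Suc t)"
    have "rising_step ((y # zs) ! t) ((y # zs) ! Suc t)" if "Suc t < length (y # zs)" for t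
      using *[rule_format, of "Suc t"] that by simp
    moreover have "rising_step x y" using *[rule_format, of 0] by simp
    ultimately show "rising (x # y # zs)" using 1 by simp
  qed
qed auto

context
  fixes n :: nat
  assumes n: "n \<ge> 1"
begin

interpretation nc2: rising_poset "nc2_partitions n" "nc2_order n" labels "{1..n}" "n - 1"
  by (rule rising_poset_nc2[OF n])

lemma tree_chain_rising:
  assumes h: "h permutes {1..n}" and p: "p \<in> parent_maps n"
  shows "tree_chain n (h, p) \<in> nc2.rising_chains"
proof -
  note a = ancestor_nc_map[OF p]
  define xs where "xs = tree_chain n (h, p)"
  have len: "length xs = n" and nth: "\<And>t. t < n \<Longrightarrow> xs ! t = two_part n h (ancestor p t)"
    by (auto simp: xs_def tree_chain_def)
  have lab: "labels (xs ! t) = {1..Suc t}" if "t < n" for t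
    using that labels_two_part[OF a] ancestor_labels[OF p that] by (simp add: nth)
  have P: "set xs \<subseteq> nc2_partitions n" using two_part_in[OF h a] by (auto simp: xs_def tree_chain_def)
  have "strictly_below (nc2_order n) (xs ! t) (xs ! t')" if "t < t'" "t' < n" for t t'
  proof -
    have "(xs ! t, xs ! t') \<in> nc2_order n"
      using that ancestor_ancestor[OF p, of t t'] by (simp add: nth two_part_order_iff[OF h a a])
    moreover have "labels (xs ! t) \<noteq> labels (xs ! t')" using that by (simp add: lab)
    ultimately show ?thesis unfolding strictly_below_def by metis
  qed
  then have "sorted_wrt (strictly_below (nc2_order n)) xs" by (simp add: sorted_wrt_iff_nth_less len)
  moreover have ne: "xs \<noteq> []" using len n by auto
  then have "hd xs = xs ! 0" "last xs = xs ! (n - 1)" "hd xs \<in> set xs" "last xs \<in> set xs"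
    using len by (auto simp: hd_conv_nth last_conv_nth)
  then have "minimal_in (nc2_partitions n) (nc2_order n) (hd xs)"
      "maximal_in (nc2_partitions n) (nc2_order n) (last xs)"
    using lab[of 0] lab[of "n - 1"] n P minimal_labels[OF n] maximal_labels by auto
  moreover have "nc2.rising xs"
    unfolding nc2.rising_iff_nth
  proof (intro allI impI)
    fix t assume "Suc t < length xs"
    then show "labels (xs ! Suc t) = insert (Min ({1..n} - labels (xs ! t))) (labels (xs ! t))"
      using Min_Diff_initial[of t n] by (auto simp: len lab)
  qed
  ultimately show ?thesis
    using len P n unfolding nc2.rising_chains_def full_chains_def xs_def by auto
qed

lemma inj_tree_chain: "inj_on (tree_chain n) ({h. h permutes {1..n}} \<times> parent_maps n)"
proof (rule inj_onI, clarify)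
  fix h p h' p'
  assume h: "h permutes {1..n}" and h': "h' permutes {1..n}"
    and p: "p \<in> parent_maps n" and p': "p' \<in> parent_maps n"
    and eq: "tree_chain n (h, p) = tree_chain n (h', p')"
  have nth: "two_part n h (ancestor p t) = two_part n h' (ancestor p' t)" if "t < n" for t
    using eq that by (simp add: tree_chain_def)
  \<comment> \<open>The top of the chain has singleton blocks, which is what
    \<open>two_part_perm_eq\<close> needs.\<close>
  have "\<forall>i\<in>{1..n}. ancestor p (n - 1) i = i" using ancestor_small[OF p] by simp
  then have hh: "h = h'"
    using two_part_perm_eq[OF h h' nth[of "n - 1"] ancestor_nc_map[OF p]] n by simp
  moreover have "p = p'"
  proof (rule extensionalityI[of _ "{2..n}"])
    fix m assume m: "m \<in> {2..n}"
    then have "ancestor p (m - 2) m = ancestor p' (m - 2) m"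
      using nth[of "m - 2"] two_part_eq_iff[OF ancestor_nc_map[OF p] ancestor_nc_map[OF p']]
      by (auto simp: hh)
    then show "p m = p' m" using ancestor_parent[OF p] ancestor_parent[OF p'] m by simp
  qed (use p p' in \<open>auto simp: parent_maps_def\<close>)
  ultimately show "h = h' \<and> p = p'" by blast
qed

lemma rising_imp_tree_chain:
  assumes xs: "xs \<in> nc2.rising_chains"
  shows "xs \<in> tree_chain n ` ({h. h permutes {1..n}} \<times> parent_maps n)"
proof -
  have len: "length xs = n" and P: "set xs \<subseteq> nc2_partitions n"
    and sorted: "sorted_wrt (strictly_below (nc2_order n)) xs"
    and min: "minimal_in (nc2_partitions n) (nc2_order n) (hd xs)"
    and rising: "nc2.rising xs"
    using xs n unfolding nc2.rising_chains_def full_chains_def by auto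
  have ne: "xs \<noteq> []" using len n by auto
  have lab: "t < n \<Longrightarrow> labels (xs ! t) = {1..Suc t}" for t
  proof (induction t)
    case 0
    then show ?case using min minimal_labels[OF n] ne by (simp add: hd_conv_nth)
  next
    case (Suc t)
    then have "labels (xs ! Suc t) = insert (Min ({1..n} - labels (xs ! t))) (labels (xs ! t))"
      using rising len unfolding nc2.rising_iff_nth by blast
    then show ?case using Suc Min_Diff_initial[of t n] by auto
  qed
  have "xs ! (n - 1) \<in> nc2_partitions n" using P len n by (auto intro: nth_mem)
  then obtain h s where h: "h permutes {1..n}" and s: "s \<in> nc_maps n" and last: "xs ! (n - 1) = two_part n h s"
    by (rule ex_two_part)
  have "\<exists>r\<in>nc_maps n. xs ! t = two_part n h r" if t: "t < n" for t
  proof (cases "t = n - 1")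
    case True
    then show ?thesis using s last by blast
  next
    case False
    then have "(xs ! t, xs ! (n - 1)) \<in> nc2_order n"
      using t sorted_wrt_nth_less[OF sorted, of t "n - 1"] len by (auto simp: strictly_below_def)
    then show ?thesis using below_two_part[OF h s] last by metis
  qed
  then obtain r where r: "\<And>t. t < n \<Longrightarrow> r t \<in> nc_maps n" "\<And>t. t < n \<Longrightarrow> xs ! t = two_part n h (r t)"
    by metis
  have rlab: "r t ` {1..n} = {1..Suc t}" if "t < n" for t
    using lab[OF that] r[OF that] by (simp add: labels_two_part)
  have r_fix: "r t i = i" if "t < n" "1 \<le> i" "i \<le> Suc t" for t i
    using fixed_iff[OF r(1), of t i] rlab[of t] that by auto
  have r_le: "r t i \<le> Suc t" if "t < n" "i \<in> {1..n}" for t i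
    using rlab[OF that(1)] that(2) by (metis atLeastAtMost_iff imageI)
  have rr: "r t (r t' i) = r t i" if "t \<le> t'" "t' < n" "i \<in> {1..n}" for t t' i
  proof (cases "t = t'")
    case True
    then show ?thesis using nc_mapsD(3)[OF r(1)] that by simp
  next
    case False
    then have "(xs ! t, xs ! t') \<in> nc2_order n"
      using that sorted_wrt_nth_less[OF sorted, of t t'] len by (auto simp: strictly_below_def)
    then show ?thesis using two_part_order_iff[OF h r(1) r(1), of t t'] r(2) that by simp
  qed
  \<comment> \<open>Position \<open>m - 2\<close> is the last one at which \<open>m\<close> is not
    yet a label; the value there is the minimum of the block from which \<open>m\<close> splits off
    in the next step.\<close>
  define p where "p = (\<lambda>m\<in>{2..n}. r (m - 2) m)"
  have p_eq: "p m = r (m - 2) m" if "2 \<le> m" "m \<le> n" for m using that by (simp add: p_def)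
  have p: "p \<in> parent_maps n"
  proof -
    have "1 \<le> p m \<and> p m < m" if "m \<in> {2..n}" for m
    proof -
      have "m - 2 < n" "Suc (m - 2) < m" "m \<in> {1..n}" using that by auto
      then show ?thesis
        using that nc_mapsD(1)[OF r(1), of "m - 2" m] r_le[of "m - 2" m] by (simp add: p_eq)
    qed
    moreover have "m \<le> p l \<or> p l \<le> p m" if lm: "l \<in> {2..n}" "m \<in> {2..<l}" for l m
    proof (rule disjCI)
      assume "\<not> p l \<le> p m"
      show "m \<le> p l"
      proof (rule ccontr)
        assume "\<not> m \<le> p l"
        then have lt: "p l < m" by simp
        have l1: "1 \<le> p l" using lm nc_mapsD(1)[OF r(1), of "l - 2" l] by (auto simp: p_eq)
        \<comment> \<open>Seen from position \<open>m - 2\<close>, where \<open>p l\<close> is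
          already a label, \<open>l\<close> has value \<open>p l\<close> and \<open>m\<close> has
          value \<open>p m\<close>. So the crossing condition of the single map
          \<open>r (m - 2)\<close> compares the two parents.\<close>
        have "r (m - 2) l = r (m - 2) (p l)" using rr[of "m - 2" "l - 2" l] lm by (auto simp: p_eq)
        also have "\<dots> = p l" using r_fix[of "m - 2" "p l"] lt l1 lm by auto
        finally have rl: "r (m - 2) l = p l" .
        have "m \<le> r (m - 2) l \<or> r (m - 2) l \<le> r (m - 2) m"
          using nc_mapsD(5)[OF r(1), of "m - 2" l m] lm by auto
        moreover have "p m = r (m - 2) m" using lm by (intro p_eq) auto
        ultimately show False using rl lt \<open>\<not> p l \<le> p m\<close> by simp
      qed
    qed
    ultimately show ?thesis by (auto simp: parent_maps_def p_def)
  qed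
  have anc: "\<lbrakk>t < n; 1 \<le> i; i \<le> n\<rbrakk> \<Longrightarrow> ancestor p t i = r t i" for t i
  proof (induction i rule: less_induct)
    case (less i)
    show ?case
    proof (cases "i \<le> Suc t")
      case False
      then have i: "2 \<le> i" "1 \<le> p i" "p i < i" using parent[OF p, of i] less.prems by auto
      have "r t i = r t (p i)" using rr[of t "i - 2" i] less.prems False i by (auto simp: p_eq)
      then show ?thesis using less.IH[of "p i"] less.prems False i ancestor_large[OF p, of t i] by simp
    qed (use less.prems r_fix in \<open>simp add: ancestor_small[OF p]\<close>)
  qed
  have "xs = tree_chain n (h, p)"
  proof (rule nth_equalityI)
    fix t assume "t < length xs"
    then have t: "t < n" using len by simp
    then show "xs ! t = tree_chain n (h, p) ! t"
      using r(2)[OF t] two_part_eq_iff[OF r(1)[OF t] ancestor_nc_map[OF p]] anc[OF t]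
      by (simp add: tree_chain_def)
  qed (simp add: len tree_chain_def)
  then show ?thesis using h p by blast
qed

lemma bij_tree_chain:
  "bij_betw (tree_chain n) ({h. h permutes {1..n}} \<times> parent_maps n) nc2.rising_chains"
  unfolding bij_betw_def using inj_tree_chain tree_chain_rising rising_imp_tree_chain by auto

end

section \<open>Counting non-crossing trees\<close>

text \<open>The parents that a new node \<open>Suc n\<close> may be given when \<open>p\<close> is
  extended by it.\<close>

definition allowed_parents :: "(nat \<Rightarrow> nat) \<Rightarrow> nat \<Rightarrow> nat set" where
  "allowed_parents p n = {q \<in> {1..n}. \<forall>m\<in>{2..n}. m \<le> q \<or> q \<le> p m}"

text \<open>Counts the extensions by \<open>k\<close> nodes of a tree with \<open>c\<close> allowed
  parents. Choosing the \<open>j\<close>-th smallest of them leaves the \<open>j\<close> smallest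
  and the new node, so \<open>Suc j\<close> for the next node: the succession rule of the Catalan
  generating tree.\<close>

fun ballot :: "nat \<Rightarrow> nat \<Rightarrow> nat" where
  "ballot c 0 = 1"
| "ballot c (Suc k) = (\<Sum>j=1..c. ballot (Suc j) k)"

lemma ballot_Suc: "ballot (Suc c) (Suc k) = ballot c (Suc k) + ballot (Suc (Suc c)) k"
  by simp

declare ballot.simps(2) [simp del]

text \<open>The reflection formula for ballot numbers, written as a sum to avoid subtraction of
  natural numbers. By \<open>ballot_Suc\<close> the induction step in \<open>c\<close> is Pascal's
  rule; for \<open>c = 0\<close> the two middle binomial coefficients agree.\<close>

lemma ballot_binomial:
  "ballot c (Suc k) + ((2 * k + c + 1) choose k) = (2 * k + c + 1) choose Suc k"
proof (induction k arbitrary: c)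
  case 0
  show ?case by (simp add: ballot.simps(2))
next
  case (Suc k)
  show ?case
  proof (induction c)
    case 0
    have "(2 * k + 3) choose Suc k = (2 * k + 3) choose Suc (Suc k)"
      by (subst binomial_symmetric) simp_all
    then show ?case by (simp add: ballot.simps(2) numeral_3_eq_3)
  next
    case (Suc c)
    let ?a = "2 * k + c + 3"
    have 1: "ballot c (Suc (Suc k)) + (?a choose Suc k) = ?a choose Suc (Suc k)"
      using Suc by (simp add: numeral_3_eq_3)
    have 2: "ballot (Suc (Suc c)) (Suc k) + (?a choose k) = ?a choose Suc k"
      using Suc.prems \<open>\<And>c. ballot c (Suc k) + ((2 * k + c + 1) choose k) = (2 * k + c + 1) choose Suc k\<close>[of "Suc (Suc c)"]
      by (simp add: numeral_3_eq_3)
    have "2 * Suc k + Suc c + 1 = Suc ?a" by simp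
    then show ?case using 1 2 by (simp only: ballot_Suc binomial_Suc_Suc)
  qed
qed

lemma ballot_eq_catalan:
  assumes "n \<ge> 1"
  shows "ballot 1 (n - 1) = catalan n"
proof (cases "n = 1")
  case False
  then obtain k where n: "n = Suc (Suc k)" using assms by (metis Suc_le_D One_nat_def nat.exhaust)
  let ?N = "2 * k + 2"
  have b: "ballot 1 (Suc k) + (?N choose k) = ?N choose Suc k"
    using ballot_binomial[of 1 k] by simp
  have "Suc k * (?N choose Suc k) = (?N - k) * (?N choose k)"
    using binomial_absorption[of k ?N] binomial_absorb_comp[of ?N k] by simp
  then have "Suc k * (?N choose Suc k) = (k + 2) * (?N choose k)" by simp
  then have "(k + 2) * (ballot 1 (Suc k) + (?N choose k)) = (k + 2) * (?N choose Suc k)"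
      "(k + 2) * (?N choose k) + (?N choose Suc k) = (k + 2) * (?N choose Suc k)"
    using b by simp_all
  then have "(k + 2) * ballot 1 (Suc k) = ?N choose Suc k" by (simp add: algebra_simps)
  then have "ballot 1 (Suc k) = (?N choose Suc k) div (k + 2)"
    by (metis nonzero_mult_div_cancel_left add_2_eq_Suc' nat.distinct(1))
  then show ?thesis by (simp add: catalan_def n)
qed (simp add: catalan_def)

text \<open>Replaces the choice of a parent by the choice of its rank, the only thing about it that
  the number of parents allowed afterwards depends on.\<close>

lemma sum_ranks:
  fixes f :: "nat \<Rightarrow> nat"
  assumes "finite (A :: nat set)"
  shows "(\<Sum>q\<in>A. f (card {q'\<in>A. q' \<le> q})) = (\<Sum>j=1..card A. f j)"
  using assms
proof (induction A rule: finite_linorder_max_induct)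
  case (insert b A)
  have "b \<notin> A" using insert by auto
  have "{q' \<in> insert b A. q' \<le> b} = insert b A" using insert by auto
  moreover have "{q' \<in> insert b A. q' \<le> q} = {q' \<in> A. q' \<le> q}" if "q \<in> A" for q
    using insert that by force
  ultimately show ?case using insert \<open>b \<notin> A\<close> by (simp add: add.commute)
qed simp

lemma finite_allowed_parents [simp]: "finite (allowed_parents p n)"
  by (simp add: allowed_parents_def)

lemma parent_maps_Suc:
  assumes n: "n \<ge> 1"
  shows "parent_maps (Suc n) = (\<lambda>(p, q). p(Suc n := q)) ` (SIGMA p:parent_maps n. allowed_parents p n)"
    (is "_ = ?f ` ?D")
proof
  show "parent_maps (Suc n) \<subseteq> ?f ` ?D"
  proof
    fix p assume p: "p \<in> parent_maps (Suc n)"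
    define p' where "p' = restrict p {2..n}"
    have "p' \<in> parent_maps n" using p by (auto simp: parent_maps_def p'_def)
    moreover have "p (Suc n) \<in> allowed_parents p' n"
      using parent[OF p, of "Suc n"] parent_cross[OF p, of "Suc n"] n
      by (auto simp: allowed_parents_def p'_def)
    moreover have "p = p'(Suc n := p (Suc n))"
      using p n by (auto simp: fun_eq_iff p'_def parent_maps_def extensional_def)
    ultimately show "p \<in> ?f ` ?D" by (intro image_eqI[of _ _ "(p', p (Suc n))"]) auto
  qed
  show "?f ` ?D \<subseteq> parent_maps (Suc n)"
  proof
    fix p' assume "p' \<in> ?f ` ?D"
    then obtain p q where p: "p \<in> parent_maps n" and q: "q \<in> allowed_parents p n" and p': "p' = p(Suc n := q)"
      by auto
    have "1 \<le> p' m \<and> p' m < m" if "m \<in> {2..Suc n}" for m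
      using that parent[OF p, of m] q by (auto simp: p' allowed_parents_def)
    moreover have "m \<le> p' l \<or> p' l \<le> p' m" if "l \<in> {2..Suc n}" "m \<in> {2..<l}" for l m
      using that parent_cross[OF p, of l m] q by (auto simp: p' allowed_parents_def)
    moreover have "p' \<in> extensional {2..Suc n}" using p n by (auto simp: p' parent_maps_def extensional_def)
    ultimately show "p' \<in> parent_maps (Suc n)" by (auto simp: parent_maps_def)
  qed
qed

lemma inj_on_parent_maps_Suc:
  "inj_on (\<lambda>(p, q). p(Suc n := q)) (SIGMA p:parent_maps n. allowed_parents p n)"
proof (rule inj_onI, clarify)
  fix p q p' q' assume p: "p \<in> parent_maps n" "p' \<in> parent_maps n" and eq: "p(Suc n := q) = p'(Suc n := q')"
  have "p = p'"
  proof (rule extensionalityI[of _ "{2..n}"])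
    fix m assume "m \<in> {2..n}"
    then show "p m = p' m" using fun_cong[OF eq, of m] by auto
  qed (use p in \<open>auto simp: parent_maps_def\<close>)
  then show "p = p' \<and> q = q'" using fun_cong[OF eq, of "Suc n"] by simp
qed

lemma allowed_parents_Suc:
  assumes "q \<in> allowed_parents p n"
  shows "allowed_parents (p(Suc n := q)) (Suc n) = insert (Suc n) {q' \<in> allowed_parents p n. q' \<le> q}"
  using assms by (auto simp: allowed_parents_def le_Suc_eq)

lemma parent_maps_1: "parent_maps 1 = {\<lambda>_. undefined}"
  by (auto simp: parent_maps_def extensional_def)

lemma finite_parent_maps: "n \<ge> 1 \<Longrightarrow> finite (parent_maps n)"
proof (induction n rule: dec_induct)
  case (step n)
  then show ?case unfolding parent_maps_Suc[OF step(1)] by (intro finite_imageI finite_SigmaI) auto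
qed (simp add: parent_maps_1[unfolded One_nat_def])

text \<open>Both sides count the trees with \<open>k + n\<close> nodes, on the left grouped by their
  first \<open>n\<close> nodes. The general \<open>k\<close> carries the induction: splitting off
  node \<open>Suc n\<close> trades a node for one more extension. At \<open>k = 0\<close> the left
  side is the number of trees.\<close>

lemma sum_ballot_parent_maps:
  "n \<ge> 1 \<Longrightarrow> (\<Sum>p\<in>parent_maps n. ballot (card (allowed_parents p n)) k) = ballot 1 (k + n - 1)"
proof (induction n arbitrary: k rule: dec_induct)
  case base
  have "allowed_parents (\<lambda>_. undefined) 1 = {1}" by (auto simp: allowed_parents_def)
  then show ?case by (simp add: parent_maps_1[unfolded One_nat_def])
next
  case (step n)
  have "(\<Sum>p\<in>parent_maps (Suc n). ballot (card (allowed_parents p (Suc n))) k) =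
      (\<Sum>(p, q)\<in>(SIGMA p:parent_maps n. allowed_parents p n).
        ballot (card (allowed_parents (p(Suc n := q)) (Suc n))) k)"
    unfolding parent_maps_Suc[OF step(1)]
    by (subst sum.reindex[OF inj_on_parent_maps_Suc]) (simp add: case_prod_beta)
  also have "\<dots> = (\<Sum>p\<in>parent_maps n. \<Sum>q\<in>allowed_parents p n.
        ballot (card (allowed_parents (p(Suc n := q)) (Suc n))) k)"
    by (rule sum.Sigma[symmetric]) (use finite_parent_maps[OF step(1)] in auto)
  also have "\<dots> = (\<Sum>p\<in>parent_maps n. ballot (card (allowed_parents p n)) (Suc k))"
  proof (rule sum.cong[OF refl])
    fix p assume "p \<in> parent_maps n"
    have "(\<Sum>q\<in>allowed_parents p n. ballot (card (allowed_parents (p(Suc n := q)) (Suc n))) k) =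
        (\<Sum>q\<in>allowed_parents p n. ballot (Suc (card {q' \<in> allowed_parents p n. q' \<le> q})) k)"
    proof (rule sum.cong[OF refl])
      fix q assume q: "q \<in> allowed_parents p n"
      have "Suc n \<notin> {q' \<in> allowed_parents p n. q' \<le> q}" by (auto simp: allowed_parents_def)
      then show "ballot (card (allowed_parents (p(Suc n := q)) (Suc n))) k =
          ballot (Suc (card {q' \<in> allowed_parents p n. q' \<le> q})) k"
        unfolding allowed_parents_Suc[OF q] by (subst card_insert_disjoint) auto
    qed
    also have "\<dots> = (\<Sum>j=1..card (allowed_parents p n). ballot (Suc j) k)"
      by (rule sum_ranks) simp
    finally show "(\<Sum>q\<in>allowed_parents p n. ballot (card (allowed_parents (p(Suc n := q)) (Suc n))) k) =
        ballot (card (allowed_parents p n)) (Suc k)" by (simp only: ballot.simps(2))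
  qed
  also have "\<dots> = ballot 1 (k + Suc n - 1)" using step.IH[of "Suc k"] by simp
  finally show ?case .
qed

lemma card_parent_maps: "n \<ge> 1 \<Longrightarrow> card (parent_maps n) = catalan n"
  using sum_ballot_parent_maps[of n 0] ballot_eq_catalan[of n] by simp

section \<open>The representation on the cohomology\<close>

text \<open>\<open>M\<close> is a common model for both sides, later the free module on the rising
  chains; the isomorphism is \<open>\<Psi>\<close> after the inverse of
  \<open>\<Phi>\<close>.\<close>

lemma isomorphic_repsI:
  fixes M :: "('k::comm_ring_1, 'm) module"
  assumes M: "module (ring_of_type_algebra :: 'k ring) M"
    and \<Phi>: "linear_bij \<Phi> M H" and \<Psi>: "linear_bij \<Psi> M D"
    and act: "\<And>g u. \<lbrakk>g \<in> carrier G; u \<in> carrier M\<rbrakk> \<Longrightarrow> \<gamma> g u \<in> carrier M"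
    and \<alpha>: "\<And>g u. \<lbrakk>g \<in> carrier G; u \<in> carrier M\<rbrakk> \<Longrightarrow> \<alpha> g (\<Phi> u) = \<Phi> (\<gamma> g u)"
    and \<beta>: "\<And>g u. \<lbrakk>g \<in> carrier G; u \<in> carrier M\<rbrakk> \<Longrightarrow> \<Psi> (\<gamma> g u) = \<beta> g (\<Psi> u)"
  shows "isomorphic_reps G H \<alpha> D \<beta>"
proof -
  interpret M: module "ring_of_type_algebra :: 'k ring" M by (rule M)
  note \<Phi>D = linear_bijD[OF \<Phi>] and \<Psi>D = linear_bijD[OF \<Psi>]
  define \<phi> where "\<phi> = \<Psi> \<circ> the_inv_into (carrier M) \<Phi>"
  have \<phi>\<Phi>: "\<phi> (\<Phi> u) = \<Psi> u" if "u \<in> carrier M" for u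
    using the_inv_into_f_f[OF bij_betw_imp_inj_on[OF \<Phi>D(1)] that] by (simp add: \<phi>_def)
  have H: "\<exists>u\<in>carrier M. x = \<Phi> u" if "x \<in> carrier H" for x
    using bij_betw_imp_surj_on[OF \<Phi>D(1)] that by (metis imageE)
  have bij: "bij_betw \<phi> (carrier H) (carrier D)"
    unfolding \<phi>_def by (rule bij_betw_trans[OF bij_betw_the_inv_into[OF \<Phi>D(1)] \<Psi>D(1)])
  have add: "\<phi> (x \<oplus>\<^bsub>H\<^esub> y) = \<phi> x \<oplus>\<^bsub>D\<^esub> \<phi> y" if "x \<in> carrier H" "y \<in> carrier H" for x y
  proof -
    obtain u v where uv: "u \<in> carrier M" "v \<in> carrier M" "x = \<Phi> u" "y = \<Phi> v"
      using H \<open>x \<in> carrier H\<close> \<open>y \<in> carrier H\<close> by metis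
    then have "x \<oplus>\<^bsub>H\<^esub> y = \<Phi> (u \<oplus>\<^bsub>M\<^esub> v)" using \<Phi>D(3) by simp
    then show ?thesis using uv \<phi>\<Phi> \<Psi>D(3) M.add.m_closed by simp
  qed
  have smult: "\<phi> (a \<odot>\<^bsub>H\<^esub> x) = a \<odot>\<^bsub>D\<^esub> \<phi> x" if "x \<in> carrier H" for a x
  proof -
    obtain u where u: "u \<in> carrier M" "x = \<Phi> u" using H \<open>x \<in> carrier H\<close> by metis
    then have "a \<odot>\<^bsub>H\<^esub> x = \<Phi> (a \<odot>\<^bsub>M\<^esub> u)" using \<Phi>D(4) by simp
    moreover have "a \<odot>\<^bsub>M\<^esub> u \<in> carrier M" using M.smult_closed[of a u] u by simp
    ultimately show ?thesis using u \<phi>\<Phi> \<Psi>D(4) by simp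
  qed
  have equivariant: "\<phi> (\<alpha> g x) = \<beta> g (\<phi> x)" if g: "g \<in> carrier G" and x: "x \<in> carrier H" for g x
  proof -
    obtain u where u: "u \<in> carrier M" "x = \<Phi> u" using H[OF x] by metis
    then show ?thesis using \<alpha>[OF g] \<beta>[OF g] act[OF g] \<phi>\<Phi> by simp
  qed
  have closed: "\<phi> x \<in> carrier D" if "x \<in> carrier H" for x using bij that bij_betwE by blast
  show ?thesis
    unfolding isomorphic_reps_def
    by (intro bexI[of _ \<phi>]) (use bij add smult equivariant closed in \<open>auto simp: iso_def hom_def\<close>)
qed

context
  fixes n :: nat
  assumes n: "n \<ge> 1"
begin

interpretation nc2: rising_poset "nc2_partitions n" "nc2_order n" labels "{1..n}" "n - 1"
  by (rule rising_poset_nc2[OF n])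

abbreviation "\<P> \<equiv> nc2_partitions n"
abbreviation "\<R> \<equiv> nc2_order n"

lemma card_rising_chains: "card nc2.rising_chains = fact n * catalan n"
proof -
  have "card nc2.rising_chains = card ({h. h permutes {1..n}} \<times> parent_maps n)"
    by (rule bij_betw_same_card[OF bij_tree_chain[OF n], symmetric])
  then show ?thesis
    using card_permutations[of "{1..n}" n] card_parent_maps[OF n] by (simp add: card_cartesian_product)
qed

section \<open>The action of the symmetric group on rising chains\<close>

lemma map_nc2_action_tree_chain:
  "\<lbrakk>g permutes {1..n}; h permutes {1..n}\<rbrakk> \<Longrightarrow>
    map (nc2_action g) (tree_chain n (h, p)) = tree_chain n (g \<circ> h, p)"
  by (simp add: tree_chain_def nc2_action_two_part)

lemma automorphism_nc2_action:
  assumes g: "g permutes {1..n}"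
  shows "nc2.automorphism (nc2_action g) (nc2_action (inv' g))"
proof -
  have g': "inv' g permutes {1..n}" by (rule permutes_inv[OF g])
  have comp: "g \<circ> (inv' g \<circ> h) = h" "inv' g \<circ> (g \<circ> h) = h" for h :: "nat \<Rightarrow> nat"
    using permutes_inv_o[OF g] by (simp_all add: comp_assoc[symmetric])
  have P: "nc2_action k x \<in> \<P>" if k: "k permutes {1..n}" and x: "x \<in> \<P>" for k x
  proof -
    from x obtain h r where h: "h permutes {1..n}" and r: "r \<in> nc_maps n" and x': "x = two_part n h r"
      by (rule ex_two_part)
    then show ?thesis
      using two_part_in[OF permutes_compose[OF h k] r] by (simp add: nc2_action_two_part[OF k h])
  qed
  have inv: "nc2_action (inv' g) (nc2_action g x) = x \<and> nc2_action g (nc2_action (inv' g) x) = x"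
    if x: "x \<in> \<P>" for x
  proof -
    from x obtain h r where h: "h permutes {1..n}" and x': "x = two_part n h r"
      by (rule ex_two_part)
    show ?thesis
      unfolding x' nc2_action_two_part[OF g h] nc2_action_two_part[OF g' h]
        nc2_action_two_part[OF g' permutes_compose[OF h g]] nc2_action_two_part[OF g permutes_compose[OF h g']]
        comp by simp
  qed
  have mono: "(nc2_action k x, nc2_action k y) \<in> \<R>"
    if k: "k permutes {1..n}" and xy: "(x, y) \<in> \<R>" for k x y
  proof -
    have "y \<in> \<P>" using xy by (auto simp: nc2_order_def)
    then obtain h s where h: "h permutes {1..n}" and s: "s \<in> nc_maps n" and y: "y = two_part n h s"
      by (rule ex_two_part)
    from xy obtain r where r: "r \<in> nc_maps n" "x = two_part n h r" "\<forall>i\<in>{1..n}. r (s i) = r i"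
      unfolding y by (rule below_two_part[OF h s])
    show ?thesis
      unfolding y r(2) nc2_action_two_part[OF k h]
      by (rule iffD2[OF two_part_order_iff[OF permutes_compose[OF h k] r(1) s] r(3)])
  qed
  have "(nc2_action g x, nc2_action g y) \<in> \<R> \<longleftrightarrow> (x, y) \<in> \<R>"
    if "x \<in> \<P>" "y \<in> \<P>" for x y
    using mono[OF g, of x y] mono[OF g', of "nc2_action g x" "nc2_action g y"] inv that by auto
  then show ?thesis unfolding nc2.automorphism_def using P[OF g] P[OF g'] inv by blast
qed

lemma cochain_action_apply:
  assumes "g permutes {1..n}"
  shows "cochain_action \<P> \<R> k nc2_action g u zs =
    (if zs \<in> full_chains \<P> \<R> k then u (map (nc2_action (inv' g)) zs) else 0)"
  unfolding cochain_action_def by (rule nc2.linear_extension_map_apply[OF automorphism_nc2_action[OF assms]])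

lemma cochain_action_tree_chain:
  assumes g: "g permutes {1..n}" and h: "h permutes {1..n}" and p: "p \<in> parent_maps n"
  shows "cochain_action \<P> \<R> (n - 1) nc2_action g u (tree_chain n (h, p)) =
    u (tree_chain n (inv' g \<circ> h, p))"
  using tree_chain_rising[OF n h p]
  unfolding cochain_action_apply[OF g] map_nc2_action_tree_chain[OF permutes_inv[OF g] h]
    nc2.rising_chains_def by auto

text \<open>A permutation \<open>g\<close> sends the rising chain of \<open>(h, p)\<close> to that
  of \<open>(g \<circ> h, p)\<close>, so a chain that is not rising is never the image of a rising
  one.\<close>

lemma rising_chains_invariant:
  assumes g: "g permutes {1..n}" and u: "u \<in> carrier (free_module nc2.rising_chains)"
  shows "cochain_action \<P> \<R> (n - 1) nc2_action g u
    \<in> carrier (free_module nc2.rising_chains)"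
proof -
  have "u (map (nc2_action (inv' g)) zs) = 0"
    if zs: "zs \<in> full_chains \<P> \<R> (n - 1)" "zs \<notin> nc2.rising_chains" for zs
  proof (rule ccontr)
    assume "\<not> ?thesis"
    then have "map (nc2_action (inv' g)) zs \<in> nc2.rising_chains" using u by auto
    then obtain h p where hp: "h permutes {1..n}" "p \<in> parent_maps n" "map (nc2_action (inv' g)) zs = tree_chain n (h, p)"
      using rising_imp_tree_chain[OF n] by blast
    have "zs = map (nc2_action g) (tree_chain n (h, p))"
      using nc2.automorphism_full_chains(2)[OF nc2.automorphism_sym[OF automorphism_nc2_action[OF g]] zs(1)] hp(3)
      by simp
    also have "\<dots> = tree_chain n (g \<circ> h, p)" by (rule map_nc2_action_tree_chain[OF g hp(1)])
    also have "\<dots> \<in> nc2.rising_chains" by (rule tree_chain_rising[OF n permutes_compose[OF hp(1) g] hp(2)])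
    finally show False using zs(2) by simp
  qed
  then show ?thesis by (auto simp: cochain_action_apply[OF g])
qed

lemma regular_action_apply:
  assumes g: "g permutes {1..n}" and k: "k permutes {1..n}"
  shows "regular_action (sym_group n) g v k = v (inv' g \<circ> k)"
proof -
  have "regular_action (sym_group n) g v k = (\<Sum>h | h permutes {1..n}. if h = inv' g \<circ> k then v h else 0)"
    unfolding regular_action_def linear_extension_def
  proof (rule sum.cong)
    fix h
    have "k = g \<circ> h \<longleftrightarrow> h = inv' g \<circ> k"
      using permutes_inv_o[OF g] by (metis comp_assoc id_comp)
    then show "v h * symbol (g \<otimes>\<^bsub>sym_group n\<^esub> h) k = (if h = inv' g \<circ> k then v h else 0)"
      by (auto simp: symbol_def sym_group_mult)
  qed (auto simp: sym_group_def)
  also have "\<dots> = v (inv' g \<circ> k)"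
    using permutes_compose[OF k permutes_inv[OF g]] by (simp add: finite_permutations)
  finally show ?thesis .
qed

lemma regular_action_outside:
  assumes "g permutes {1..n}" "\<not> k permutes {1..n}"
  shows "regular_action (sym_group n) g v k = 0"
  unfolding regular_action_def linear_extension_def
  by (rule sum.neutral) (use assms permutes_compose[OF _ assms(1)] in
    \<open>auto simp: sym_group_carrier sym_group_mult symbol_def\<close>)

text \<open>The rising chains with parent map \<open>e i\<close> form one orbit, indexed freely by
  the permutations \<open>h\<close>. The values of \<open>u\<close> on it are the coordinates in
  copy \<open>i\<close> of the regular representation.\<close>

definition tree_coordinates ::
  "(nat \<Rightarrow> nat \<Rightarrow> nat) \<Rightarrow> (two_partition list \<Rightarrow> 'k::comm_ring_1) \<Rightarrow> nat \<Rightarrow> (nat \<Rightarrow> nat) \<Rightarrow> 'k" where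
  "tree_coordinates e u =
    (\<lambda>i\<in>{..<catalan n}. \<lambda>h. if h permutes {1..n} then u (tree_chain n (h, e i)) else 0)"

lemma linear_bij_tree_coordinates:
  assumes e: "bij_betw e {..<catalan n} (parent_maps n)"
  shows "linear_bij (tree_coordinates e) (free_module nc2.rising_chains)
    (direct_power (catalan n) (regular_module (sym_group n)) :: ('k::comm_ring_1, _) module)"
proof -
  let ?C = "{..<catalan n}" and ?M = "free_module nc2.rising_chains :: ('k, _) module"
  let ?D = "direct_power (catalan n) (regular_module (sym_group n)) :: ('k, _) module"
  have D: "carrier ?D = ?C \<rightarrow>\<^sub>E {v. \<forall>h. \<not> h permutes {1..n} \<longrightarrow> v h = 0}"
    by (simp add: direct_power_def regular_module_def sym_group_def)
  have eP: "e i \<in> parent_maps n" if "i < catalan n" for i using bij_betwE[OF e] that by auto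
  have bij: "bij_betw (\<lambda>(h, i). tree_chain n (h, e i)) ({h. h permutes {1..n}} \<times> ?C) nc2.rising_chains"
  proof -
    have "bij_betw (tree_chain n \<circ> map_prod id e) ({h. h permutes {1..n}} \<times> ?C) nc2.rising_chains"
      by (rule bij_betw_trans[OF bij_betw_map_prod[OF bij_betw_id e] bij_tree_chain[OF n]])
    moreover have "tree_chain n \<circ> map_prod id e = (\<lambda>(h, i). tree_chain n (h, e i))" by (auto simp: fun_eq_iff)
    ultimately show ?thesis by simp
  qed
  define J where "J = the_inv_into ({h. h permutes {1..n}} \<times> ?C) (\<lambda>(h, i). tree_chain n (h, e i))"
  have J: "J (tree_chain n (h, e i)) = (h, i)" if "h permutes {1..n}" "i < catalan n" for h i
    using the_inv_into_f_f[OF bij_betw_imp_inj_on[OF bij], of "(h, i)"] that by (simp add: J_def)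
  have ex: "\<exists>h i. h permutes {1..n} \<and> i < catalan n \<and> s = tree_chain n (h, e i)"
    if "s \<in> nc2.rising_chains" for s
    using bij_betw_imp_surj_on[OF bij] that by force
  have "bij_betw (tree_coordinates e) (carrier ?M) (carrier ?D)"
  proof (rule bij_betwI[where g = "\<lambda>v s. if s \<in> nc2.rising_chains then v (snd (J s)) (fst (J s)) else 0"])
    show "tree_coordinates e \<in> carrier ?M \<rightarrow> carrier ?D"
      by (auto simp: tree_coordinates_def D)
    show "(\<lambda>v s. if s \<in> nc2.rising_chains then v (snd (J s)) (fst (J s)) else 0) \<in> carrier ?D \<rightarrow> carrier ?M"
      by auto
  next
    fix u assume u: "u \<in> carrier ?M"
    show "(\<lambda>s. if s \<in> nc2.rising_chains then tree_coordinates e u (snd (J s)) (fst (J s)) else 0) = u"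
    proof
      fix s
      show "(if s \<in> nc2.rising_chains then tree_coordinates e u (snd (J s)) (fst (J s)) else 0) = u s"
      proof (cases "s \<in> nc2.rising_chains")
        case True
        then obtain h i where "h permutes {1..n}" "i < catalan n" "s = tree_chain n (h, e i)" using ex by blast
        then show ?thesis using True J by (simp add: tree_coordinates_def)
      qed (use u in simp)
    qed
  next
    fix v assume v: "v \<in> carrier ?D"
    show "tree_coordinates e (\<lambda>s. if s \<in> nc2.rising_chains then v (snd (J s)) (fst (J s)) else 0) = v"
    proof (rule extensionalityI[of _ ?C])
      fix i assume i: "i \<in> ?C"
      then have "v i \<in> {v. \<forall>h. \<not> h permutes {1..n} \<longrightarrow> v h = 0}" using v unfolding D by blast
      then show "tree_coordinates e (\<lambda>s. if s \<in> nc2.rising_chains then v (snd (J s)) (fst (J s)) else 0) i = v i"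
        using i J tree_chain_rising[OF n _ eP] by (auto simp: tree_coordinates_def fun_eq_iff)
    qed (use v in \<open>auto simp: D tree_coordinates_def PiE_def\<close>)
  qed
  then show ?thesis
    unfolding linear_bij_def
    by (auto simp: tree_coordinates_def direct_power_def regular_module_def fun_eq_iff)
qed

text \<open>\<open>g\<close> moves the index \<open>h\<close> to \<open>g \<circ> h\<close> and
  keeps the parent map, so both actions read off the old value at \<open>inv' g \<circ> h\<close> in
  the same copy.\<close>

lemma tree_coordinates_equivariant:
  assumes e: "bij_betw e {..<catalan n} (parent_maps n)" and g: "g permutes {1..n}"
  shows "tree_coordinates e (cochain_action \<P> \<R> (n - 1) nc2_action g u) =
    power_action (catalan n) (regular_action (sym_group n)) g (tree_coordinates e u)"
proof -
  have "(\<lambda>h. if h permutes {1..n}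
        then cochain_action \<P> \<R> (n - 1) nc2_action g u (tree_chain n (h, e i)) else 0) =
      regular_action (sym_group n) g (\<lambda>h. if h permutes {1..n} then u (tree_chain n (h, e i)) else 0)"
    if "i < catalan n" for i
  proof
    fix h
    have "e i \<in> parent_maps n" using bij_betwE[OF e] that by auto
    then show "(if h permutes {1..n}
        then cochain_action \<P> \<R> (n - 1) nc2_action g u (tree_chain n (h, e i)) else 0) =
      regular_action (sym_group n) g (\<lambda>h. if h permutes {1..n} then u (tree_chain n (h, e i)) else 0) h"
      using permutes_compose[of h "{1..n}" "inv' g"] permutes_inv[OF g]
      by (cases "h permutes {1..n}")
        (simp_all only: cochain_action_tree_chain[OF g] regular_action_apply[OF g]
          regular_action_outside[OF g] if_True if_False not_False_eq_True)
  qed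
  then show ?thesis
    unfolding tree_coordinates_def power_action_def
    by (intro restrict_ext) (simp only: restrict_apply if_True lessThan_iff)
qed

lemma nc2_cohomology:
  shows "\<forall>k. k \<noteq> n - 1 \<longrightarrow>
      carrier (cohomology \<P> \<R> k :: ('k::comm_ring_1, _) module) = {\<zero>\<^bsub>cohomology \<P> \<R> k\<^esub>}"
    and "free_of_rank (cohomology \<P> \<R> (n - 1) :: ('k, _) module) (fact n * catalan n)"
    and "isomorphic_reps (sym_group n) (cohomology \<P> \<R> (n - 1) :: ('k, _) module)
      (cohomology_action \<P> \<R> (n - 1) nc2_action)
      (direct_power (catalan n) (regular_module (sym_group n)))
      (power_action (catalan n) (regular_action (sym_group n)))"
proof -
  show "\<forall>k. k \<noteq> n - 1 \<longrightarrow>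
      carrier (cohomology \<P> \<R> k :: ('k, _) module) = {\<zero>\<^bsub>cohomology \<P> \<R> k\<^esub>}"
    by (intro allI impI nc2.cohomology_trivial)
  note basis = nc2.cohomology_rising_basis[where 'k = 'k]
  show "free_of_rank (cohomology \<P> \<R> (n - 1) :: ('k, _) module) (fact n * catalan n)"
    using free_of_rank_transport[OF basis nc2.finite_rising_chains] by (simp only: card_rising_chains)
  obtain e where e: "bij_betw e {..<catalan n} (parent_maps n)"
    using ex_bij_betw_nat_finite[OF finite_parent_maps[OF n]] card_parent_maps[OF n]
    by (auto simp: atLeast0LessThan)
  show "isomorphic_reps (sym_group n) (cohomology \<P> \<R> (n - 1) :: ('k, _) module)
      (cohomology_action \<P> \<R> (n - 1) nc2_action)
      (direct_power (catalan n) (regular_module (sym_group n)))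
      (power_action (catalan n) (regular_action (sym_group n)))"
  proof (rule isomorphic_repsI[OF module_free_module basis linear_bij_tree_coordinates[OF e],
        where \<gamma> = "cochain_action \<P> \<R> (n - 1) nc2_action"])
    fix g and u :: "two_partition list \<Rightarrow> 'k"
    assume "g \<in> carrier (sym_group n)" and u: "u \<in> carrier (free_module nc2.rising_chains)"
    then have g: "g permutes {1..n}" by (simp add: sym_group_carrier)
    show "cochain_action \<P> \<R> (n - 1) nc2_action g u \<in> carrier (free_module nc2.rising_chains)"
      by (rule rising_chains_invariant[OF g u])
    show "cohomology_action \<P> \<R> (n - 1) nc2_action g (shift (coboundaries \<P> \<R> (n - 1)) u) =
        shift (coboundaries \<P> \<R> (n - 1)) (cochain_action \<P> \<R> (n - 1) nc2_action g u)"
      by (rule nc2.cohomology_action_shift[where \<gamma> = nc2_action and g = g, OF automorphism_nc2_action[OF g]])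
    show "tree_coordinates e (cochain_action \<P> \<R> (n - 1) nc2_action g u) =
        power_action (catalan n) (regular_action (sym_group n)) g (tree_coordinates e u)"
      by (rule tree_coordinates_equivariant[OF e g])
  qed
qed

end

theorem proposition5p8:
  fixes n :: nat
  assumes "n \<ge> 1"
  shows "(\<forall>k. k \<noteq> n - 1 \<longrightarrow>
            carrier (cohomology (nc2_partitions n) (nc2_order n) k
              :: ('k::comm_ring_1, (two_partition list \<Rightarrow> 'k) set) module)
            = {\<zero>\<^bsub>cohomology (nc2_partitions n) (nc2_order n) k\<^esub>}) \<and>
         free_of_rank
           (cohomology (nc2_partitions n) (nc2_order n) (n - 1)
              :: ('k, (two_partition list \<Rightarrow> 'k) set) module)
           (fact n * catalan n) \<and>
         isomorphic_reps (sym_group n)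
           (cohomology (nc2_partitions n) (nc2_order n) (n - 1)
              :: ('k, (two_partition list \<Rightarrow> 'k) set) module)
           (cohomology_action (nc2_partitions n) (nc2_order n) (n - 1) nc2_action)
           (direct_power (catalan n) (regular_module (sym_group n)))
           (power_action (catalan n) (regular_action (sym_group n)))"
  by (intro conjI nc2_cohomology[OF assms])

end
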